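(* There is a fixed-parameter algorithm (parameterized by $k$) that, given a finite totally ordered binary structure $G$ of twin-width $k$, outputs a witness that $G$ has twin-width at most $2^{O(k^4)}$.
   Context: An ordered binary structure is a structure over a fixed finite signature of unary and binary relation symbols that includes a symbol $<$ interpreted as a total order on the domain. "Fixed-parameter algorithm" means running time $f(k)\cdot|G|^{c}$ for a computable function $f$ and a constant $c$. A matrix $M:R\times C\to A$ over a finite alphabet $A$ has a finite totally ordered set $R$ of rows and a finite totally ordered set $C$ of columns. The span of a nonempty set $S$ of columns is the set of all columns between the smallest and the largest element of $S$ (inclusive); likewise for rows. Two sets of columns (or of rows) are in conflict if their spans intersect. A partition of $C$ (or $R$) is $p$-overlapping if every part is in conflict with at most $p$ other parts. A contraction sequence of an $n\times m$ matrix is a sequence $\mathcal P_1,\dots,\mathcal P_{n+m-1}$ of partitions of $R\cup C$ such that $\mathcal P_1$ is the partition into singletons, each $\mathcal P_{i+1}$ arises from $\mathcal P_i$ by merging two row parts or two column parts, and $\mathcal P_{n+m-1}=\{R,C\}$. Let $\mathcal P_i^R,\mathcal P_i^C$ be the induced partitions of $R$ and $C$. The error value of a column part $Q\in\mathcal P_i^C$ is the number of row parts $P\in\mathcal P_i^R$ such that the submatrix with rows $P$ and columns $Q$ is not constant; symmetrically for row parts. A $(p,e)$-sequence is a contraction sequence in which all $\mathcal P_i^R,\mathcal P_i^C$ are $p$-overlapping and all error values are at most $e$. The twin-width of $M$ is the minimum of $p+e$ over all $(p,e)$-sequences of $M$. The matrix encoding of an ordered binary structure $G$ with relations $<,E_1,\dots,E_q$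 is the $|G|\times|G|$ matrix, rows and columns ordered by $<$, whose entry at $(x,y)$ is $(b_1,\dots,b_q)\in\{-1,0,1,2\}^q$ with $b_i=1$ if $E_i(x,y)\wedge\neg E_i(y,x)$, $b_i=-1$ if $\neg E_i(x,y)\wedge E_i(y,x)$, $b_i=2$ if $E_i(x,y)\wedge E_i(y,x)$, and $b_i=0$ otherwise (a unary relation $U$ is treated as the binary relation $\{(x,x):U(x)\}$). The twin-width of $G$ is the twin-width of its matrix encoding. A witness that $G$ has twin-width at most $d$ is a $(p,e)$-sequence of the matrix encoding with $p+e\le d$. *)

theory Defs
  imports "HOL-Library.Disjoint_Sets" "HOL-Library.Landau_Symbols"
begin

section \<open>Twin-width of matrices over ordered index sets\<close>

record ('r, 'c, 'a) matrix =
  rows :: "'r set"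
  row_less :: "'r rel"
  cols :: "'c set"
  col_less :: "'c rel"
  entry :: "'r \<Rightarrow> 'c \<Rightarrow> 'a"

text \<open>All orders below are strict orders \<open>L\<close> on a finite set \<open>X\<close>.\<close>

definition smallest :: "'x rel \<Rightarrow> 'x set \<Rightarrow> 'x \<Rightarrow> bool" where
  "smallest L S a \<longleftrightarrow> a \<in> S \<and> (\<forall>s\<in>S. (a, s) \<in> L\<^sup>=)"

definition largest :: "'x rel \<Rightarrow> 'x set \<Rightarrow> 'x \<Rightarrow> bool" where
  "largest L S b \<longleftrightarrow> b \<in> S \<and> (\<forall>s\<in>S. (s, b) \<in> L\<^sup>=)"

definition span_of :: "'x set \<Rightarrow> 'x rel \<Rightarrow> 'x set \<Rightarrow> 'x set" where
  "span_of X L S =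
     {z \<in> X. \<exists>a b. smallest L S a \<and> largest L S b \<and> (a, z) \<in> L\<^sup>= \<and> (z, b) \<in> L\<^sup>=}"

definition in_conflict :: "'x set \<Rightarrow> 'x rel \<Rightarrow> 'x set \<Rightarrow> 'x set \<Rightarrow> bool" where
  "in_conflict X L S T \<longleftrightarrow> span_of X L S \<inter> span_of X L T \<noteq> {}"

definition overlapping :: "nat \<Rightarrow> 'x set \<Rightarrow> 'x rel \<Rightarrow> 'x set set \<Rightarrow> bool" where
  "overlapping p X L \<P> \<longleftrightarrow>
     (\<forall>S\<in>\<P>. card {T \<in> \<P>. T \<noteq> S \<and> in_conflict X L S T} \<le> p)"

text \<open>A partition of the disjoint union of rows and columns in which no part mixes rows and
  columns is represented by the pair of the induced partitions of the rows and of the columns.\<close>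

definition merge_two :: "'x set set \<Rightarrow> 'x set set \<Rightarrow> bool" where
  "merge_two \<P> \<P>' \<longleftrightarrow>
     (\<exists>S\<in>\<P>. \<exists>T\<in>\<P>. S \<noteq> T \<and> \<P>' = insert (S \<union> T) (\<P> - {S, T}))"

definition contraction_step ::
  "'r set set \<times> 'c set set \<Rightarrow> 'r set set \<times> 'c set set \<Rightarrow> bool" where
  "contraction_step \<P> \<P>' \<longleftrightarrow>
     merge_two (fst \<P>) (fst \<P>') \<and> snd \<P>' = snd \<P> \<or>
     fst \<P>' = fst \<P> \<and> merge_two (snd \<P>) (snd \<P>')"

definition contraction_sequence ::
  "('r, 'c, 'a) matrix \<Rightarrow> ('r set set \<times> 'c set set) list \<Rightarrow> bool" where
  "contraction_sequence M Ps \<longleftrightarrow>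
     length Ps = card (rows M) + card (cols M) - 1 \<and> Ps \<noteq> [] \<and>
     (\<forall>\<P>\<in>set Ps. partition_on (rows M) (fst \<P>) \<and> partition_on (cols M) (snd \<P>)) \<and>
     hd Ps = ((\<lambda>x. {x}) ` rows M, (\<lambda>y. {y}) ` cols M) \<and>
     (\<forall>i. Suc i < length Ps \<longrightarrow> contraction_step (Ps ! i) (Ps ! Suc i)) \<and>
     last Ps = ({rows M}, {cols M})"

definition constant_submatrix :: "('r, 'c, 'a) matrix \<Rightarrow> 'r set \<Rightarrow> 'c set \<Rightarrow> bool" where
  "constant_submatrix M P Q \<longleftrightarrow>
     (\<forall>x\<in>P. \<forall>x'\<in>P. \<forall>y\<in>Q. \<forall>y'\<in>Q. entry M x y = entry M x' y')"

definition col_error :: "('r, 'c, 'a) matrix \<Rightarrow> 'r set set \<Rightarrow> 'c set \<Rightarrow> nat" where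
  "col_error M \<P>R Q = card {P \<in> \<P>R. \<not> constant_submatrix M P Q}"

definition row_error :: "('r, 'c, 'a) matrix \<Rightarrow> 'c set set \<Rightarrow> 'r set \<Rightarrow> nat" where
  "row_error M \<P>C P = card {Q \<in> \<P>C. \<not> constant_submatrix M P Q}"

definition pe_sequence ::
  "('r, 'c, 'a) matrix \<Rightarrow> nat \<Rightarrow> nat \<Rightarrow> ('r set set \<times> 'c set set) list \<Rightarrow> bool" where
  "pe_sequence M p e Ps \<longleftrightarrow>
     contraction_sequence M Ps \<and>
     (\<forall>(\<P>R, \<P>C) \<in> set Ps.
        overlapping p (rows M) (row_less M) \<P>R \<and>
        overlapping p (cols M) (col_less M) \<P>C \<and>
        (\<forall>Q\<in>\<P>C. col_error M \<P>R Q \<le> e) \<and>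
        (\<forall>P\<in>\<P>R. row_error M \<P>C P \<le> e))"

definition twin_width :: "('r, 'c, 'a) matrix \<Rightarrow> nat" where
  "twin_width M = (LEAST d. \<exists>p e Ps. d = p + e \<and> pe_sequence M p e Ps)"


section \<open>Ordered binary structures\<close>

record 'a ostruct =
  universe :: "'a set"
  less_rel :: "'a rel"
  unary :: "'a set list"
  binary :: "'a rel list"

text \<open>The signature consists of the order symbol, \<open>u\<close> unary and \<open>b\<close> further binary symbols.\<close>

definition ordered_binary_structure :: "nat \<Rightarrow> nat \<Rightarrow> 'a ostruct \<Rightarrow> bool" where
  "ordered_binary_structure u b G \<longleftrightarrow>
     finite (universe G) \<and> universe G \<noteq> {} \<and>
     less_rel G \<subseteq> universe G \<times> universe G \<and>
     strict_linear_order_on (universe G) (less_rel G) \<and>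
     length (unary G) = u \<and> (\<forall>U\<in>set (unary G). U \<subseteq> universe G) \<and>
     length (binary G) = b \<and> (\<forall>E\<in>set (binary G). E \<subseteq> universe G \<times> universe G)"

definition entry_code :: "'a rel \<Rightarrow> 'a \<Rightarrow> 'a \<Rightarrow> int" where
  "entry_code E x y =
     (if (x, y) \<in> E \<and> (y, x) \<notin> E then 1
      else if (x, y) \<notin> E \<and> (y, x) \<in> E then -1
      else if (x, y) \<in> E \<and> (y, x) \<in> E then 2
      else 0)"

definition matrix_encoding :: "'a ostruct \<Rightarrow> ('a, 'a, int list) matrix" where
  "matrix_encoding G =
     \<lparr>rows = universe G, row_less = less_rel G,
      cols = universe G, col_less = less_rel G,
      entry = (\<lambda>x y. map (\<lambda>E. entry_code E x y) (map Id_on (unary G) @ binary G))\<rparr>"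

definition struct_twin_width :: "'a ostruct \<Rightarrow> nat" where
  "struct_twin_width G = twin_width (matrix_encoding G)"

definition twin_width_witness ::
  "'a ostruct \<Rightarrow> nat \<Rightarrow> ('a set set \<times> 'a set set) list \<Rightarrow> bool" where
  "twin_width_witness G d Ps \<longleftrightarrow>
     (\<exists>p e. p + e \<le> d \<and> pe_sequence (matrix_encoding G) p e Ps)"


section \<open>Model of computation\<close>

text \<open>Algorithms are programs of a first-order, call-by-value functional language over binary
  trees (pure Lisp with \<open>nil\<close> as its only atom), after N. D. Jones, Computability and Complexity
  from a Programming Perspective (MIT Press, 1997). Every evaluation step costs one unit. Since
  values can be shared in memory, and there is no primitive test for equality of trees, each step
  takes constant time on a pointer machine; so the model is Turing complete and running times
  agree with those of Turing machines and random access machines up to a polynomial.\<close>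

datatype tree = Leaf | Node tree tree

datatype expr =
    Var nat
  | LeafE
  | NodeE expr expr
  | LeftE expr
  | RightE expr
  | IfNode expr expr expr
  | Call nat "expr list"

text \<open>A program is the list of its function bodies. In a body, \<open>Var i\<close> is the \<open>i\<close>-th argument
  and \<open>Call f\<close> calls the \<open>f\<close>-th function; function 0 is the main function.\<close>

type_synonym program = "expr list"

fun left :: "tree \<Rightarrow> tree" where
  "left Leaf = Leaf"
| "left (Node x y) = x"

fun right :: "tree \<Rightarrow> tree" where
  "right Leaf = Leaf"
| "right (Node x y) = y"

text \<open>\<open>evaluates \<pi> \<rho> a v t\<close>: in environment \<open>\<rho>\<close> the expression \<open>a\<close> evaluates to \<open>v\<close> in exactly \<open>t\<close> steps.
  Non-terminating evaluations, and those referring to missing variables or functions, have no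
  derivation.\<close>

inductive evaluates :: "program \<Rightarrow> tree list \<Rightarrow> expr \<Rightarrow> tree \<Rightarrow> nat \<Rightarrow> bool"
  and evaluates_list :: "program \<Rightarrow> tree list \<Rightarrow> expr list \<Rightarrow> tree list \<Rightarrow> nat \<Rightarrow> bool"
  for \<pi> :: program
where
  eval_Var: "i < length \<rho> \<Longrightarrow> evaluates \<pi> \<rho> (Var i) (\<rho> ! i) 1"
| eval_LeafE: "evaluates \<pi> \<rho> LeafE Leaf 1"
| eval_NodeE: "evaluates \<pi> \<rho> a v s \<Longrightarrow> evaluates \<pi> \<rho> b w t \<Longrightarrow> evaluates \<pi> \<rho> (NodeE a b) (Node v w) (s + t + 1)"
| eval_Left: "evaluates \<pi> \<rho> a v t \<Longrightarrow> evaluates \<pi> \<rho> (LeftE a) (left v) (t + 1)"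
| eval_Right: "evaluates \<pi> \<rho> a v t \<Longrightarrow> evaluates \<pi> \<rho> (RightE a) (right v) (t + 1)"
| eval_If_Node: "evaluates \<pi> \<rho> a (Node x y) s \<Longrightarrow> evaluates \<pi> \<rho> b v t \<Longrightarrow> evaluates \<pi> \<rho> (IfNode a b c) v (s + t + 1)"
| eval_If_Leaf: "evaluates \<pi> \<rho> a Leaf s \<Longrightarrow> evaluates \<pi> \<rho> c v t \<Longrightarrow> evaluates \<pi> \<rho> (IfNode a b c) v (s + t + 1)"
| eval_Call: "evaluates_list \<pi> \<rho> as vs s \<Longrightarrow> f < length \<pi> \<Longrightarrow> evaluates \<pi> vs (\<pi> ! f) v t \<Longrightarrow>
    evaluates \<pi> \<rho> (Call f as) v (s + t + 1)"
| evals_Nil: "evaluates_list \<pi> \<rho> [] [] 0"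
| evals_Cons: "evaluates \<pi> \<rho> a v s \<Longrightarrow> evaluates_list \<pi> \<rho> as vs t \<Longrightarrow> evaluates_list \<pi> \<rho> (a # as) (v # vs) (s + t)"

inductive_cases eval_elims:
  "evaluates \<pi> \<rho> (Var i) v t" "evaluates \<pi> \<rho> LeafE v t" "evaluates \<pi> \<rho> (NodeE a b) v t"
  "evaluates \<pi> \<rho> (LeftE a) v t" "evaluates \<pi> \<rho> (RightE a) v t" "evaluates \<pi> \<rho> (IfNode a b c) v t"
  "evaluates \<pi> \<rho> (Call f as) v t" "evaluates_list \<pi> \<rho> [] vs t" "evaluates_list \<pi> \<rho> (a # as) vs t"

lemma eval_deterministic:
  "evaluates \<pi> \<rho> a v t \<Longrightarrow> \<forall>v' t'. evaluates \<pi> \<rho> a v' t' \<longrightarrow> v' = v \<and> t' = t"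
  "evaluates_list \<pi> \<rho> as vs t \<Longrightarrow> \<forall>vs' t'. evaluates_list \<pi> \<rho> as vs' t' \<longrightarrow> vs' = vs \<and> t' = t"
proof (induction rule: evaluates_evaluates_list.inducts)
  case (eval_If_Node \<rho> a x y s b v t c)
  show ?case
  proof (intro allI impI)
    fix v' t'
    assume "evaluates \<pi> \<rho> (IfNode a b c) v' t'"
    then show "v' = v \<and> t' = s + t + 1"
    proof (rule eval_elims(6))
      fix s' t'' assume "evaluates \<pi> \<rho> a Leaf s'"
      with eval_If_Node.IH have "Leaf = Node x y" by blast
      then show ?thesis by simp
    qed (use eval_If_Node.IH in \<open>metis Suc_eq_plus1\<close>)
  qed
next
  case (eval_If_Leaf \<rho> a s c v t b)
  show ?case
  proof (intro allI impI)
    fix v' t'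
    assume "evaluates \<pi> \<rho> (IfNode a b c) v' t'"
    then show "v' = v \<and> t' = s + t + 1"
    proof (rule eval_elims(6))
      fix x y s' assume "evaluates \<pi> \<rho> a (Node x y) s'"
      with eval_If_Leaf.IH have "Node x y = Leaf" by blast
      then show ?thesis by simp
    qed (use eval_If_Leaf.IH in \<open>metis Suc_eq_plus1\<close>)
  qed
qed (intro allI impI, erule eval_elims, metis Suc_eq_plus1 One_nat_def)+

definition runs :: "program \<Rightarrow> tree \<Rightarrow> tree \<Rightarrow> nat \<Rightarrow> bool" where
  "runs \<pi> inp out t \<longleftrightarrow> evaluates \<pi> [inp] (Call 0 [Var 0]) out t"


subsection \<open>Encodings of inputs and outputs\<close>

text \<open>Numbers are encoded in unary, as lists of leaves.\<close>

definition enc_list :: "('a \<Rightarrow> tree) \<Rightarrow> 'a list \<Rightarrow> tree" where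
  "enc_list enc xs = foldr (\<lambda>x t. Node (enc x) t) xs Leaf"

definition enc_nat :: "nat \<Rightarrow> tree" where
  "enc_nat n = enc_list (\<lambda>_. Leaf) [0..<n]"

definition enc_bool :: "bool \<Rightarrow> tree" where
  "enc_bool P = (if P then Node Leaf Leaf else Leaf)"

definition enc_prod :: "('a \<Rightarrow> tree) \<Rightarrow> ('b \<Rightarrow> tree) \<Rightarrow> 'a \<times> 'b \<Rightarrow> tree" where
  "enc_prod enc1 enc2 z = Node (enc1 (fst z)) (enc2 (snd z))"

definition enc_set :: "nat \<Rightarrow> nat set \<Rightarrow> tree" where
  "enc_set n U = enc_list (\<lambda>x. enc_bool (x \<in> U)) [0..<n]"

definition enc_rel :: "nat \<Rightarrow> nat rel \<Rightarrow> tree" where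
  "enc_rel n E = enc_list (\<lambda>x. enc_list (\<lambda>y. enc_bool ((x, y) \<in> E)) [0..<n]) [0..<n]"

text \<open>As usual for algorithms on structures, the elements of an input structure are the numbers
  \<open>0, ..., n - 1\<close>. The order relation of the structure is unrelated to the order of
  these numbers, and is part of the input like every other relation.\<close>

definition enc_struct :: "nat ostruct \<Rightarrow> tree" where
  "enc_struct G =
     (let n = card (universe G) in
      enc_list id
        [enc_nat n, enc_rel n (less_rel G),
         enc_list (enc_set n) (unary G), enc_list (enc_rel n) (binary G)])"

text \<open>Outputs list all pairs of partitions explicitly; a partition is a list of parts, and a part
  is a list of elements.\<close>

type_synonym listed_sequence = "(nat list list \<times> nat list list) list"

definition enc_sequence :: "listed_sequence \<Rightarrow> tree" where
  "enc_sequence =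
     enc_list (enc_prod (enc_list (enc_list enc_nat)) (enc_list (enc_list enc_nat)))"

definition partitions_of :: "listed_sequence \<Rightarrow> (nat set set \<times> nat set set) list" where
  "partitions_of = map (\<lambda>(Rs, Cs). (set (map set Rs), set (map set Cs)))"

definition computable :: "(nat \<Rightarrow> nat) \<Rightarrow> bool" where
  "computable f \<longleftrightarrow> (\<exists>\<pi>. \<forall>n. \<exists>t. runs \<pi> (enc_nat n) (enc_nat (f n)) t)"

end

theory Submission
  imports Defs "HOL-Library.FuncSet" "HOL-Library.Multiset"
begin

text \<open>
  In a matrix encoding, equality of two entries is preserved by transposition, so rows and columns
  can be treated alike. A division cuts the ordered universe into consecutive intervals, its parts;
  two of them form a zone of the matrix. Two rows have the same type on a set of columns if they
  agree there. For a parameter \<open>l\<close>, the algorithm starts with the division into single elements and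
  merges consecutive parts \<open>R\<close>, \<open>R'\<close> whenever some \<open>l\<^sup>3\<close> parts can be exempted so that the rows of
  \<open>R \<union> R'\<close> have at most \<open>l\<close> types outside them. A greedy test (\<open>mergeable\<close>) recognises all unions
  for which exempting \<open>l\<^sup>2\<close> parts is enough.

  From divisions to a contraction sequence. A zone is mixed if it has more than \<open>l\<close> types of rows
  and more than \<open>l\<close> types of columns; a part has at most \<open>l\<^sup>3\<close> mixed zones. Over an alphabet of size
  \<open>\<alpha>\<close>, a zone that is not mixed has at most \<open>\<alpha>\<^sup>l\<close> types of rows (\<open>row_types_le_power\<close>). Split each part
  into the classes of rows that agree on all its zones that are not mixed. This gives at most
  \<open>l\<close> times \<open>\<alpha>\<^sup>l\<close> to the power of \<open>l\<^sup>3\<close>, hence \<open>2\<close> to the power of \<open>O(l\<^sup>4)\<close>, classes (\<open>few_classes\<close>).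
  Classes in different parts are not in conflict, and two classes span a constant submatrix
  unless their zone is mixed (\<open>compatible_overlapping\<close>, \<open>compatible_error\<close>). Mixed zones stay mixed
  when parts are merged. So the classes of a division refine those of the next one, and merging two
  classes at a time leads from one division to the next and yields the desired sequence
  (\<open>attempt_result\<close>).

  Why the algorithm does not get stuck. In a sequence with overlaps at most \<open>p\<close> and errors at most \<open>e\<close>,
  consider the first time that the span of a part of the partition covers two consecutive intervals
  of a given division, say for rows. Only \<open>p + 1\<close> row parts meet these intervals, they have errors
  with at most \<open>(p + 1) e\<close> column parts, and as those do not cover two consecutive intervals, each
  touches at most three. Exempting these intervals leaves \<open>p + 1\<close> types of rows
  (\<open>few_types_of_pe_sequence\<close>). For twin-width \<open>k\<close> the algorithm thus succeeds with \<open>l = 2 k + 2\<close>. It also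
  succeeds as soon as \<open>l\<close> reaches the number \<open>n\<close> of elements. So the values \<open>1, ..., n + 1\<close> are tried
  in turn, in time polynomial in \<open>n\<close> alone.

  The running time is established without writing a program: the relation \<open>ptime\<close> between inputs and
  an output states that a program with polynomial running time exists. It is closed under
  composition and under recursion with results of polynomial size (\<open>ptime_rec_list\<close>), and the
  algorithm, a composition of such recursions on lists, is covered by these rules.
\<close>

section \<open>Row types\<close>

definition row_types :: "('a \<Rightarrow> 'b \<Rightarrow> 'c) \<Rightarrow> 'a set \<Rightarrow> 'b set \<Rightarrow> nat" where
  "row_types M X Y = card ((\<lambda>x. restrict (M x) Y) ` X)"

lemma restrict_eq_iff: "restrict f Y = restrict g Y \<longleftrightarrow> (\<forall>y\<in>Y. f y = g y)"
  by (auto simp: restrict_def fun_eq_iff)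

lemma row_types_mono:
  assumes "X \<subseteq> X'" "Y \<subseteq> Y'" "finite X'"
  shows "row_types M X Y \<le> row_types M X' Y'"
proof -
  have "(\<lambda>x. restrict (M x) Y) ` X = (\<lambda>f. restrict f Y) ` (\<lambda>x. restrict (M x) Y') ` X"
    using assms(2) by (simp add: image_image Int_absorb1)
  then have "row_types M X Y \<le> card ((\<lambda>x. restrict (M x) Y') ` X)"
    unfolding row_types_def using assms by (metis card_image_le finite_imageI finite_subset)
  also have "\<dots> \<le> row_types M X' Y'"
    unfolding row_types_def using assms by (intro card_mono) auto
  finally show ?thesis .
qed

lemma row_types_le_card: "finite X \<Longrightarrow> row_types M X Y \<le> card X"
  unfolding row_types_def by (rule card_image_le)

lemma row_types_Un:
  assumes "finite X"
  shows "row_types M X (Y \<union> Z) \<le> row_types M X Y * row_types M X Z"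
proof -
  let ?f = "\<lambda>W x. restrict (M x) W"
  have "(\<lambda>f. (restrict f Y, restrict f Z)) ` (?f (Y \<union> Z) ` X) \<subseteq> ?f Y ` X \<times> ?f Z ` X"
    by (auto simp: Int_absorb1)
  moreover have "inj_on (\<lambda>f. (restrict f Y, restrict f Z)) (?f (Y \<union> Z) ` X)"
    by (intro inj_onI, clarify) (auto simp: restrict_eq_iff)
  ultimately have "card (?f (Y \<union> Z) ` X) \<le> card (?f Y ` X \<times> ?f Z ` X)"
    by (intro card_inj_on_le) (use assms in auto)
  then show ?thesis by (simp add: row_types_def card_cartesian_product)
qed

lemma row_types_Union:
  assumes "finite X" "finite \<Y>" "\<And>Y. Y \<in> \<Y> \<Longrightarrow> row_types M X Y \<le> b"
  shows "row_types M X (\<Union>\<Y>) \<le> b ^ card \<Y>"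
  using assms(2,3)
proof (induction \<Y>)
  case empty
  then show ?case by (simp add: row_types_def restrict_def image_constant_conv)
next
  case (insert Y \<Y>)
  have "row_types M X (\<Union>(insert Y \<Y>)) \<le> row_types M X Y * row_types M X (\<Union>\<Y>)"
    using row_types_Un[OF assms(1)] by simp
  also have "\<dots> \<le> b * b ^ card \<Y>" using insert by (intro mult_mono) auto
  finally show ?case using insert by simp
qed

lemma card_le_row_types:
  assumes "finite X" "Z \<subseteq> X" "\<And>x x'. x \<in> Z \<Longrightarrow> x' \<in> Z \<Longrightarrow> (\<forall>y\<in>Y. M x y = M x' y) \<Longrightarrow> x = x'"
  shows "card Z \<le> row_types M X Y"
proof -
  have "inj_on (\<lambda>x. restrict (M x) Y) Z" using assms(3) by (auto simp: inj_on_def restrict_eq_iff)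
  then have "card Z = card ((\<lambda>x. restrict (M x) Y) ` Z)" by (simp add: card_image)
  also have "\<dots> \<le> row_types M X Y" unfolding row_types_def using assms by (intro card_mono) auto
  finally show ?thesis .
qed

text \<open>A row is determined by its entries in one representative of each column type, so there are no
  more rows than functions from the column types to the alphabet.\<close>

lemma row_types_le_power:
  assumes transposed: "\<And>x y x' y'. M x y = M x' y' \<longleftrightarrow> M y x = M y' x'"
    and alphabet: "\<And>x y. M x y \<in> \<Sigma>" "finite \<Sigma>"
    and fin: "finite X" "finite Y"
  shows "row_types M X Y \<le> card \<Sigma> ^ row_types M Y X"
proof -
  let ?col = "\<lambda>y. restrict (M y) X"
  let ?rep = "inv_into Y ?col"
  define g where "g f = restrict (\<lambda>q. f (?rep q)) (?col ` Y)" for f :: "'a \<Rightarrow> 'b"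
  let ?rows = "(\<lambda>x. restrict (M x) Y) ` X"
  have same: "M x y = M x (?rep (?col y))" if "x \<in> X" "y \<in> Y" for x y
  proof -
    have "?col (?rep (?col y)) = ?col y" using that by (intro f_inv_into_f) auto
    then have "M (?rep (?col y)) x = M y x" using that by (simp add: restrict_eq_iff)
    then show ?thesis using transposed by metis
  qed
  have rep: "?rep q \<in> Y" if "q \<in> ?col ` Y" for q using that by (rule inv_into_into)
  have "inj_on g ?rows"
  proof (intro inj_onI, clarify)
    fix x x' assume x: "x \<in> X" "x' \<in> X" and eq: "g (restrict (M x) Y) = g (restrict (M x') Y)"
    have "M x y = M x' y" if y: "y \<in> Y" for y
    proof -
      have "M x (?rep (?col y)) = M x' (?rep (?col y))"
        using fun_cong[OF eq, of "?col y"] y rep[of "?col y"] by (simp add: g_def)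
      then show ?thesis using same[OF x(1) y] same[OF x(2) y] by simp
    qed
    then show "restrict (M x) Y = restrict (M x') Y" by (simp add: restrict_eq_iff)
  qed
  moreover have "g ` ?rows \<subseteq> ?col ` Y \<rightarrow>\<^sub>E \<Sigma>"
    using rep alphabet by (auto simp: g_def)
  moreover have "finite (?col ` Y \<rightarrow>\<^sub>E \<Sigma>)" using fin alphabet by (intro finite_PiE) auto
  ultimately have "card ?rows \<le> card (?col ` Y \<rightarrow>\<^sub>E \<Sigma>)" by (intro card_inj_on_le)
  then show ?thesis using fin by (simp add: row_types_def card_funcsetE)
qed

text \<open>Restriction maps the types on \<open>Y \<union> Z\<close> onto the types on \<open>Y\<close>. If there are no more of the former
  than of the latter, it is injective, and the type on \<open>Y\<close> determines the type on \<open>Z\<close>.\<close>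

lemma row_types_eq_imp_agree:
  assumes fin: "finite X" and le: "row_types M X (Y \<union> Z) \<le> row_types M X Y"
    and x: "x \<in> X" "x' \<in> X" and eq: "\<forall>y\<in>Y. M x y = M x' y"
  shows "\<forall>z\<in>Z. M x z = M x' z"
proof -
  let ?f = "\<lambda>W x. restrict (M x) W"
  have "(\<lambda>f. restrict f Y) ` (?f (Y \<union> Z) ` X) = ?f Y ` X"
    by (simp add: image_image Int_absorb1)
  moreover have "card (?f (Y \<union> Z) ` X) = card (?f Y ` X)"
    using le row_types_mono[of X X Y "Y \<union> Z" M] fin unfolding row_types_def by auto
  ultimately have "inj_on (\<lambda>f. restrict f Y) (?f (Y \<union> Z) ` X)"
    using fin by (intro eq_card_imp_inj_on) auto
  moreover have "restrict (?f (Y \<union> Z) x) Y = restrict (?f (Y \<union> Z) x') Y"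
    using eq by (simp add: restrict_eq_iff)
  ultimately have "?f (Y \<union> Z) x = ?f (Y \<union> Z) x'"
    using inj_onD[of "\<lambda>f. restrict f Y" "?f (Y \<union> Z) ` X" "?f (Y \<union> Z) x" "?f (Y \<union> Z) x'"]
      imageI[OF x(1), of "?f (Y \<union> Z)"] imageI[OF x(2), of "?f (Y \<union> Z)"] by satx
  then show ?thesis by (simp add: restrict_eq_iff)
qed

lemma row_types_pos: "finite X \<Longrightarrow> X \<noteq> {} \<Longrightarrow> 0 < row_types M X Y"
  by (simp add: row_types_def card_gt_0_iff)

section \<open>Testing whether few row types remain after removing few parts\<close>

text \<open>Tells whether the entries at two positions are equal. The search accesses the matrix only in this way.\<close>

type_synonym entry_test = "nat \<Rightarrow> nat \<Rightarrow> nat \<Rightarrow> nat \<Rightarrow> bool"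

definition agree :: "entry_test \<Rightarrow> nat list \<Rightarrow> nat \<Rightarrow> nat \<Rightarrow> bool" where
  "agree s C x x' \<longleftrightarrow> list_all (\<lambda>y. s x y x' y) C"

definition reps :: "entry_test \<Rightarrow> nat list \<Rightarrow> nat list \<Rightarrow> nat list" where
  "reps s C R = foldr (\<lambda>x rs. if list_ex (agree s C x) rs then rs else x # rs) R []"

definition num_types :: "entry_test \<Rightarrow> nat list \<Rightarrow> nat list list \<Rightarrow> nat" where
  "num_types s R W = length (reps s (concat W) R)"

text \<open>Collects in the first component parts that distinguish rows of \<open>R\<close> which the parts collected before
  do not distinguish, until there are more than \<open>l\<close> types. Every collected part raises the number of
  types, so at most \<open>l\<close> parts are collected.\<close>

definition scan ::
  "entry_test \<Rightarrow> nat \<Rightarrow> nat list \<Rightarrow> nat list list \<Rightarrow> nat list list \<times> nat list list"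
where
  "scan s l R Cs = foldr (\<lambda>C z.
     if num_types s R (fst z) \<le> l \<and> num_types s R (fst z) < num_types s R (C # fst z)
     then (C # fst z, snd z) else (fst z, C # snd z)) Cs ([], [])"

lemma scan_Cons:
  "scan s l R (C # Cs) = (let (W, S) = scan s l R Cs in
     if num_types s R W \<le> l \<and> num_types s R W < num_types s R (C # W) then (C # W, S) else (W, C # S))"
  by (simp add: scan_def case_prod_beta Let_def)

text \<open>Discards the parts collected by \<open>scan\<close>. As long as \<open>R\<close> has more than \<open>l\<close> types, this hits every set of
  parts whose removal would leave at most \<open>l\<close> types.\<close>

definition prune ::
  "entry_test \<Rightarrow> nat \<Rightarrow> nat list \<Rightarrow> nat list list \<Rightarrow> nat list list" where
  "prune s l R Cs = snd (scan s l R Cs)"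

text \<open>A greedy hitting set computation. It removes at most \<open>l * l * l\<close> parts. Suppose that removing some set
  of \<open>l * l\<close> parts leaves at most \<open>l\<close> types; as every round that starts with more than \<open>l\<close> types
  removes a member of this set, \<open>l * l\<close> rounds are enough to get down to \<open>l\<close> types.\<close>

definition mergeable ::
  "entry_test \<Rightarrow> nat \<Rightarrow> nat list \<Rightarrow> nat list list \<Rightarrow> bool" where
  "mergeable s l R Cs \<longleftrightarrow> num_types s R ((prune s l R ^^ (l * l)) Cs) \<le> l"

text \<open>In a matrix encoding, transposition permutes the alphabet; therefore equality of entries is
  preserved, and the types of the columns of a zone are the row types of the transposed zone.\<close>

locale symmetric_matrix =
  fixes M :: "nat \<Rightarrow> nat \<Rightarrow> 'b"
  assumes transposed: "M x y = M x' y' \<longleftrightarrow> M y x = M y' x'"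
begin

abbreviation same :: "nat \<Rightarrow> nat \<Rightarrow> nat \<Rightarrow> nat \<Rightarrow> bool" where
  "same x y x' y' \<equiv> M x y = M x' y'"

abbreviation cells :: "nat list set \<Rightarrow> nat set" where
  "cells \<C> \<equiv> \<Union>(set ` \<C>)"

lemma agree_iff: "agree same C x x' \<longleftrightarrow> (\<forall>y\<in>set C. M x y = M x' y)"
  by (simp add: agree_def list_all_iff)

lemma length_reps: "length (reps same C R) = row_types M (set R) (set C)"
proof -
  define f where "f x = restrict (M x) (set C)" for x
  have "distinct (map f (reps same C R)) \<and> f ` set (reps same C R) = f ` set R"
  proof (induction R)
    case Nil
    then show ?case by (simp add: reps_def)
  next
    case (Cons x R)
    have ex: "list_ex (agree same C x) rs \<longleftrightarrow> f x \<in> f ` set rs" for rs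
      by (simp add: list_ex_iff agree_iff image_iff f_def restrict_eq_iff)
    have step: "reps same C (x # R) =
        (if f x \<in> f ` set (reps same C R) then reps same C R else x # reps same C R)"
      unfolding ex[symmetric] by (simp add: reps_def)
    show ?case
    proof (cases "f x \<in> f ` set R")
      case True
      then have "reps same C (x # R) = reps same C R" using Cons step by presburger
      then show ?thesis using Cons True by auto
    next
      case False
      then have "reps same C (x # R) = x # reps same C R" using Cons step by presburger
      then show ?thesis using Cons False by auto
    qed
  qed
  then have "length (reps same C R) = card (f ` set R)"
    using distinct_card[of "map f (reps same C R)"] by simp
  then show ?thesis by (simp add: row_types_def f_def)
qed

lemma num_types_eq: "num_types same R W = row_types M (set R) (cells (set W))"
  by (simp add: num_types_def length_reps)

text \<open>The number of types starts at 1 and grows with every collected part, whence the strict inequality.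
  If the collected parts \<open>W\<close> have at most \<open>l\<close> types, then no other part was able to separate
  rows that agree on \<open>W\<close>.\<close>

lemma scan_invariant:
  assumes "R \<noteq> []" and "scan same l R Cs = (W, S)"
  shows "mset W + mset S = mset Cs \<and> length W \<le> l \<and> length W < num_types same R W \<and>
    (num_types same R W \<le> l \<longrightarrow> (\<forall>x\<in>set R. \<forall>x'\<in>set R.
       (\<forall>y\<in>cells (set W). M x y = M x' y) \<longrightarrow> (\<forall>y\<in>cells (set Cs). M x y = M x' y)))"
  using assms(2)
proof (induction Cs arbitrary: W S)
  case Nil
  have "0 < num_types same R []"
    using assms(1) row_types_pos[of "set R" M] by (simp add: num_types_eq)
  then show ?case using Nil by (simp add: scan_def)
next
  case (Cons C Cs)
  obtain W0 S0 where z: "scan same l R Cs = (W0, S0)" by (cases "scan same l R Cs")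
  note IH = Cons.IH[OF z]
  have IH1: "mset W0 + mset S0 = mset Cs" "length W0 \<le> l" "length W0 < num_types same R W0"
    using IH by blast+
  have step: "(W, S) = (if num_types same R W0 \<le> l \<and> num_types same R W0 < num_types same R (C # W0)
      then (C # W0, S0) else (W0, C # S0))"
    using Cons.prems by (simp add: scan_Cons z)
  have "\<forall>y\<in>cells (set (C # Cs)). M x y = M x' y"
    if W: "num_types same R W \<le> l" and x: "x \<in> set R" "x' \<in> set R"
      and eq: "\<forall>y\<in>cells (set W). M x y = M x' y" for x x'
  proof (cases "num_types same R W0 \<le> l \<and> num_types same R W0 < num_types same R (C # W0)")
    case True
    have W': "W = C # W0" "num_types same R W0 \<le> l" using step[unfolded if_P[OF True]] True by simp_all
    have "\<forall>y\<in>cells (set W0). M x y = M x' y" and C: "\<forall>y\<in>set C. M x y = M x' y"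
      using eq unfolding W' by auto
    then have "\<forall>y\<in>cells (set Cs). M x y = M x' y"
      using IH W' x by blast
    then show ?thesis using C by auto
  next
    case False
    have W0: "W = W0" using step[unfolded if_not_P[OF False]] by simp
    have "row_types M (set R) (cells (set W0) \<union> set C) \<le> row_types M (set R) (cells (set W0))"
      using False W W0 by (auto simp: num_types_eq Un_commute)
    then have "\<forall>y\<in>set C. M x y = M x' y"
      using row_types_eq_imp_agree[of "set R" M "cells (set W0)" "set C" x x'] x eq W0 by simp
    moreover have "\<forall>y\<in>cells (set Cs). M x y = M x' y" using IH W W0 x eq by blast
    ultimately show ?thesis by auto
  qed
  moreover have "mset W + mset S = mset (C # Cs) \<and> length W \<le> l \<and> length W < num_types same R W"
  proof (cases "num_types same R W0 \<le> l \<and> num_types same R W0 < num_types same R (C # W0)")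
    case True
    have "W = C # W0" "S = S0" using step[unfolded if_P[OF True]] by simp_all
    then show ?thesis using IH1 True by simp
  next
    case False
    have "W = W0" "S = C # S0" using step[unfolded if_not_P[OF False]] by simp_all
    then show ?thesis using IH1 by simp
  qed
  ultimately show ?case by blast
qed

lemma prune_subset:
  assumes "R \<noteq> []" "distinct Cs"
  shows "set (prune same l R Cs) \<subseteq> set Cs" "distinct (prune same l R Cs)"
    "card (set Cs - set (prune same l R Cs)) \<le> l"
proof -
  obtain W S where z: "scan same l R Cs = (W, S)" by (cases "scan same l R Cs")
  note inv = scan_invariant[OF assms(1) z, THEN conjunct1]
    scan_invariant[OF assms(1) z, THEN conjunct2, THEN conjunct1]
    scan_invariant[OF assms(1) z, THEN conjunct2, THEN conjunct2, THEN conjunct2, rule_format]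
  have S: "prune same l R Cs = S" using z by (simp add: prune_def)
  have m: "mset (W @ S) = mset Cs" using inv(1) by simp
  then have d: "distinct (W @ S)" using assms(2) mset_eq_imp_distinct_iff by blast
  have s: "set W \<union> set S = set Cs" using mset_eq_setD[OF m] by simp
  then have "set Cs - set S \<subseteq> set W" by auto
  then have "card (set Cs - set S) \<le> length W"
    by (meson List.finite_set card_length card_mono le_trans)
  then show "card (set Cs - set (prune same l R Cs)) \<le> l" using inv(2) S by simp
  show "set (prune same l R Cs) \<subseteq> set Cs" "distinct (prune same l R Cs)" using s d S by auto
qed

text \<open>Otherwise the discarded parts avoid \<open>\<Y>\<close> and have at most \<open>l\<close> types. By \<open>scan_invariant\<close> they then
  determine the types on all of \<open>Cs\<close>, which would have at most \<open>l\<close> types, too.\<close>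

lemma prune_hits:
  assumes "R \<noteq> []" "distinct Cs" "l < num_types same R Cs"
    and Y: "row_types M (set R) (cells (set Cs - \<Y>)) \<le> l"
  shows "\<exists>C\<in>\<Y> \<inter> set Cs. C \<notin> set (prune same l R Cs)"
proof (rule ccontr)
  assume neg: "\<not> ?thesis"
  obtain W S where z: "scan same l R Cs = (W, S)" by (cases "scan same l R Cs")
  note inv = scan_invariant[OF assms(1) z, THEN conjunct1]
    scan_invariant[OF assms(1) z, THEN conjunct2, THEN conjunct1]
    scan_invariant[OF assms(1) z, THEN conjunct2, THEN conjunct2, THEN conjunct2, rule_format]
  have S: "prune same l R Cs = S" using z by (simp add: prune_def)
  have m: "mset (W @ S) = mset Cs" using inv(1) by simp
  then have d: "distinct (W @ S)" using assms(2) mset_eq_imp_distinct_iff by blast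
  have s: "set W \<union> set S = set Cs" using mset_eq_setD[OF m] by simp
  have "set W \<subseteq> set Cs - \<Y>" using neg s d S by auto
  then have "num_types same R W \<le> row_types M (set R) (cells (set Cs - \<Y>))"
    unfolding num_types_eq by (intro row_types_mono) auto
  then have W: "num_types same R W \<le> l" using Y by simp
  have "inj_on (\<lambda>f. restrict f (cells (set W))) ((\<lambda>x. restrict (M x) (cells (set Cs))) ` set R)"
  proof (intro inj_onI, clarify)
    fix x x' assume x: "x \<in> set R" "x' \<in> set R"
      and "restrict (restrict (M x) (cells (set Cs))) (cells (set W)) =
           restrict (restrict (M x') (cells (set Cs))) (cells (set W))"
    then have "\<forall>y\<in>cells (set W). M x y = M x' y"
      using s by (auto simp: restrict_eq_iff)
    then have "\<forall>y\<in>cells (set Cs). M x y = M x' y" using inv(3)[OF W x] by blast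
    then show "restrict (M x) (cells (set Cs)) = restrict (M x') (cells (set Cs))"
      unfolding restrict_eq_iff .
  qed
  then have "num_types same R Cs = card ((\<lambda>f. restrict f (cells (set W))) ` (\<lambda>x. restrict (M x) (cells (set Cs))) ` set R)"
    unfolding num_types_eq row_types_def by (simp add: card_image)
  also have "(\<lambda>f. restrict f (cells (set W))) ` (\<lambda>x. restrict (M x) (cells (set Cs))) ` set R
      = (\<lambda>x. restrict (M x) (cells (set W))) ` set R"
  proof -
    have "cells (set Cs) \<inter> cells (set W) = cells (set W)" using s by auto
    then show ?thesis by (simp add: image_image)
  qed
  finally show False using W assms(3) by (simp add: num_types_eq row_types_def)
qed

lemma mergeable_sound:
  assumes "R \<noteq> []" "distinct D" "mergeable same l R D"
  obtains \<Y> where "\<Y> \<subseteq> set D" "card \<Y> \<le> l * l * l"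
    "row_types M (set R) (cells (set D - \<Y>)) \<le> l"
proof -
  have "set ((prune same l R ^^ j) D) \<subseteq> set D \<and> distinct ((prune same l R ^^ j) D) \<and>
      card (set D - set ((prune same l R ^^ j) D)) \<le> j * l" for j
  proof (induction j)
    case (Suc j)
    let ?P = "(prune same l R ^^ j) D"
    note p = prune_subset[OF assms(1), of ?P l]
    have "set D - set (prune same l R ?P) \<subseteq> (set D - set ?P) \<union> (set ?P - set (prune same l R ?P))"
      by auto
    then have "card (set D - set (prune same l R ?P)) \<le>
        card ((set D - set ?P) \<union> (set ?P - set (prune same l R ?P)))"
      by (intro card_mono) auto
    also have "\<dots> \<le> j * l + l"
      using card_Un_le[of "set D - set ?P" "set ?P - set (prune same l R ?P)"] p(3) Suc by linarith
    finally show ?case using p Suc by auto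
  qed (use assms in auto)
  note P = this[of "l * l"]
  let ?P = "(prune same l R ^^ (l * l)) D"
  have "set D - (set D - set ?P) = set ?P" using P by auto
  then show ?thesis
    using assms(3) P by (intro that[of "set D - set ?P"]) (auto simp: mergeable_def num_types_eq)
qed

lemma mergeable_complete:
  assumes R: "R \<noteq> []" "distinct D" and Y: "\<Y> \<subseteq> set D" "card \<Y> \<le> l * l"
    "row_types M (set R) (cells (set D - \<Y>)) \<le> l"
  shows "mergeable same l R D"
proof -
  let ?P = "\<lambda>j. (prune same l R ^^ j) D"
  have fin: "finite \<Y>" using Y(1) finite_subset by auto
  have "set (?P j) \<subseteq> set D \<and> distinct (?P j) \<and>
      (num_types same R (?P j) \<le> l \<or> j \<le> card (\<Y> - set (?P j)))" for j
  proof (induction j)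
    case (Suc j)
    note p = prune_subset[OF assms(1), of "?P j" l]
    show ?case
    proof (cases "num_types same R (?P j) \<le> l")
      case True
      have "num_types same R (?P (Suc j)) \<le> num_types same R (?P j)"
        unfolding num_types_eq using p Suc by (intro row_types_mono) auto
      then show ?thesis using True p Suc by auto
    next
      case False
      have "row_types M (set R) (cells (set (?P j) - \<Y>)) \<le> row_types M (set R) (cells (set D - \<Y>))"
        using Suc by (intro row_types_mono) auto
      then obtain C where C: "C \<in> \<Y> \<inter> set (?P j)" "C \<notin> set (?P (Suc j))"
        using prune_hits[OF R(1), of "?P j" l \<Y>] Suc False Y by fastforce
      have "card (insert C (\<Y> - set (?P j))) \<le> card (\<Y> - set (?P (Suc j)))"
        using C p Suc fin by (intro card_mono) auto
      then show ?thesis using C p Suc False fin by auto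
    qed
  qed (use assms in auto)
  note P = this[of "l * l"]
  show ?thesis
  proof (rule ccontr)
    assume n: "\<not> ?thesis"
    then have "l * l \<le> card (\<Y> - set (?P (l * l)))" using P by (simp add: mergeable_def)
    then have "card \<Y> \<le> card (\<Y> - set (?P (l * l)))" using Y by simp
    then have "\<Y> - set (?P (l * l)) = \<Y>" using fin by (intro card_seteq) auto
    then have "set (?P (l * l)) \<subseteq> set D - \<Y>" using P by auto
    then have "num_types same R (?P (l * l)) \<le> row_types M (set R) (cells (set D - \<Y>))"
      unfolding num_types_eq by (intro row_types_mono) auto
    then show False using n Y by (simp add: mergeable_def)
  qed
qed

end

section \<open>Divisions and a lower bound for twin-width\<close>

locale ordered_matrix = symmetric_matrix M for M :: "nat \<Rightarrow> nat \<Rightarrow> 'b" +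
  fixes U :: "nat set" and L :: "nat rel"
  assumes finite_U: "finite U" and U_nonempty: "U \<noteq> {}"
    and order: "strict_linear_order_on U L" and L_subset: "L \<subseteq> U \<times> U"
begin

lemma L_trans: "(x, y) \<in> L \<Longrightarrow> (y, z) \<in> L \<Longrightarrow> (x, z) \<in> L"
  using order unfolding strict_linear_order_on_def trans_def by blast

lemma L_irrefl: "(x, x) \<notin> L"
  using order unfolding strict_linear_order_on_def irrefl_def by blast

lemma L_total: "x \<in> U \<Longrightarrow> y \<in> U \<Longrightarrow> (x, y) \<in> L \<or> x = y \<or> (y, x) \<in> L"
  using order unfolding strict_linear_order_on_def total_on_def by blast

lemma ex_smallest: "finite S \<Longrightarrow> S \<noteq> {} \<Longrightarrow> S \<subseteq> U \<Longrightarrow> \<exists>a. smallest L S a"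
proof (induction S rule: finite_ne_induct)
  case (insert x F)
  then obtain a where a: "smallest L F a" by auto
  then have "a \<in> U" using insert by (auto simp: smallest_def)
  then consider "(x, a) \<in> L" | "x = a" | "(a, x) \<in> L" using L_total insert by blast
  then show ?case
  proof cases
    case 1
    then show ?thesis using a L_trans by (intro exI[of _ x]) (auto simp: smallest_def)
  qed (use a in \<open>auto intro!: exI[of _ a] simp: smallest_def\<close>)
qed (auto simp: smallest_def)

lemma ex_largest: "finite S \<Longrightarrow> S \<noteq> {} \<Longrightarrow> S \<subseteq> U \<Longrightarrow> \<exists>a. largest L S a"
proof (induction S rule: finite_ne_induct)
  case (insert x F)
  then obtain a where a: "largest L F a" by auto
  then have "a \<in> U" using insert by (auto simp: largest_def)
  then consider "(a, x) \<in> L" | "x = a" | "(x, a) \<in> L" using L_total insert by blast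
  then show ?case
  proof cases
    case 1
    then show ?thesis using a L_trans by (intro exI[of _ x]) (auto simp: largest_def)
  qed (use a in \<open>auto intro!: exI[of _ a] simp: largest_def\<close>)
qed (auto simp: largest_def)

lemma between_in_span:
  assumes S: "S \<subseteq> U" "q \<in> S" "q' \<in> S" and z: "z \<in> U" "(q, z) \<in> L\<^sup>=" "(z, q') \<in> L\<^sup>="
  shows "z \<in> span_of U L S"
proof -
  have "finite S" "S \<noteq> {}" using S finite_U finite_subset by auto
  then obtain a b where "smallest L S a" "largest L S b" using ex_smallest ex_largest S by meson
  moreover from this have "(a, q) \<in> L\<^sup>=" "(q', b) \<in> L\<^sup>=" using S by (auto simp: smallest_def largest_def)
  then have "(a, z) \<in> L\<^sup>=" "(z, b) \<in> L\<^sup>=" using z L_trans by blast+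
  ultimately show ?thesis using z by (auto simp: span_of_def)
qed

lemma subset_span: "S \<subseteq> U \<Longrightarrow> S \<subseteq> span_of U L S"
  using between_in_span by blast

definition division :: "nat list list \<Rightarrow> bool" where
  "division D \<longleftrightarrow> sorted_wrt (\<lambda>x y. (x, y) \<in> L) (concat D) \<and> set (concat D) = U \<and> [] \<notin> set D"

lemma division_less:
  assumes "division D" "i < j" "j < length D" "x \<in> set (D ! i)" "y \<in> set (D ! j)"
  shows "(x, y) \<in> L"
proof -
  have "D ! i \<in> set (take j D)" using assms by (metis in_set_conv_nth length_take min.absorb4 nth_take)
  then have "x \<in> set (concat (take j D))" using assms(4) by auto
  moreover have "D ! j \<in> set (drop j D)" using assms(3) by (simp add: Cons_nth_drop_Suc[symmetric])
  then have "y \<in> set (concat (drop j D))" using assms(5) by auto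
  moreover have "concat D = concat (take j D) @ concat (drop j D)"
    by (metis append_take_drop_id concat_append)
  ultimately show ?thesis using assms(1) unfolding division_def by (metis sorted_wrt_append)
qed

lemma distinct_concat_division: "division D \<Longrightarrow> distinct (concat D)"
proof -
  have "sorted_wrt (\<lambda>x y. (x, y) \<in> L) xs \<Longrightarrow> distinct xs" for xs
    by (induction xs) (use L_irrefl in auto)
  then show "division D \<Longrightarrow> distinct (concat D)" by (simp add: division_def)
qed

lemma distinct_division: "division D \<Longrightarrow> distinct D"
  using distinct_concat_division distinct_concat_iff[of D]
  by (metis division_def removeAll_id)

lemma division_disjoint:
  "division D \<Longrightarrow> i < length D \<Longrightarrow> j < length D \<Longrightarrow> x \<in> set (D ! i) \<Longrightarrow> x \<in> set (D ! j) \<Longrightarrow> i = j"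
  using division_less L_irrefl by (metis linorder_neqE_nat)

lemma division_disjoint_sets:
  "division D \<Longrightarrow> R \<in> set D \<Longrightarrow> R' \<in> set D \<Longrightarrow> x \<in> set R \<Longrightarrow> x \<in> set R' \<Longrightarrow> R = R'"
  using division_disjoint by (metis in_set_conv_nth)

lemma span_within_part:
  assumes D: "division D" "R \<in> set D" and S: "S \<subseteq> set R"
  shows "span_of U L S \<subseteq> set R"
proof
  fix z assume "z \<in> span_of U L S"
  then obtain a b where z: "z \<in> U" "a \<in> S" "b \<in> S" "(a, z) \<in> L\<^sup>=" "(z, b) \<in> L\<^sup>="
    by (auto simp: span_of_def smallest_def largest_def)
  obtain i where i: "i < length D" "D ! i = R" using D by (auto simp: in_set_conv_nth)
  have "z \<in> set (concat D)" using z D by (simp add: division_def)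
  then obtain C where "C \<in> set D" "z \<in> set C" by auto
  then obtain j where j: "j < length D" "z \<in> set (D ! j)" by (metis in_set_conv_nth)
  have "\<not> j < i"
  proof
    assume "j < i"
    then have "(z, a) \<in> L" using division_less[OF D(1)] i j z S by blast
    then show False using z L_trans L_irrefl by blast
  qed
  moreover have "\<not> i < j"
  proof
    assume "i < j"
    then have "(b, z) \<in> L" using division_less[OF D(1)] i j z S by blast
    then show False using z L_trans L_irrefl by blast
  qed
  ultimately show "z \<in> set R" using i j by (simp add: linorder_not_less)
qed

text \<open>The threshold of two consecutive intervals is chosen such that the final partition of a contraction
  sequence is wide and the initial one is not, while the span of a part that is not wide can touch only
  three intervals.\<close>

definition wide :: "nat list list \<Rightarrow> nat set \<Rightarrow> bool" where
  "wide D S \<longleftrightarrow> (\<exists>i. Suc i < length D \<and> set (D ! i @ D ! Suc i) \<subseteq> span_of U L S)"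

lemma not_wide_meets_three:
  assumes D: "division D" and Q: "Q \<subseteq> U" "\<not> wide D Q"
  shows "card {C \<in> set D. Q \<inter> set C \<noteq> {}} \<le> 3"
proof -
  define I where "I = {j. j < length D \<and> Q \<inter> set (D ! j) \<noteq> {}}"
  have fin: "finite I" unfolding I_def by simp
  have img: "{C \<in> set D. Q \<inter> set C \<noteq> {}} = (!) D ` I"
    unfolding I_def by (auto simp: in_set_conv_nth)
  have "card I \<le> 3"
  proof (cases "I = {}")
    case False
    define a where "a = Min I"
    have a: "a \<in> I" "\<And>j. j \<in> I \<Longrightarrow> a \<le> j" using fin False by (auto simp: a_def)
    have "j < a + 3" if j: "j \<in> I" for j
    proof (rule ccontr)
      assume "\<not> j < a + 3"
      then have ij: "a < Suc a" "Suc (Suc a) < j" "j < length D" using j by (auto simp: I_def)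
      obtain q q' where q: "q \<in> Q" "q \<in> set (D ! a)" "q' \<in> Q" "q' \<in> set (D ! j)"
        using a(1) j by (auto simp: I_def)
      have "z \<in> span_of U L Q" if m: "m = Suc a \<or> m = Suc (Suc a)" and z: "z \<in> set (D ! m)" for m z
      proof -
        have mm: "a < m" "m < j" using m ij by auto
        then have "(q, z) \<in> L" "(z, q') \<in> L"
          using division_less[OF D] q z ij(3) by (meson less_trans)+
        then show ?thesis using between_in_span[OF Q(1) q(1,3)] L_subset by blast
      qed
      then have "set (D ! Suc a @ D ! Suc (Suc a)) \<subseteq> span_of U L Q" by auto
      then show False using Q(2) ij unfolding wide_def by (meson less_trans)
    qed
    then have "I \<subseteq> {a..<a + 3}" using a by auto
    then show ?thesis using card_mono[of "{a..<a + 3}" I] by simp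
  qed simp
  then show ?thesis unfolding img using card_image_le[OF fin, of "(!) D"] by linarith
qed

text \<open>The parts of \<open>\<P>\<close> that meet the two intervals covered by a wide part are in conflict with it,
  so there are at most \<open>p + 1\<close> of them. Together they have errors with at most \<open>(p + 1) * e\<close> parts of \<open>\<Q>\<close>,
  each of which touches at most three intervals; these form \<open>\<Y>\<close>. On the other intervals, rows
  from the same part of \<open>\<P>\<close> agree.\<close>

lemma few_types_of_wide_part:
  assumes D: "division D"
    and parts: "partition_on U \<P>" "partition_on U \<Q>"
    and overlap: "overlapping p U L \<P>"
    and err: "\<And>P. P \<in> \<P> \<Longrightarrow>
       card {Q \<in> \<Q>. \<not> (\<forall>x\<in>P. \<forall>x'\<in>P. \<forall>y\<in>Q. \<forall>y'\<in>Q. M x y = M x' y')} \<le> e"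
    and wide: "\<exists>P\<in>\<P>. wide D P" and narrow: "\<And>Q. Q \<in> \<Q> \<Longrightarrow> \<not> wide D Q"
  shows "\<exists>i \<Y>. Suc i < length D \<and> \<Y> \<subseteq> set D \<and> card \<Y> \<le> 3 * ((p + 1) * e) \<and>
    row_types M (set (D ! i @ D ! Suc i)) (cells (set D - \<Y>)) \<le> p + 1"
proof -
  have finP: "finite \<P>" "finite \<Q>" using parts finite_U by (auto intro: finite_elements)
  have PU: "P \<in> \<P> \<Longrightarrow> P \<subseteq> U" "Q \<in> \<Q> \<Longrightarrow> Q \<subseteq> U" for P Q
    using parts by (auto simp: partition_on_def)
  obtain P0 i where P0: "P0 \<in> \<P>" and i: "Suc i < length D"
    and sp: "set (D ! i @ D ! Suc i) \<subseteq> span_of U L P0"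
    using wide unfolding wide_def by blast
  define R where "R = set (D ! i @ D ! Suc i)"
  define meet where "meet = {P \<in> \<P>. P \<inter> R \<noteq> {}}"
  have RU: "R \<subseteq> U" using sp by (auto simp: R_def span_of_def)
  have "meet \<subseteq> insert P0 {T \<in> \<P>. T \<noteq> P0 \<and> in_conflict U L P0 T}"
  proof
    fix P assume "P \<in> meet"
    then obtain x where x: "x \<in> P" "x \<in> R" "P \<in> \<P>" by (auto simp: meet_def)
    then have "x \<in> span_of U L P0" "x \<in> span_of U L P"
      using sp subset_span[OF PU(1)] unfolding R_def by blast+
    then show "P \<in> insert P0 {T \<in> \<P>. T \<noteq> P0 \<and> in_conflict U L P0 T}"
      using x unfolding in_conflict_def by blast
  qed
  then have "card meet \<le> card (insert P0 {T \<in> \<P>. T \<noteq> P0 \<and> in_conflict U L P0 T})"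
    using finP by (intro card_mono) auto
  also have "\<dots> \<le> p + 1"
    using overlap P0 finP unfolding overlapping_def by (simp add: card_insert_if)
  finally have meet: "card meet \<le> p + 1" .
  have fin_meet: "finite meet" using finP by (simp add: meet_def)
  define const where "const P Q \<longleftrightarrow> (\<forall>x\<in>P. \<forall>x'\<in>P. \<forall>y\<in>Q. \<forall>y'\<in>Q. M x y = M x' y')" for P Q
  note err = err[folded const_def]
  define bad where "bad = (\<Union>P\<in>meet. {Q \<in> \<Q>. \<not> const P Q})"
  have "card bad \<le> (\<Sum>P\<in>meet. e)"
    unfolding bad_def using err fin_meet
    by (intro order.trans[OF card_UN_le] sum_mono) (auto simp: meet_def)
  also have "\<dots> \<le> (p + 1) * e" using mult_right_mono[OF meet, of e] by simp
  finally have bad: "card bad \<le> (p + 1) * e" .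
  have fin_bad: "finite bad" using finP by (rule_tac finite_subset[of _ \<Q>]) (auto simp: bad_def)
  define \<Y> where "\<Y> = (\<Union>Q\<in>bad. {C \<in> set D. Q \<inter> set C \<noteq> {}})"
  have "card \<Y> \<le> (\<Sum>Q\<in>bad. 3)"
    unfolding \<Y>_def using fin_bad
    by (intro order.trans[OF card_UN_le] sum_mono not_wide_meets_three[OF D] narrow PU)
       (auto simp: bad_def)
  also have "\<dots> \<le> 3 * ((p + 1) * e)" using bad by simp
  finally have Y: "card \<Y> \<le> 3 * ((p + 1) * e)" .
  \<comment> \<open>Rows are grouped by the parts of \<open>\<P>\<close> that contain them.\<close>
  define part where "part x = (THE P. P \<in> \<P> \<and> x \<in> P)" for x
  have part: "part x \<in> \<P>" "x \<in> part x" if "x \<in> U" for x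
  proof -
    have "\<exists>!P. P \<in> \<P> \<and> x \<in> P"
      using that parts(1) unfolding partition_on_def disjoint_def by blast
    then have "part x \<in> \<P> \<and> x \<in> part x" unfolding part_def by (rule theI')
    then show "part x \<in> \<P>" "x \<in> part x" by auto
  qed
  have agree: "M x y = M x' y" if x: "x \<in> R" "x' \<in> R" and eq: "part x = part x'"
    and y: "y \<in> cells (set D - \<Y>)" for x x' y
  proof -
    obtain C where C: "C \<in> set D" "C \<notin> \<Y>" "y \<in> set C" using y by auto
    then have "y \<in> U" using D by (auto simp: division_def)
    then obtain Q where Q: "Q \<in> \<Q>" "y \<in> Q" using parts(2) by (auto simp: partition_on_def)
    have "Q \<notin> bad" using C Q by (auto simp: \<Y>_def)
    moreover have "part x \<in> meet" using part[of x] x RU by (auto simp: meet_def)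
    ultimately have "const (part x) Q"
      using Q by (auto simp: bad_def)
    moreover have "x \<in> part x" "x' \<in> part x" using part x RU eq by auto
    ultimately show ?thesis using Q unfolding const_def by blast
  qed
  have "row_types M R (cells (set D - \<Y>)) \<le> card (part ` R)"
  proof -
    let ?f = "\<lambda>x. restrict (M x) (cells (set D - \<Y>))"
    define g where "g P = ?f (SOME x. x \<in> R \<and> part x = P)" for P
    have "?f x = g (part x)" if "x \<in> R" for x
    proof -
      have "(SOME x'. x' \<in> R \<and> part x' = part x) \<in> R \<and> part (SOME x'. x' \<in> R \<and> part x' = part x) = part x"
        using that by (intro someI[where P = "\<lambda>x'. x' \<in> R \<and> part x' = part x"]) auto
      then show ?thesis unfolding g_def restrict_eq_iff using agree that by metis
    qed
    then have "?f ` R \<subseteq> g ` (part ` R)" by auto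
    then have "card (?f ` R) \<le> card (g ` (part ` R))"
      using finite_subset[OF RU finite_U] by (intro card_mono) auto
    also have "\<dots> \<le> card (part ` R)"
      using finite_subset[OF RU finite_U] by (intro card_image_le) auto
    finally show ?thesis by (simp add: row_types_def)
  qed
  also have "\<dots> \<le> card meet"
    using part RU fin_meet by (intro card_mono) (auto simp: meet_def)
  finally have "row_types M R (cells (set D - \<Y>)) \<le> p + 1" using meet by simp
  then show ?thesis using i Y unfolding R_def by (intro exI[of _ i] exI[of _ \<Y>]) (auto simp: \<Y>_def)
qed

definition matrix_of :: "(nat, nat, 'b) matrix" where
  "matrix_of = \<lparr>rows = U, row_less = L, cols = U, col_less = L, entry = M\<rparr>"

text \<open>A contraction step changes only the row partition or only the column partition. So when the first
  wide part appears in one of the two, the other one has no wide part.\<close>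

lemma few_types_of_pe_sequence:
  assumes pe: "pe_sequence matrix_of p e Ps" and D: "division D" "2 \<le> length D"
  shows "\<exists>i \<Y>. Suc i < length D \<and> \<Y> \<subseteq> set D \<and> card \<Y> \<le> 3 * ((p + 1) * e) \<and>
    row_types M (set (D ! i @ D ! Suc i)) (cells (set D - \<Y>)) \<le> p + 1"
proof -
  have cs: "contraction_sequence matrix_of Ps" using pe by (simp add: pe_sequence_def)
  let ?wide = "\<lambda>s. \<exists>S\<in>fst (Ps ! s) \<union> snd (Ps ! s). wide D S"
  have ne: "Ps \<noteq> []" using cs by (simp add: contraction_sequence_def)
  have part: "partition_on U (fst (Ps ! s))" "partition_on U (snd (Ps ! s))"
    and ov: "overlapping p U L (fst (Ps ! s))" "overlapping p U L (snd (Ps ! s))"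
    and col: "\<And>Q. Q \<in> snd (Ps ! s) \<Longrightarrow> col_error matrix_of (fst (Ps ! s)) Q \<le> e"
    and row: "\<And>P. P \<in> fst (Ps ! s) \<Longrightarrow> row_error matrix_of (snd (Ps ! s)) P \<le> e"
    if "s < length Ps" for s
    using pe nth_mem[OF that]
    unfolding pe_sequence_def contraction_sequence_def by (auto simp: matrix_of_def split: prod.splits)
  have "last Ps = ({U}, {U})" using cs by (simp add: contraction_sequence_def matrix_of_def)
  then have "Ps ! (length Ps - 1) = ({U}, {U})" by (simp only: last_conv_nth[OF ne])
  moreover have "wide D U"
  proof -
    have "D ! 0 \<in> set D" "D ! Suc 0 \<in> set D"
      using nth_mem[of 0 D] nth_mem[of "Suc 0" D] D(2) by linarith+
    then have "set (D ! 0 @ D ! Suc 0) \<subseteq> U" using D(1) unfolding division_def by auto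
    then show ?thesis using subset_span[of U] D(2) unfolding wide_def by (intro exI[of _ 0]) auto
  qed
  ultimately have last: "?wide (length Ps - 1)" by simp
  have "hd Ps = ((\<lambda>x. {x}) ` U, (\<lambda>x. {x}) ` U)"
    using cs by (simp add: contraction_sequence_def matrix_of_def)
  moreover have "\<not> wide D {x}" if x: "x \<in> U" for x
  proof
    assume "wide D {x}"
    then obtain i where i: "Suc i < length D" "set (D ! i @ D ! Suc i) \<subseteq> span_of U L {x}"
      by (auto simp: wide_def)
    have "span_of U L {x} \<subseteq> {x}"
      using L_trans L_irrefl by (auto simp: span_of_def smallest_def largest_def)
    then have sub: "set (D ! i @ D ! Suc i) \<subseteq> {x}" using i by blast
    have "D ! i \<noteq> []" "D ! Suc i \<noteq> []" using D i by (metis Suc_lessD division_def nth_mem)+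
    then have "x \<in> set (D ! i)" "x \<in> set (D ! Suc i)" using sub by (auto simp: neq_Nil_conv)
    then show False using division_disjoint[OF D(1), of i "Suc i"] i by auto
  qed
  ultimately have first: "\<not> ?wide 0" using ne by (auto simp: hd_conv_nth)
  define s where "s = (LEAST s. ?wide s)"
  have ws: "?wide s" unfolding s_def using last by (rule LeastI)
  have sle: "s \<le> length Ps - 1" unfolding s_def using last by (rule Least_le)
  have least: "\<not> ?wide s'" if "s' < s" for s' using that unfolding s_def by (rule not_less_Least)
  have "s \<noteq> 0" using ws first by metis
  then obtain s' where s': "s = Suc s'" by (cases s) auto
  have slen: "s < length Ps" using sle ne by (cases Ps) auto
  have "\<not> ?wide s'" using s' by (intro least) simp
  have step: "contraction_step (Ps ! s') (Ps ! s)"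
    using cs slen s' by (simp add: contraction_sequence_def)
  then show ?thesis
  proof (cases "snd (Ps ! s) = snd (Ps ! s')")
    case True
    have narrow: "\<not> wide D Q" if "Q \<in> snd (Ps ! s)" for Q using that True \<open>\<not> ?wide s'\<close> by auto
    then have "\<exists>P\<in>fst (Ps ! s). wide D P" using ws by auto
    with narrow show ?thesis
      using row[OF slen] unfolding row_error_def constant_submatrix_def
      by (intro few_types_of_wide_part[OF D(1) part[OF slen] ov(1)[OF slen]]) (auto simp: matrix_of_def)
  next
    case False
    then have "fst (Ps ! s) = fst (Ps ! s')" using step by (auto simp: contraction_step_def)
    then have narrow: "\<not> wide D Q" if "Q \<in> fst (Ps ! s)" for Q using that \<open>\<not> ?wide s'\<close> by auto
    then have "\<exists>P\<in>snd (Ps ! s). wide D P" using ws by auto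
    moreover have "card {P \<in> fst (Ps ! s). \<not> (\<forall>x\<in>Q. \<forall>x'\<in>Q. \<forall>y\<in>P. \<forall>y'\<in>P. M x y = M x' y')} \<le> e"
      if "Q \<in> snd (Ps ! s)" for Q
    proof -
      have "(\<forall>x\<in>Q. \<forall>x'\<in>Q. \<forall>y\<in>P. \<forall>y'\<in>P. M x y = M x' y') \<longleftrightarrow> constant_submatrix matrix_of P Q" for P
        unfolding constant_submatrix_def matrix_of_def matrix.simps
        by (intro iffI ballI; subst transposed; blast)
      then show ?thesis using col[OF slen that] by (simp add: col_error_def)
    qed
    ultimately show ?thesis
      using narrow by (intro few_types_of_wide_part[OF D(1) part(2,1)[OF slen] ov(2)[OF slen]]) auto
  qed
qed

end

section \<open>Splitting the parts of a division into classes\<close>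

text \<open>Being mixed is monotone in \<open>R\<close> and \<open>C\<close>, in contrast to membership in a set of parts
  that can be removed to leave few types; this is what makes the classes of successive divisions
  refine each other.\<close>

definition mixed :: "entry_test \<Rightarrow> nat \<Rightarrow> nat list \<Rightarrow> nat list \<Rightarrow> bool" where
  "mixed s l R C \<longleftrightarrow> l < num_types s R [C] \<and> l < num_types s C [R]"

text \<open>A single part relates everything, so that in the end the remaining classes get merged as well.\<close>

definition related ::
  "entry_test \<Rightarrow> nat \<Rightarrow> nat list list \<Rightarrow> nat \<Rightarrow> nat \<Rightarrow> bool" where
  "related s l D x y \<longleftrightarrow> length D \<le> 1 \<or>
     list_ex (\<lambda>R. x \<in> set R \<and> y \<in> set R \<and> list_all (\<lambda>C. mixed s l R C \<or> agree s C x y) D) D"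

text \<open>The default value \<open>0\<close> is encoded by \<open>Leaf\<close>, which is also the left subtree of the encoded empty list.\<close>

definition rep :: "nat list \<Rightarrow> nat" where
  "rep P = (case P of [] \<Rightarrow> 0 | x # _ \<Rightarrow> x)"

lemma rep_in: "P \<noteq> [] \<Longrightarrow> rep P \<in> set P"
  by (cases P) (auto simp: rep_def)

primrec insert_part :: "(nat \<Rightarrow> nat \<Rightarrow> bool) \<Rightarrow> nat list \<Rightarrow> nat list list \<Rightarrow> nat list list" where
  "insert_part r P [] = [P]"
| "insert_part r P (P' # A) = (if r (rep P) (rep P') then (P @ P') # A else P' # insert_part r P A)"

text \<open>Merges just one pair of related parts, because a contraction step does. Comparing representatives is
  enough for partitions into parts of pairwise related elements.\<close>

primrec merge_related :: "(nat \<Rightarrow> nat \<Rightarrow> bool) \<Rightarrow> nat list list \<Rightarrow> nat list list" where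
  "merge_related r [] = []"
| "merge_related r (P # A) =
     (if list_ex (\<lambda>P'. r (rep P) (rep P')) A then insert_part r P A else P # merge_related r A)"

primrec merge_adjacent :: "(nat list \<Rightarrow> bool) \<Rightarrow> nat list list \<Rightarrow> nat list list" where
  "merge_adjacent t [] = []"
| "merge_adjacent t (R # Rs) =
     (if Rs = [] then [R]
      else if t (R @ hd Rs) then (R @ hd Rs) # tl Rs else R # merge_adjacent t Rs)"

lemma insert_part_merges:
  assumes "\<exists>P'\<in>set A. r (rep P) (rep P')"
  shows "\<exists>P' B. P' \<in> set A \<and> r (rep P) (rep P') \<and> mset A = {#P'#} + B \<and>
    mset (insert_part r P A) = {#P @ P'#} + B"
  using assms
proof (induction A)
  case (Cons P' A)
  show ?case
  proof (cases "r (rep P) (rep P')")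
    case True
    then show ?thesis by (intro exI[of _ P'] exI[of _ "mset A"]) auto
  next
    case False
    then obtain P'' B where "P'' \<in> set A" "r (rep P) (rep P'')" "mset A = {#P''#} + B"
      "mset (insert_part r P A) = {#P @ P''#} + B" using Cons by auto
    then show ?thesis using False by (intro exI[of _ P''] exI[of _ "{#P'#} + B"]) auto
  qed
qed simp

lemma merge_related_cases:
  obtains (stalled) "merge_related r A = A" "sorted_wrt (\<lambda>P P'. \<not> r (rep P) (rep P')) A"
  | (merged) P P' B where "r (rep P) (rep P')" "mset A = {#P, P'#} + B"
      "mset (merge_related r A) = {#P @ P'#} + B"
proof -
  have "merge_related r A = A \<and> sorted_wrt (\<lambda>P P'. \<not> r (rep P) (rep P')) A \<or>
    (\<exists>P P' B. r (rep P) (rep P') \<and> mset A = {#P, P'#} + B \<and> mset (merge_related r A) = {#P @ P'#} + B)"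
  proof (induction A)
    case (Cons P A)
    show ?case
    proof (cases "\<exists>P'\<in>set A. r (rep P) (rep P')")
      case True
      obtain P' B where "P' \<in> set A" "r (rep P) (rep P')" "mset A = {#P'#} + B"
        "mset (insert_part r P A) = {#P @ P'#} + B" using insert_part_merges[where r = r and P = P and A = A, OF True] by auto
      then show ?thesis using True
        by (intro disjI2 exI[of _ P] exI[of _ P'] exI[of _ B]) (auto simp: list_ex_iff)
    next
      case False
      then have m: "merge_related r (P # A) = P # merge_related r A" by (simp add: list_ex_iff)
      from Cons show ?thesis
      proof
        assume "merge_related r A = A \<and> sorted_wrt (\<lambda>P P'. \<not> r (rep P) (rep P')) A"
        then show ?thesis using False m by auto
      next
        assume "\<exists>Q P' B. r (rep Q) (rep P') \<and> mset A = {#Q, P'#} + B \<and>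
          mset (merge_related r A) = {#Q @ P'#} + B"
        then obtain Q P' B where "r (rep Q) (rep P')" "mset A = {#Q, P'#} + B"
          "mset (merge_related r A) = {#Q @ P'#} + B" by blast
        then show ?thesis using m
          by (intro disjI2 exI[of _ Q] exI[of _ P'] exI[of _ "{#P#} + B"]) auto
      qed
    qed
  qed simp
  then show ?thesis using that by blast
qed

lemma merge_adjacent_cases:
  obtains (stalled) "merge_adjacent t D = D" "\<And>i. Suc i < length D \<Longrightarrow> \<not> t (D ! i @ D ! Suc i)"
  | (merged) Ds R R' Es where "t (R @ R')" "D = Ds @ R # R' # Es"
      "merge_adjacent t D = Ds @ (R @ R') # Es"
proof -
  have "merge_adjacent t D = D \<and> (\<forall>i. Suc i < length D \<longrightarrow> \<not> t (D ! i @ D ! Suc i)) \<or>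
    (\<exists>Ds R R' Es. t (R @ R') \<and> D = Ds @ R # R' # Es \<and> merge_adjacent t D = Ds @ (R @ R') # Es)"
  proof (induction D)
    case (Cons R D)
    show ?case
    proof (cases D)
      case (Cons R' Es)
      show ?thesis
      proof (cases "t (R @ R')")
        case True
        then show ?thesis using Cons by (intro disjI2 exI[of _ "[]"] exI[of _ R] exI[of _ R'] exI[of _ Es]) auto
      next
        case False
        then have m: "merge_adjacent t (R # D) = R # merge_adjacent t D" using Cons by simp
        from Cons.IH show ?thesis
        proof
          assume 1: "merge_adjacent t D = D \<and> (\<forall>i. Suc i < length D \<longrightarrow> \<not> t (D ! i @ D ! Suc i))"
          have "\<not> t ((R # D) ! i @ (R # D) ! Suc i)" if "Suc i < length (R # D)" for i
            using that 1 False Cons by (cases i) auto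
          then show ?thesis using 1 m by auto
        next
          assume "\<exists>Ds R R' Es. t (R @ R') \<and> D = Ds @ R # R' # Es \<and>
            merge_adjacent t D = Ds @ (R @ R') # Es"
          then obtain Ds Q Q' Es where "t (Q @ Q')" "D = Ds @ Q # Q' # Es"
            "merge_adjacent t D = Ds @ (Q @ Q') # Es" by blast
          then show ?thesis using m
            by (intro disjI2 exI[of _ "R # Ds"] exI[of _ Q] exI[of _ Q'] exI[of _ Es]) auto
        qed
      qed
    qed simp
  qed simp
  then show ?thesis using that by blast
qed

lemma merged_shorter:
  assumes "mset A = {#P, P'#} + B" "mset A' = {#P @ P'#} + B"
  shows "length A = Suc (length A')"
  using assms[THEN arg_cong[where f = size]] by simp

abbreviation parts_in :: "nat list \<Rightarrow> nat list list \<Rightarrow> nat list list" where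
  "parts_in R A \<equiv> filter (\<lambda>P. set P \<subseteq> set R) A"

locale bounded_alphabet = ordered_matrix M U L for M :: "nat \<Rightarrow> nat \<Rightarrow> 'b" and U L +
  fixes \<Sigma> :: "'b set" and \<alpha> l :: nat
  assumes alphabet: "M x y \<in> \<Sigma>" "finite \<Sigma>" "card \<Sigma> \<le> \<alpha>" "2 \<le> \<alpha>" and l_pos: "1 \<le> l"
begin

text \<open>There are at most \<open>l\<close> types outside the exempted parts, and at most \<open>\<alpha> ^ l\<close> in each exempted zone
  that is not mixed.\<close>

definition max_classes :: nat where
  "max_classes = l * (\<alpha> ^ l) ^ (l * l * l)"

text \<open>A set \<open>\<Y>\<close> of exempted parts is found when \<open>R\<close> is formed. It survives later merges of other
  parts, being replaced by its image in the coarser division.\<close>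

definition certified :: "nat list list \<Rightarrow> nat list \<Rightarrow> bool" where
  "certified D R \<longleftrightarrow> (\<exists>\<Y>\<subseteq>set D. card \<Y> \<le> l * l * l \<and> row_types M (set R) (cells (set D - \<Y>)) \<le> l)"

definition lists_partition :: "nat list list \<Rightarrow> bool" where
  "lists_partition A \<longleftrightarrow> distinct (concat A) \<and> set (concat A) = U \<and> [] \<notin> set A"

text \<open>The partitions visited while the classes of one division are merged into the classes of \<open>D\<close>, the
  next one. The factor 2 is due to the part of \<open>D\<close> that was just formed from two parts.\<close>

definition compatible :: "nat list list \<Rightarrow> nat list list \<Rightarrow> bool" where
  "compatible D A \<longleftrightarrow> lists_partition A \<and>
     (\<forall>P\<in>set A. (\<exists>R\<in>set D. set P \<subseteq> set R) \<and> (\<forall>x\<in>set P. \<forall>y\<in>set P. related same l D x y)) \<and>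
     (\<forall>R\<in>set D. length (parts_in R A) \<le> 2 * max_classes)"

lemma mixed_iff:
  "mixed same l R C \<longleftrightarrow> l < row_types M (set R) (set C) \<and> l < row_types M (set C) (set R)"
  by (simp add: mixed_def num_types_eq)

lemma mixed_mono:
  "mixed same l R C \<Longrightarrow> set R \<subseteq> set R' \<Longrightarrow> set C \<subseteq> set C' \<Longrightarrow> mixed same l R' C'"
  unfolding mixed_iff by (meson List.finite_set less_le_trans row_types_mono)

lemma related_iff:
  "related same l D x y \<longleftrightarrow> length D \<le> 1 \<or>
     (\<exists>R\<in>set D. x \<in> set R \<and> y \<in> set R \<and> (\<forall>C\<in>set D. mixed same l R C \<or> (\<forall>z\<in>set C. M x z = M y z)))"
  by (simp add: related_def list_ex_iff list_all_iff agree_iff)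

lemma related_sym: "related same l D x y \<Longrightarrow> related same l D y x"
  unfolding related_iff by metis

lemma related_trans:
  assumes D: "division D" and "related same l D x y" "related same l D y z"
  shows "related same l D x z"
proof (cases "length D \<le> 1")
  case False
  then obtain R where R: "R \<in> set D" "x \<in> set R" "y \<in> set R"
      "\<forall>C\<in>set D. mixed same l R C \<or> (\<forall>w\<in>set C. M x w = M y w)"
    using assms unfolding related_iff by blast
  obtain R' where R': "R' \<in> set D" "y \<in> set R'" "z \<in> set R'"
      "\<forall>C\<in>set D. mixed same l R' C \<or> (\<forall>w\<in>set C. M y w = M z w)"
    using assms False unfolding related_iff by blast
  have "R' = R" using division_disjoint_sets[OF D] R R' by metis
  then show ?thesis unfolding related_iff using R R' by metis
qed (simp add: related_def)

lemma lists_partition_partition_on: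
  assumes "lists_partition A"
  shows "partition_on U (set ` set A)"
proof -
  have "P \<inter> P' = {}" if "P \<in> set ` set A" "P' \<in> set ` set A" "P \<noteq> P'" for P P'
    using that assms unfolding lists_partition_def by (auto simp: distinct_concat_iff)
  then show ?thesis using assms
    unfolding lists_partition_def partition_on_def disjoint_def by auto
qed

lemma few_mixed:
  assumes "certified D R"
  shows "card {C \<in> set D. mixed same l R C} \<le> l * l * l"
proof -
  obtain \<Y> where Y: "\<Y> \<subseteq> set D" "card \<Y> \<le> l * l * l" "row_types M (set R) (cells (set D - \<Y>)) \<le> l"
    using assms unfolding certified_def by blast
  have "C \<in> \<Y>" if "C \<in> set D" "mixed same l R C" for C
  proof (rule ccontr)
    assume "C \<notin> \<Y>"
    then have "row_types M (set R) (set C) \<le> row_types M (set R) (cells (set D - \<Y>))"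
      using that by (intro row_types_mono) auto
    then show False using Y that by (simp add: mixed_iff)
  qed
  then have "card {C \<in> set D. mixed same l R C} \<le> card \<Y>"
    using finite_subset[OF Y(1)] by (intro card_mono) auto
  then show ?thesis using Y by simp
qed

text \<open>A zone of \<open>R\<close> that is not mixed has at most \<open>l\<close> row types, or it has at most \<open>l\<close> column types and
  hence at most \<open>\<alpha> ^ l\<close> row types.\<close>

lemma few_classes:
  assumes "certified D R"
  shows "row_types M (set R) (cells {C \<in> set D. \<not> mixed same l R C}) \<le> max_classes"
proof -
  obtain \<Y> where Y: "\<Y> \<subseteq> set D" "card \<Y> \<le> l * l * l" "row_types M (set R) (cells (set D - \<Y>)) \<le> l"
    using assms unfolding certified_def by blast
  have finY: "finite \<Y>" using Y(1) finite_subset by auto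
  let ?Z = "{C \<in> \<Y>. \<not> mixed same l R C}"
  have l: "l \<le> \<alpha> ^ l"
    using less_exp[of l] power_mono[of 2 \<alpha> l] alphabet(4) by linarith
  have "row_types M (set R) (set C) \<le> \<alpha> ^ l" if "\<not> mixed same l R C" for C
  proof (cases "row_types M (set R) (set C) \<le> l")
    case False
    then have c: "row_types M (set C) (set R) \<le> l" using that by (auto simp: mixed_iff)
    have "row_types M (set R) (set C) \<le> card \<Sigma> ^ row_types M (set C) (set R)"
      using transposed alphabet by (intro row_types_le_power) auto
    also have "\<dots> \<le> \<alpha> ^ row_types M (set C) (set R)" using alphabet by (intro power_mono) auto
    also have "\<dots> \<le> \<alpha> ^ l" using c alphabet by (intro power_increasing) auto
    finally show ?thesis .
  qed (use l in simp)
  then have "row_types M (set R) (\<Union>(set ` ?Z)) \<le> (\<alpha> ^ l) ^ card (set ` ?Z)"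
    using finY by (intro row_types_Union) auto
  also have "\<dots> \<le> (\<alpha> ^ l) ^ (l * l * l)"
  proof (rule power_increasing)
    have "card (set ` ?Z) \<le> card ?Z" using finY by (intro card_image_le) auto
    also have "\<dots> \<le> card \<Y>" using finY by (intro card_mono) auto
    finally show "card (set ` ?Z) \<le> l * l * l" using Y by simp
  qed (use alphabet in simp)
  finally have Z: "row_types M (set R) (cells ?Z) \<le> (\<alpha> ^ l) ^ (l * l * l)" .
  have "row_types M (set R) (cells {C \<in> set D. \<not> mixed same l R C}) \<le>
      row_types M (set R) (cells (set D - \<Y>) \<union> cells ?Z)"
    by (intro row_types_mono) auto
  also have "\<dots> \<le> row_types M (set R) (cells (set D - \<Y>)) * row_types M (set R) (cells ?Z)"
    by (intro row_types_Un) simp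
  also have "\<dots> \<le> max_classes" unfolding max_classes_def using Y Z by (intro mult_mono) auto
  finally show ?thesis .
qed

text \<open>Spans of parts that lie in different intervals are disjoint.\<close>

lemma compatible_overlapping:
  assumes D: "division D" and A: "compatible D A"
  shows "overlapping (2 * max_classes) U L (set ` set A)"
  unfolding overlapping_def
proof
  fix S assume "S \<in> set ` set A"
  then obtain R where R: "R \<in> set D" "S \<subseteq> set R" using A unfolding compatible_def by blast
  have "{T \<in> set ` set A. T \<noteq> S \<and> in_conflict U L S T} \<subseteq> set ` set (parts_in R A)"
  proof
    fix T assume "T \<in> {T \<in> set ` set A. T \<noteq> S \<and> in_conflict U L S T}"
    then obtain P z where P: "P \<in> set A" "T = set P" and z: "z \<in> span_of U L S" "z \<in> span_of U L T"
      by (auto simp: in_conflict_def)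
    obtain R' where R': "R' \<in> set D" "set P \<subseteq> set R'" using A P unfolding compatible_def by blast
    have "z \<in> set R" "z \<in> set R'" using span_within_part[OF D] R R' P z by blast+
    then have "R' = R" using division_disjoint_sets[OF D] R R' by metis
    then show "T \<in> set ` set (parts_in R A)" using P R' by auto
  qed
  then have "card {T \<in> set ` set A. T \<noteq> S \<and> in_conflict U L S T} \<le>
      card (set ` set (parts_in R A))" by (intro card_mono) auto
  also have "\<dots> \<le> length (parts_in R A)"
    by (meson List.finite_set card_image_le card_length le_trans)
  also have "\<dots> \<le> 2 * max_classes" using A R unfolding compatible_def by blast
  finally show "card {T \<in> set ` set A. T \<noteq> S \<and> in_conflict U L S T} \<le> 2 * max_classes" .
qed

text \<open>Let \<open>P\<close> lie in \<open>R\<close> and \<open>Q\<close> in \<open>C\<close>. If the zone of \<open>R\<close> and \<open>C\<close> is not mixed, then the rows of \<open>P\<close> agree on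
  \<open>C\<close> and the columns of \<open>Q\<close> agree on \<open>R\<close>, so all entries are equal. Hence \<open>Q\<close> has errors only in the
  few mixed zones of \<open>C\<close>.\<close>

lemma compatible_error:
  assumes D: "division D" "\<And>R. R \<in> set D \<Longrightarrow> certified D R"
    and A: "compatible D A" "compatible D A'" and Q: "Q \<in> set A'"
  shows "card {P \<in> set ` set A. \<exists>x\<in>P. \<exists>x'\<in>P. \<exists>y\<in>set Q. \<exists>y'\<in>set Q. M x y \<noteq> M x' y'} \<le>
    l * l * l * (2 * max_classes)"
proof -
  obtain C where C: "C \<in> set D" "set Q \<subseteq> set C" using A(2) Q unfolding compatible_def by blast
  define bad where "bad = {R \<in> set D. length D \<le> 1 \<or> mixed same l C R}"
  have "card bad \<le> l * l * l"
  proof (cases "length D \<le> 1")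
    case True
    then have "card bad \<le> 1" unfolding bad_def using card_length[of D] by simp
    moreover have "1 \<le> l * l * l" using l_pos by (simp add: Suc_le_eq)
    ultimately show ?thesis by linarith
  next
    case False
    then show ?thesis using few_mixed[OF D(2)[OF C(1)]] by (simp add: bad_def)
  qed
  have "{P \<in> set ` set A. \<exists>x\<in>P. \<exists>x'\<in>P. \<exists>y\<in>set Q. \<exists>y'\<in>set Q. M x y \<noteq> M x' y'} \<subseteq>
      (\<Union>R\<in>bad. set ` set (parts_in R A))"
  proof clarify
    fix P x x' y y'
    assume P: "P \<in> set A" and x: "x \<in> set P" "x' \<in> set P" and y: "y \<in> set Q" "y' \<in> set Q"
      and neq: "M x y \<noteq> M x' y'"
    obtain R where R: "R \<in> set D" "set P \<subseteq> set R" using A(1) P unfolding compatible_def by blast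
    have "R \<in> bad"
    proof (rule ccontr)
      assume nb: "R \<notin> bad"
      then have nb: "\<not> length D \<le> 1" "\<not> mixed same l C R" "\<not> mixed same l R C"
        using R by (auto simp: bad_def mixed_def)
      obtain R' where R': "R' \<in> set D" "x \<in> set R'"
        "\<forall>C\<in>set D. mixed same l R' C \<or> (\<forall>z\<in>set C. M x z = M x' z)"
        using A(1) P x nb(1) unfolding compatible_def related_iff by blast
      have "R' = R" using division_disjoint_sets[OF D(1)] R R' x by blast
      then have 1: "M x y = M x' y" using R' C y nb by blast
      obtain C' where C': "C' \<in> set D" "y \<in> set C'"
        "\<forall>R\<in>set D. mixed same l C' R \<or> (\<forall>z\<in>set R. M y z = M y' z)"
        using A(2) Q y nb(1) unfolding compatible_def related_iff by blast
      have "C' = C" using division_disjoint_sets[OF D(1)] C C' y by blast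
      then have "M y x' = M y' x'" using C' R x nb by blast
      then have "M x' y = M x' y'" using transposed by metis
      then show False using 1 neq by simp
    qed
    then show "set P \<in> (\<Union>R\<in>bad. set ` set (parts_in R A))" using P R by auto
  qed
  then have "card {P \<in> set ` set A. \<exists>x\<in>P. \<exists>x'\<in>P. \<exists>y\<in>set Q. \<exists>y'\<in>set Q. M x y \<noteq> M x' y'} \<le>
      card (\<Union>R\<in>bad. set ` set (parts_in R A))"
    by (intro card_mono) (auto simp: bad_def)
  also have "\<dots> \<le> (\<Sum>R\<in>bad. 2 * max_classes)"
  proof (intro order.trans[OF card_UN_le] sum_mono)
    fix R assume "R \<in> bad"
    then have "length (parts_in R A) \<le> 2 * max_classes"
      using A(1) unfolding compatible_def bad_def by blast
    then show "card (set ` set (parts_in R A)) \<le> 2 * max_classes"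
      by (meson List.finite_set card_image_le card_length le_trans)
  qed (simp add: bad_def)
  also have "\<dots> \<le> l * l * l * (2 * max_classes)" using \<open>card bad \<le> l * l * l\<close> by simp
  finally show ?thesis .
qed

lemma mset_concat_eq: "mset (concat A) = \<Sum>\<^sub># (image_mset mset (mset A))"
  by (induction A) auto

lemma compatible_merge_classes:
  assumes D: "division D" and A: "compatible D A"
    and m: "mset A = {#P, P'#} + B" "mset A' = {#P @ P'#} + B"
    and r: "related same l D (rep P) (rep P')"
  shows "compatible D A'" "merge_two (set ` set A) (set ` set A')"
proof -
  have lp: "lists_partition A" using A by (simp add: compatible_def)
  have sA: "set A = insert P (insert P' (set_mset B))" and sA': "set A' = insert (P @ P') (set_mset B)"
    using m[THEN arg_cong[where f = set_mset]] by auto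
  then have PA: "P \<in> set A" "P' \<in> set A" and BA: "set_mset B \<subseteq> set A" by auto
  have "mset (concat A') = mset (concat A)" using m by (simp add: mset_concat_eq)
  then have dc: "distinct (concat A') = distinct (concat A)" "set (concat A') = set (concat A)"
    using mset_eq_imp_distinct_iff mset_eq_setD by blast+
  have ne: "P \<noteq> []" "P' \<noteq> []" "[] \<notin> set_mset B" using lp sA by (auto simp: lists_partition_def)
  have lp': "lists_partition A'" using lp dc ne sA' by (auto simp: lists_partition_def)
  show "compatible D A'"
  proof -
    have cls: "related same l D x (rep S)" "related same l D (rep S) x" if "x \<in> set S" "S \<in> set A" for x S
    proof -
      have "rep S \<in> set S" using that by (intro rep_in) auto
      then show "related same l D x (rep S)" "related same l D (rep S) x"
        using A that unfolding compatible_def by blast+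
    qed
    have PP: "related same l D x y" if "x \<in> set (P @ P')" "y \<in> set (P @ P')" for x y
    proof -
      have "related same l D z (rep P)" if "z \<in> set (P @ P')" for z
      proof (cases "z \<in> set P")
        case False
        then have "related same l D z (rep P')" using that cls PA by auto
        then show ?thesis using related_trans[OF D] related_sym r by blast
      qed (use cls PA in auto)
      then show ?thesis using that related_trans[OF D] related_sym by blast
    qed
    have in_part: "\<exists>R\<in>set D. set (P @ P') \<subseteq> set R"
    proof -
      obtain R where R: "R \<in> set D" "set P \<subseteq> set R" using A PA unfolding compatible_def by blast
      have "set P' \<subseteq> set R"
      proof
        fix y assume y: "y \<in> set P'"
        have "y \<in> U" using y PA lp by (auto simp: lists_partition_def)
        then obtain R'' where R'': "R'' \<in> set D" "y \<in> set R''" using D by (auto simp: division_def)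
        show "y \<in> set R"
        proof (cases "length D \<le> 1")
          case True
          then have "R'' = R" using R R'' by (cases D) auto
          then show ?thesis using R'' by simp
        next
          case False
          have "rep P \<in> set P" using ne by (simp add: rep_in)
          then have "related same l D (rep P) y" using y by (intro PP) auto
          then obtain R0 where "R0 \<in> set D" "rep P \<in> set R0" "y \<in> set R0"
            using False unfolding related_iff by blast
          then show ?thesis using division_disjoint_sets[OF D] R \<open>rep P \<in> set P\<close> by blast
        qed
      qed
      then show ?thesis using R by auto
    qed
    have "length (parts_in R A') \<le> length (parts_in R A)" for R
    proof -
      have "length (filter f xs) = size (filter_mset f (mset xs))" for f :: "nat list \<Rightarrow> bool" and xs
        by (metis mset_filter size_mset)
      then show ?thesis using m by auto
    qed
    then have "\<forall>R\<in>set D. length (parts_in R A') \<le> 2 * max_classes"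
      using A unfolding compatible_def by (meson le_trans)
    moreover have "(\<exists>R\<in>set D. set S \<subseteq> set R) \<and> (\<forall>x\<in>set S. \<forall>y\<in>set S. related same l D x y)"
      if "S \<in> set A'" for S
    proof (cases "S = P @ P'")
      case True
      then show ?thesis using PP in_part by blast
    next
      case False
      then have "S \<in> set A" using that sA' BA by auto
      then show ?thesis using A unfolding compatible_def by blast
    qed
    ultimately show ?thesis using lp' unfolding compatible_def by blast
  qed
  have dist: "S \<inter> S' = {}" if "S \<in> set ` set A" "S' \<in> set ` set A" "S \<noteq> S'" for S S'
    using lists_partition_partition_on[OF lp] that by (auto simp: partition_on_def disjoint_def)
  have "distinct A"
    using lp distinct_concat_iff[of A] by (metis lists_partition_def removeAll_id)
  obtain bs where bs: "mset bs = B" using ex_mset by blast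
  then have "mset A = mset (P # P' # bs)" using m(1) by simp
  then have "distinct (P # P' # bs)" using \<open>distinct A\<close> mset_eq_imp_distinct_iff by blast
  then have B: "P \<noteq> P'" "P \<notin># B" "P' \<notin># B" using bs by auto
  have inj: "inj_on set (set A)"
    using lp unfolding lists_partition_def distinct_concat_iff inj_on_def
    by (metis inf.idem removeAll_id set_empty)
  have "set P \<noteq> set P'" using inj PA B by (meson inj_onD)
  moreover have "set P \<notin> set ` set_mset B" "set P' \<notin> set ` set_mset B"
    using inj PA BA B by (auto dest: inj_onD)
  then have "set ` set A' = insert (set P \<union> set P') (set ` set A - {set P, set P'})"
    using sA sA' by auto
  ultimately show "merge_two (set ` set A) (set ` set A')"
    unfolding merge_two_def using PA by blast
qed

end

section \<open>Correctness of the greedy search\<close>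

type_synonym search_state =
  "nat list list \<times> nat list list \<times> (nat list list \<times> nat list list) list"

definition singletons :: "nat list \<Rightarrow> nat list list" where
  "singletons X = map (\<lambda>x. [x]) X"

text \<open>A state consists of a division, a partition and the pairs of partitions visited so far, latest
  first. Merging two parts of the partition amounts to two contraction steps, one for the rows and one
  for the columns.\<close>

definition step :: "entry_test \<Rightarrow> nat \<Rightarrow> search_state \<Rightarrow> search_state" where
  "step s l st = (let D = fst st; A = fst (snd st); h = snd (snd st);
      A' = merge_related (related s l D) A
    in if length A' < length A then (D, A', (A', A') # (A', A) # h)
       else (merge_adjacent (\<lambda>R. mergeable s l R D) D, A, h))"

text \<open>Each change of the state decreases the total number of parts, which is \<open>2 * length X\<close> at the start;
  so the iteration ends in a state that does not change any more.\<close>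

definition attempt ::
  "entry_test \<Rightarrow> nat \<Rightarrow> nat list \<Rightarrow> (nat list list \<times> nat list list) list" where
  "attempt s l X = (let st = (step s l ^^ (length X + length X))
        (singletons X, singletons X, [(singletons X, singletons X)])
      in if length (fst (snd st)) \<le> 1 then rev (snd (snd st)) else [])"

abbreviation as_partitions ::
  "nat list list \<times> nat list list \<Rightarrow> nat set set \<times> nat set set" where
  "as_partitions z \<equiv> (set ` set (fst z), set ` set (snd z))"

context bounded_alphabet begin

lemma merge_division:
  assumes D: "division (Ds @ R # R' # Es)"
  shows "division (Ds @ (R @ R') # Es)"
  using D unfolding division_def by auto

text \<open>The map \<open>\<phi>\<close> sends a part of \<open>D\<close> to the part of \<open>D'\<close> that contains it. The image of a set of
  exempted parts can be exempted in \<open>D'\<close>, and zones that are not mixed in \<open>D'\<close> consist of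
  zones that are not mixed in \<open>D\<close>.\<close>

lemma merged_division_props:
  assumes D: "division D" "D = Ds @ R # R' # Es" and D': "D' = Ds @ (R @ R') # Es"
    and cert: "\<And>C. C \<in> set D \<Longrightarrow> certified D C" and new: "mergeable same l (R @ R') D"
  defines "\<phi> \<equiv> \<lambda>C. if C = R \<or> C = R' then R @ R' else C"
  shows "set D' = \<phi> ` set D" "\<And>C. C \<in> set D \<Longrightarrow> set C \<subseteq> set (\<phi> C)"
    "\<And>C. C \<in> set D' \<Longrightarrow> certified D' C"
    "\<And>x y. related same l D x y \<Longrightarrow> related same l D' x y"
proof -
  have dist: "distinct D" by (rule distinct_division[OF D(1)])
  show img: "set D' = \<phi> ` set D"
  proof -
    have "\<phi> ` set Ds = set Ds" "\<phi> ` set Es = set Es"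
      using dist unfolding D(2) by (auto simp: \<phi>_def image_iff)
    then show ?thesis unfolding D(2) D' by (simp add: image_Un insert_commute) (simp add: \<phi>_def)
  qed
  show sub: "set C \<subseteq> set (\<phi> C)" if "C \<in> set D" for C by (auto simp: \<phi>_def)
  have RD: "R \<in> set D" "R' \<in> set D" using D by auto
  have transfer: "certified D' E"
    if Y: "\<Y> \<subseteq> set D" "card \<Y> \<le> l * l * l" "row_types M (set E) (cells (set D - \<Y>)) \<le> l" for E \<Y>
  proof -
    have fin: "finite \<Y>" using Y(1) finite_subset by auto
    have "cells (set D' - \<phi> ` \<Y>) \<subseteq> cells (set D - \<Y>)"
    proof
      fix z assume "z \<in> cells (set D' - \<phi> ` \<Y>)"
      then obtain C where C: "C \<in> set D" "\<phi> C \<notin> \<phi> ` \<Y>" "z \<in> set (\<phi> C)" using img by auto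
      show "z \<in> cells (set D - \<Y>)"
      proof (cases "C = R \<or> C = R'")
        case True
        then have eq: "\<phi> C = \<phi> R" "\<phi> C = \<phi> R'" "\<phi> C = R @ R'" by (auto simp: \<phi>_def)
        have "R \<notin> \<Y>" "R' \<notin> \<Y>" using C(2) eq(1,2) by (metis imageI)+
        moreover have "z \<in> set R \<or> z \<in> set R'" using C(3) unfolding eq(3) by simp
        ultimately show ?thesis using RD by auto
      next
        case False
        then show ?thesis using C by (auto simp: \<phi>_def)
      qed
    qed
    then have "row_types M (set E) (cells (set D' - \<phi> ` \<Y>)) \<le> l"
      using row_types_mono[of "set E" "set E" _ _ M] Y(3) by (meson List.finite_set le_trans order_refl)
    moreover have "card (\<phi> ` \<Y>) \<le> l * l * l" using card_image_le[OF fin, of \<phi>] Y(2) by linarith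
    moreover have "\<phi> ` \<Y> \<subseteq> set D'" using Y(1) img by auto
    ultimately show ?thesis unfolding certified_def by blast
  qed
  show "certified D' C" if C: "C \<in> set D'" for C
  proof (cases "C = R @ R'")
    case True
    have "R @ R' \<noteq> []" using D by (auto simp: division_def)
    then show ?thesis using mergeable_sound[OF _ dist new] transfer True by metis
  next
    case False
    then have "C \<in> set D" using C D(2) D' by auto
    then show ?thesis using cert transfer unfolding certified_def by blast
  qed
  fix x y assume rel: "related same l D x y"
  have "\<not> length D \<le> 1" using D(2) by simp
  then obtain R0 where R0: "R0 \<in> set D" "x \<in> set R0" "y \<in> set R0"
    and ag: "\<And>C. C \<in> set D \<Longrightarrow> mixed same l R0 C \<or> (\<forall>z\<in>set C. M x z = M y z)"
    using rel unfolding related_iff by blast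
  \<comment> \<open>Agreement on \<open>\<phi> C\<close> is put together from agreement on the parts that \<open>\<phi>\<close> maps to it.\<close>
  have ag': "mixed same l (\<phi> R0) (\<phi> C) \<or> (\<forall>z\<in>set C. M x z = M y z)" if "C \<in> set D" for C
    using ag[OF that] mixed_mono sub[OF that] sub[OF R0(1)] by blast
  have "mixed same l (\<phi> R0) (\<phi> C) \<or> (\<forall>z\<in>set (\<phi> C). M x z = M y z)" if C: "C \<in> set D" for C
  proof (cases "C = R \<or> C = R'")
    case True
    then have eq: "\<phi> R = \<phi> C" "\<phi> R' = \<phi> C" "set (\<phi> C) = set R \<union> set R'" by (auto simp: \<phi>_def)
    show ?thesis using ag'[OF RD(1)] ag'[OF RD(2)] unfolding eq by blast
  next
    case False
    then have "\<phi> C = C" by (simp add: \<phi>_def)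
    then show ?thesis using ag'[OF C] by simp
  qed
  then have "\<forall>C\<in>set D'. mixed same l (\<phi> R0) C \<or> (\<forall>z\<in>set C. M x z = M y z)" unfolding img by blast
  moreover have "\<phi> R0 \<in> set D'" "x \<in> set (\<phi> R0)" "y \<in> set (\<phi> R0)" using R0 sub img by auto
  ultimately show "related same l D' x y" unfolding related_iff by blast
qed

text \<open>If no two parts of \<open>A\<close> are related, their representatives in \<open>R\<close> have pairwise different types on the
  zones that are not mixed.\<close>

lemma stalled_few_classes:
  assumes D: "division D" "2 \<le> length D" and R: "R \<in> set D" "certified D R"
    and A: "compatible D A" and stalled: "sorted_wrt (\<lambda>P P'. \<not> related same l D (rep P) (rep P')) A"
  shows "length (parts_in R A) \<le> max_classes"
proof -
  let ?F = "parts_in R A"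
  have F: "P \<noteq> [] \<and> rep P \<in> set R" if "P \<in> set ?F" for P
    using that A rep_in[of P] unfolding compatible_def lists_partition_def by auto
  have "sorted_wrt (\<lambda>P P'. \<not> related same l D (rep P) (rep P')) ?F"
    by (rule sorted_wrt_filter[OF stalled])
  then have srt: "sorted_wrt (\<lambda>x y. \<not> related same l D x y) (map rep ?F)" by (simp add: sorted_wrt_map)
  have sub: "set (map rep ?F) \<subseteq> set R" using F by auto
  have refl: "related same l D x x" if "x \<in> set R" for x using that R unfolding related_iff by blast
  have neq: "distinct xs \<and> (\<forall>x\<in>set xs. \<forall>y\<in>set xs. related same l D x y \<longrightarrow> x = y)"
    if "sorted_wrt (\<lambda>x y. \<not> related same l D x y) xs" "set xs \<subseteq> set R" for xs
    using that
  proof (induction xs)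
    case (Cons a xs)
    have IH: "distinct xs" "\<forall>x\<in>set xs. \<forall>y\<in>set xs. related same l D x y \<longrightarrow> x = y" using Cons by simp_all
    have a: "\<forall>y\<in>set xs. \<not> related same l D a y" "related same l D a a" using Cons.prems refl by simp_all
    then have "a \<notin> set xs" "\<forall>y\<in>set xs. \<not> related same l D y a" using related_sym by blast+
    then show ?case using IH a(1) unfolding list.set distinct.simps by blast
  qed simp
  have d: "distinct (map rep ?F)"
    and n: "\<And>x y. x \<in> rep ` set ?F \<Longrightarrow> y \<in> rep ` set ?F \<Longrightarrow> related same l D x y \<Longrightarrow> x = y"
    using neq[OF srt sub] unfolding set_map by blast+
  have "length ?F = card (rep ` set ?F)" using distinct_card[OF d] by simp
  also have "\<dots> \<le> row_types M (set R) (cells {C \<in> set D. \<not> mixed same l R C})"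
  proof (rule card_le_row_types)
    fix x y assume x: "x \<in> rep ` set ?F" "y \<in> rep ` set ?F"
      and eq: "\<forall>z\<in>cells {C \<in> set D. \<not> mixed same l R C}. M x z = M y z"
    have "x \<in> set R" "y \<in> set R" using x F by auto
    moreover have "\<forall>C\<in>set D. mixed same l R C \<or> (\<forall>z\<in>set C. M x z = M y z)" using eq by blast
    ultimately have "related same l D x y" using R(1) unfolding related_iff by blast
    then show "x = y" using n x by blast
  qed (use F in auto)
  also have "\<dots> \<le> max_classes" by (rule few_classes[OF R(2)])
  finally show ?thesis .
qed

lemma length_filter_mono:
  "(\<And>x. x \<in> set xs \<Longrightarrow> f x \<Longrightarrow> g x) \<Longrightarrow> length (filter f xs) \<le> length (filter g xs)"
  by (induction xs) (auto simp: le_SucI)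

lemma compatible_merge_division:
  assumes D: "division D" "D = Ds @ R # R' # Es" and D': "D' = Ds @ (R @ R') # Es"
    and cert: "\<And>C. C \<in> set D \<Longrightarrow> certified D C" and new: "mergeable same l (R @ R') D"
    and A: "compatible D A" and stalled: "sorted_wrt (\<lambda>P P'. \<not> related same l D (rep P) (rep P')) A"
  shows "compatible D' A"
proof -
  note props = merged_division_props[OF D D' cert new]
  have RD: "R \<in> set D" "R' \<in> set D" "2 \<le> length D" using D by auto
  note few = stalled_few_classes[OF D(1) RD(3) _ cert A stalled]
  have "length (parts_in E A) \<le> 2 * max_classes" if E: "E \<in> set D'" for E
  proof (cases "E = R @ R'")
    case True
    have "length (parts_in E A) \<le>
        length (filter (\<lambda>P. set P \<subseteq> set R \<or> set P \<subseteq> set R') A)"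
    proof -
      have "set P \<subseteq> set R \<or> set P \<subseteq> set R'" if P: "P \<in> set A" "set P \<subseteq> set E" for P
      proof -
        obtain C where C: "C \<in> set D" "set P \<subseteq> set C" using A P unfolding compatible_def by blast
        have "P \<noteq> []" using A P unfolding compatible_def lists_partition_def by auto
        then have "rep P \<in> set P" by (rule rep_in)
        then have "C = R \<or> C = R'"
          using division_disjoint_sets[OF D(1)] C RD P True by (metis Un_iff set_append subsetD)
        then show ?thesis using C by auto
      qed
      then show ?thesis by (intro length_filter_mono) blast
    qed
    also have "\<dots> \<le> length (parts_in R A) + length (parts_in R' A)"
      by (induction A) auto
    also have "\<dots> \<le> 2 * max_classes" using few[OF RD(1) RD(1)] few[OF RD(2) RD(2)] by simp
    finally show ?thesis .
  next
    case False
    then have "E \<in> set D" using E D(2) D' by auto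
    then show ?thesis using A unfolding compatible_def by blast
  qed
  moreover have "\<exists>E\<in>set D'. set P \<subseteq> set E" if "P \<in> set A" for P
    using A that props(1,2) unfolding compatible_def by (metis (no_types, lifting) imageI subset_trans)
  ultimately show ?thesis using A props(4) unfolding compatible_def by blast
qed

definition good_pair :: "nat list list \<times> nat list list \<Rightarrow> bool" where
  "good_pair z \<longleftrightarrow> lists_partition (fst z) \<and> lists_partition (snd z) \<and>
     overlapping (2 * max_classes) U L (set ` set (fst z)) \<and>
     overlapping (2 * max_classes) U L (set ` set (snd z)) \<and>
     (\<forall>Q\<in>set ` set (snd z). col_error matrix_of (set ` set (fst z)) Q \<le> l * l * l * (2 * max_classes)) \<and>
     (\<forall>P\<in>set ` set (fst z). row_error matrix_of (set ` set (snd z)) P \<le> l * l * l * (2 * max_classes))"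

lemma compatible_good_pair:
  assumes D: "division D" "\<And>R. R \<in> set D \<Longrightarrow> certified D R"
    and A: "compatible D A" "compatible D A'"
  shows "good_pair (A, A')"
proof -
  have c1: "\<not> constant_submatrix matrix_of P Q \<longleftrightarrow> (\<exists>x\<in>P. \<exists>x'\<in>P. \<exists>y\<in>Q. \<exists>y'\<in>Q. M x y \<noteq> M x' y')" for P Q
    by (auto simp: constant_submatrix_def matrix_of_def)
  have c2: "\<not> constant_submatrix matrix_of P Q \<longleftrightarrow> (\<exists>y\<in>Q. \<exists>y'\<in>Q. \<exists>x\<in>P. \<exists>x'\<in>P. M y x \<noteq> M y' x')" for P Q
    unfolding c1 by (subst transposed) blast
  show ?thesis
    unfolding good_pair_def fst_conv snd_conv
  proof (intro conjI ballI)
    show "overlapping (2 * max_classes) U L (set ` set A)" "overlapping (2 * max_classes) U L (set ` set A')"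
      using compatible_overlapping[OF D(1)] A by auto
    show "lists_partition A" "lists_partition A'" using A by (auto simp: compatible_def)
    show "col_error matrix_of (set ` set A) Q \<le> l * l * l * (2 * max_classes)" if "Q \<in> set ` set A'" for Q
      using compatible_error[OF D A] that unfolding col_error_def c1 by blast
    show "row_error matrix_of (set ` set A') P \<le> l * l * l * (2 * max_classes)" if "P \<in> set ` set A" for P
      using compatible_error[OF D A(2,1)] that unfolding row_error_def c2 by blast
  qed
qed

text \<open>Each merge in the partition adds two pairs, so a history that has reached a single part is of length
  \<open>2 * length X - 1\<close>, as required of a contraction sequence.\<close>

definition history :: "nat list \<Rightarrow> nat list list \<Rightarrow> (nat list list \<times> nat list list) list \<Rightarrow> bool" where
  "history X A h \<longleftrightarrow> h \<noteq> [] \<and> hd h = (A, A) \<and> last h = (singletons X, singletons X) \<and>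
     length h + 2 * length A = 2 * length X + 1 \<and> (\<forall>z\<in>set h. good_pair z) \<and>
     successively (\<lambda>z z'. contraction_step (as_partitions z') (as_partitions z)) h"

definition invariant :: "nat list \<Rightarrow> search_state \<Rightarrow> bool" where
  "invariant X st \<longleftrightarrow> (case st of (D, A, h) \<Rightarrow>
     division D \<and> (\<forall>R\<in>set D. certified D R) \<and> compatible D A \<and> history X A h)"

lemma step_cases:
  assumes inv: "invariant X (D, A, h)"
  obtains (merged) D' A' h' where "step same l (D, A, h) = (D', A', h')" "invariant X (D', A', h')"
      "Suc (length D' + length A') = length D + length A"
  | (stuck) "step same l (D, A, h) = (D, A, h)"
      "sorted_wrt (\<lambda>P P'. \<not> related same l D (rep P) (rep P')) A"
      "\<And>i. Suc i < length D \<Longrightarrow> \<not> mergeable same l (D ! i @ D ! Suc i) D"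
proof (rule merge_related_cases[of "related same l D" A])
  have D: "division D" and cert: "\<And>R. R \<in> set D \<Longrightarrow> certified D R" and A: "compatible D A"
    and h: "history X A h" using inv by (auto simp: invariant_def)
  {
    fix P P' B
    let ?A = "merge_related (related same l D) A"
    assume r: "related same l D (rep P) (rep P')" and m: "mset A = {#P, P'#} + B" "mset ?A = {#P @ P'#} + B"
    have len: "length A = Suc (length ?A)" by (rule merged_shorter[OF m])
    have A': "compatible D ?A" and mt: "merge_two (set ` set A) (set ` set ?A)"
      using compatible_merge_classes[OF D A m r] by auto
    obtain h1 where h1: "h = (A, A) # h1" using h by (cases h) (auto simp: history_def)
    have "history X ?A ((?A, ?A) # (?A, A) # h)"
      using h len mt compatible_good_pair[OF D cert A' A'] compatible_good_pair[OF D cert A' A]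
      unfolding history_def h1 by (auto simp: contraction_step_def)
    then have "invariant X (D, ?A, (?A, ?A) # (?A, A) # h)"
      using D cert A' by (simp add: invariant_def)
    moreover have "step same l (D, A, h) = (D, ?A, (?A, ?A) # (?A, A) # h)"
      using len by (simp add: step_def Let_def)
    ultimately show ?thesis using len by (intro merged) auto
  }
  assume same_A: "merge_related (related same l D) A = A"
    and st: "sorted_wrt (\<lambda>P P'. \<not> related same l D (rep P) (rep P')) A"
  let ?D = "merge_adjacent (\<lambda>R. mergeable same l R D) D"
  have step: "step same l (D, A, h) = (?D, A, h)" using same_A by (simp add: step_def Let_def)
  show ?thesis
  proof (rule merge_adjacent_cases[of "\<lambda>R. mergeable same l R D" D])
    assume "?D = D" "\<And>i. Suc i < length D \<Longrightarrow> \<not> mergeable same l (D ! i @ D ! Suc i) D"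
    then show ?thesis using step st by (intro stuck) auto
  next
    fix Ds R R' Es
    assume new: "mergeable same l (R @ R') D" and eq: "D = Ds @ R # R' # Es" "?D = Ds @ (R @ R') # Es"
    have "division ?D" using D eq merge_division by metis
    moreover have "\<forall>R\<in>set ?D. certified ?D R" using merged_division_props(3)[OF D eq cert new] by blast
    moreover have "compatible ?D A" by (rule compatible_merge_division[OF D eq cert new A st])
    moreover have "Suc (length ?D) = length D" using arg_cong[OF eq(1), of length] arg_cong[OF eq(2), of length] by simp
    ultimately show ?thesis using step h by (intro merged) (auto simp: invariant_def)
  qed
qed

lemma initial_invariant:
  assumes X: "sorted_wrt (\<lambda>x y. (x, y) \<in> L) X" "set X = U"
  shows "invariant X (singletons X, singletons X, [(singletons X, singletons X)])"
proof -
  have cc: "concat (singletons X) = X" unfolding singletons_def by (induction X) auto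
  have D: "division (singletons X)" using X cc by (auto simp: division_def singletons_def)
  have cert: "certified (singletons X) R" if R: "R \<in> set (singletons X)" for R
  proof -
    obtain x where "R = [x]" using R by (auto simp: singletons_def)
    then have "row_types M (set R) Y \<le> l" for Y using row_types_le_card[of "set R" M Y] l_pos by simp
    then show ?thesis unfolding certified_def by (intro exI[of _ "{}"]) auto
  qed
  have lp: "lists_partition (singletons X)"
    using distinct_concat_division[OF D] X cc by (auto simp: lists_partition_def singletons_def)
  have mc: "1 \<le> max_classes" unfolding max_classes_def using l_pos alphabet by (simp add: Suc_le_eq)
  have "compatible (singletons X) (singletons X)"
    unfolding compatible_def
  proof (intro conjI ballI lp)
    fix P assume P: "P \<in> set (singletons X)"
    then show "\<exists>R\<in>set (singletons X). set P \<subseteq> set R" by blast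
    fix x y assume "x \<in> set P" "y \<in> set P"
    then show "related same l (singletons X) x y"
      using P unfolding related_iff by (auto simp: singletons_def)
  next
    fix R assume "R \<in> set (singletons X)"
    then obtain x where x: "R = [x]" by (auto simp: singletons_def)
    have "distinct (singletons X)" using distinct_division[OF D] .
    then have "length (parts_in R (singletons X)) =
        card (set (parts_in R (singletons X)))"
      by (intro distinct_card[symmetric]) simp
    also have "\<dots> \<le> card {R}" by (intro card_mono) (auto simp: x singletons_def)
    finally show "length (parts_in R (singletons X)) \<le> 2 * max_classes" using mc by simp
  qed
  moreover from this have "history X (singletons X) [(singletons X, singletons X)]"
    using compatible_good_pair[OF D cert] by (simp add: history_def singletons_def)
  ultimately show ?thesis using D cert by (simp add: invariant_def)
qed

lemma iterate_step:
  assumes "invariant X st"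
  shows "invariant X ((step same l ^^ j) st) \<and>
    (step same l ((step same l ^^ j) st) = (step same l ^^ j) st \<or>
     length (fst ((step same l ^^ j) st)) + length (fst (snd ((step same l ^^ j) st))) + j \<le>
       length (fst st) + length (fst (snd st)))"
proof (induction j)
  case (Suc j)
  obtain D A h where st: "(step same l ^^ j) st = (D, A, h)" by (cases "(step same l ^^ j) st")
  have inv: "invariant X (D, A, h)" using Suc st by simp
  show ?case
  proof (cases rule: step_cases[OF inv])
    case (1 D' A' h')
    then have "step same l (D, A, h) \<noteq> (D, A, h)" by auto
    then show ?thesis using 1 Suc st by auto
  next
    case 2
    then show ?thesis using Suc st by simp
  qed
qed (use assms in simp)

text \<open>Divisions that violate this condition are rich: all pairs of consecutive parts keep many types no
  matter which few parts are removed. They are the only obstacle to the search.\<close>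

definition no_rich_division :: bool where
  "no_rich_division \<longleftrightarrow> (\<forall>D. division D \<longrightarrow> 2 \<le> length D \<longrightarrow> (\<exists>i \<Y>. Suc i < length D \<and> \<Y> \<subseteq> set D \<and>
     card \<Y> \<le> l * l \<and> row_types M (set (D ! i @ D ! Suc i)) (cells (set D - \<Y>)) \<le> l))"

text \<open>If the final state has at least two classes, then its division has at least two parts, as a single
  part relates everything; and no two consecutive parts are mergeable. By \<open>mergeable_complete\<close>, the
  division is rich.\<close>

lemma attempt_result:
  assumes X: "sorted_wrt (\<lambda>x y. (x, y) \<in> L) X" "set X = U"
  shows "attempt same l X \<noteq> [] \<Longrightarrow>
      pe_sequence matrix_of (2 * max_classes) (l * l * l * (2 * max_classes)) (map as_partitions (attempt same l X))"
    and "no_rich_division \<Longrightarrow> attempt same l X \<noteq> []"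
proof -
  have dX: "distinct X"
    using distinct_concat_division[of "[X]"] X U_nonempty by (auto simp: division_def)
  have cX: "card U = length X" using distinct_card[OF dX] X by simp
  let ?st0 = "(singletons X, singletons X, [(singletons X, singletons X)])"
  obtain D A h where st: "(step same l ^^ (length X + length X)) ?st0 = (D, A, h)"
    by (cases "(step same l ^^ (length X + length X)) ?st0")
  have att: "attempt same l X = (if length A \<le> 1 then rev h else [])"
    by (simp add: attempt_def st Let_def)
  note it = iterate_step[OF initial_invariant[OF X], of "length X + length X"]
  have inv: "invariant X (D, A, h)" using it st by simp
  have A0: "0 < length A" using inv U_nonempty by (auto simp: invariant_def compatible_def lists_partition_def)
  then have fixpoint: "step same l (D, A, h) = (D, A, h)"
    using it st A0 by (auto simp: singletons_def)
  have h: "history X A h" and D: "division D" and A: "compatible D A" using inv by (auto simp: invariant_def)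
  {
    assume "attempt same l X \<noteq> []"
    then have "length A \<le> 1" and r: "attempt same l X = rev h" using att by (auto split: if_splits)
    then have lA: "length A = 1" using A0 by linarith
    then obtain P where "A = [P]" by (auto simp: length_Suc_conv)
    then have PU: "set ` set A = {U}" using A by (auto simp: compatible_def lists_partition_def)
    let ?Ps = "map as_partitions (attempt same l X)"
    have hd: "hd ?Ps = ((\<lambda>x. {x}) ` U, (\<lambda>x. {x}) ` U)"
      using h X by (simp add: r history_def hd_map hd_rev singletons_def image_image)
    have last: "last ?Ps = ({U}, {U})"
      using h PU by (simp add: r history_def last_map last_rev)
    have "successively (\<lambda>z z'. contraction_step (as_partitions z) (as_partitions z')) (rev h)"
      using h by (simp add: history_def)
    then have succ: "contraction_step (?Ps ! i) (?Ps ! Suc i)" if "Suc i < length ?Ps" for i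
      using that by (simp add: r successively_conv_nth)
    have good: "good_pair z" if "z \<in> set (attempt same l X)" for z
      using that h by (simp add: r history_def)
    have "contraction_sequence matrix_of ?Ps"
      unfolding contraction_sequence_def
    proof (intro conjI)
      show "length ?Ps = card (rows matrix_of) + card (cols matrix_of) - 1"
      proof -
        have "length h + 2 * length A = 2 * length X + 1" using h by (simp add: history_def)
        then have "length h = length X + length X - 1" using lA by linarith
        then show ?thesis by (simp add: r matrix_of_def cX)
      qed
      show "?Ps \<noteq> []" using h by (simp add: r history_def)
      show "\<forall>\<P>\<in>set ?Ps. partition_on (rows matrix_of) (fst \<P>) \<and> partition_on (cols matrix_of) (snd \<P>)"
        using good lists_partition_partition_on by (auto simp: good_pair_def matrix_of_def)
    qed (use hd last succ in \<open>auto simp: matrix_of_def\<close>)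
    then show "pe_sequence matrix_of (2 * max_classes) (l * l * l * (2 * max_classes)) ?Ps"
      unfolding pe_sequence_def using good by (auto simp: good_pair_def matrix_of_def)
  }
  assume no_rich_division
  have "length A \<le> 1"
  proof (cases rule: step_cases[OF inv])
    case 2
    show ?thesis
    proof (cases "length D \<le> 1")
      case True
      then have "sorted_wrt (\<lambda>P P'. False) A" using 2(2) by (simp add: related_def)
      then show ?thesis by (cases A rule: remdups_adj.cases) auto
    next
      case False
      then obtain i \<Y> where i: "Suc i < length D" and Y: "\<Y> \<subseteq> set D" "card \<Y> \<le> l * l"
        "row_types M (set (D ! i @ D ! Suc i)) (cells (set D - \<Y>)) \<le> l"
        using \<open>no_rich_division\<close> D unfolding no_rich_division_def by fastforce
      have "D ! i \<noteq> []" using D i by (metis Suc_lessD division_def nth_mem)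
      then have "mergeable same l (D ! i @ D ! Suc i) D"
        using distinct_division[OF D] Y by (intro mergeable_complete) auto
      then show ?thesis using 2(3) i by blast
    qed
  qed (use fixpoint in auto)
  then show "attempt same l X \<noteq> []" using att h by (simp add: history_def)
qed

lemma no_rich_division_if_large: "card U \<le> l \<Longrightarrow> no_rich_division"
  unfolding no_rich_division_def
proof (intro allI impI)
  fix D assume l: "card U \<le> l" and D: "division D" "2 \<le> length D"
  have "D ! 0 \<in> set D" "D ! Suc 0 \<in> set D"
    using nth_mem[of 0 D] nth_mem[of "Suc 0" D] D(2) by linarith+
  then have "set (D ! 0 @ D ! Suc 0) \<subseteq> U" using D by (auto simp: division_def)
  then have "card (set (D ! 0 @ D ! Suc 0)) \<le> l" using card_mono[OF finite_U] l by (meson le_trans)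
  then have "row_types M (set (D ! 0 @ D ! Suc 0)) Y \<le> l" for Y
    using row_types_le_card[of "set (D ! 0 @ D ! Suc 0)" M Y] by simp
  then show "\<exists>i \<Y>. Suc i < length D \<and> \<Y> \<subseteq> set D \<and> card \<Y> \<le> l * l \<and>
      row_types M (set (D ! i @ D ! Suc i)) (cells (set D - \<Y>)) \<le> l"
    using D(2) by (intro exI[of _ 0] exI[of _ "{}"]) auto
qed

lemma no_rich_division_if_pe_sequence:
  assumes "pe_sequence matrix_of p e Ps" "2 * (p + e + 1) \<le> l"
  shows no_rich_division
  unfolding no_rich_division_def
proof (intro allI impI)
  fix D assume D: "division D" "2 \<le> length D"
  have "3 * ((p + 1) * e) \<le> (2 * (p + e + 1)) * (2 * (p + e + 1))"
    by (simp add: algebra_simps)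
  also have "\<dots> \<le> l * l" using assms(2) by (intro mult_mono) auto
  finally have "3 * ((p + 1) * e) \<le> l * l" .
  moreover have "p + 1 \<le> l" using assms(2) by simp
  ultimately show "\<exists>i \<Y>. Suc i < length D \<and> \<Y> \<subseteq> set D \<and> card \<Y> \<le> l * l \<and>
      row_types M (set (D ! i @ D ! Suc i)) (cells (set D - \<Y>)) \<le> l"
    using few_types_of_pe_sequence[OF assms(1) D] by (meson le_trans)
qed

end

section \<open>Functions computable in polynomial time\<close>

definition env_size :: "('x \<Rightarrow> tree) list \<Rightarrow> 'x \<Rightarrow> nat" where
  "env_size Es x = (\<Sum>F\<leftarrow>Es. size (F x))"

text \<open>As the base is at least 2, one constant can absorb coefficients, summands and the degree.\<close>

definition poly_bounded :: "('x \<Rightarrow> nat) \<Rightarrow> ('x \<Rightarrow> nat) \<Rightarrow> bool" where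
  "poly_bounded s T \<longleftrightarrow> (\<exists>c. \<forall>x. T x \<le> (s x + 2) ^ c)"

lemma poly_bounded_mono:
  assumes "poly_bounded s T" "\<And>x. T' x \<le> T x"
  shows "poly_bounded s T'"
  using assms unfolding poly_bounded_def by (meson le_trans)

lemma poly_bounded_const: "poly_bounded s (\<lambda>_. c)"
proof -
  have "c \<le> (s x + 2) ^ c" for x
    using less_exp[of c] power_mono[of 2 "s x + 2" c] by linarith
  then show ?thesis unfolding poly_bounded_def by blast
qed

lemma poly_bounded_self: "poly_bounded s s"
  unfolding poly_bounded_def by (rule exI[of _ 1]) simp

lemma poly_bounded_mult:
  assumes "poly_bounded s T" "poly_bounded s T'"
  shows "poly_bounded s (\<lambda>x. T x * T' x)"
proof -
  obtain c c' where "\<And>x. T x \<le> (s x + 2) ^ c" "\<And>x. T' x \<le> (s x + 2) ^ c'"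
    using assms unfolding poly_bounded_def by blast
  then have "T x * T' x \<le> (s x + 2) ^ (c + c')" for x
    by (simp add: power_add mult_mono)
  then show ?thesis unfolding poly_bounded_def by blast
qed

lemma poly_bounded_add:
  assumes "poly_bounded s T" "poly_bounded s T'"
  shows "poly_bounded s (\<lambda>x. T x + T' x)"
proof -
  obtain c c' where c: "\<And>x. T x \<le> (s x + 2) ^ c" and c': "\<And>x. T' x \<le> (s x + 2) ^ c'"
    using assms unfolding poly_bounded_def by blast
  have "T x + T' x \<le> (s x + 2) ^ (Suc (max c c'))" for x
  proof -
    let ?b = "s x + 2"
    have "?b ^ c \<le> ?b ^ max c c'" "?b ^ c' \<le> ?b ^ max c c'"
      by (intro power_increasing; simp)+
    then have "T x + T' x \<le> 2 * ?b ^ max c c'" using c[of x] c'[of x] by linarith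
    also have "\<dots> \<le> ?b * ?b ^ max c c'" by (rule mult_right_mono) auto
    finally show ?thesis by simp
  qed
  then show ?thesis unfolding poly_bounded_def by blast
qed

lemma poly_bounded_Suc: "poly_bounded s T \<Longrightarrow> poly_bounded s (\<lambda>x. Suc (T x))"
  using poly_bounded_add[OF _ poly_bounded_const[of s 1]] by simp

lemma poly_bounded_trans:
  assumes "poly_bounded s T" "poly_bounded r s"
  shows "poly_bounded r T"
proof -
  obtain c d where c: "\<And>x. T x \<le> (s x + 2) ^ c" and d: "\<And>x. s x \<le> (r x + 2) ^ d"
    using assms unfolding poly_bounded_def by blast
  have "T x \<le> (r x + 2) ^ ((d + 2) * c)" for x
  proof -
    let ?b = "r x + 2"
    have p: "1 \<le> ?b ^ d" by simp
    have "s x + 2 \<le> ?b ^ d + 2" using d[of x] by simp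
    also have "\<dots> \<le> ?b ^ d * 2 ^ 2" using p by (simp only: power2_eq_square)
    also have "\<dots> \<le> ?b ^ d * ?b ^ 2" by (intro mult_left_mono power_mono) auto
    finally have "s x + 2 \<le> ?b ^ (d + 2)" by (simp only: power_add)
    then have "(s x + 2) ^ c \<le> (?b ^ (d + 2)) ^ c" by (rule power_mono) simp
    with c[of x] show ?thesis unfolding power_mult by linarith
  qed
  then show ?thesis unfolding poly_bounded_def by blast
qed

lemma poly_bounded_reindex: "poly_bounded s T \<Longrightarrow> poly_bounded (\<lambda>z. s (g z)) (\<lambda>z. T (g z))"
  unfolding poly_bounded_def by blast

lemmas poly_bounded_intros =
  poly_bounded_const poly_bounded_add poly_bounded_mult poly_bounded_Suc

text \<open>The functions \<open>\<pi>\<close> may be embedded in any program at offset \<open>k\<close>. As only the offset matters, programs can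
  be composed by concatenation, without renumbering their calls.\<close>

definition realizes ::
  "nat \<Rightarrow> program \<Rightarrow> expr \<Rightarrow> ('x \<Rightarrow> tree) list \<Rightarrow> ('x \<Rightarrow> tree) \<Rightarrow> ('x \<Rightarrow> nat) \<Rightarrow> bool" where
  "realizes k \<pi> a Es F T \<longleftrightarrow>
     (\<forall>\<pi>0 \<pi>1 x. length \<pi>0 = k \<longrightarrow>
        (\<exists>t\<le>T x. evaluates (\<pi>0 @ \<pi> @ \<pi>1) (map (\<lambda>F. F x) Es) a (F x) t))"

text \<open>The output \<open>F x\<close> is computable in polynomial time from the values of the inputs \<open>Es\<close> at \<open>x\<close>, where \<open>x\<close> is
  the abstract data that inputs and output encode. Time does not bound the size of
  the output, because subtrees are shared; so the size is bounded separately.\<close>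

definition ptime :: "('x \<Rightarrow> tree) list \<Rightarrow> ('x \<Rightarrow> tree) \<Rightarrow> bool" where
  "ptime Es F \<longleftrightarrow>
     poly_bounded (env_size Es) (\<lambda>x. size (F x)) \<and>
     (\<exists>T. poly_bounded (env_size Es) T \<and> (\<forall>k. \<exists>\<pi> a. realizes k \<pi> a Es F T))"

lemma realizes_append:
  assumes "realizes k \<pi> a Es F T"
  shows "realizes k (\<pi> @ \<pi>') a Es F T"
  unfolding realizes_def
proof (intro allI impI)
  fix \<pi>0 \<pi>1 :: program and x assume "length \<pi>0 = k"
  then show "\<exists>t\<le>T x. evaluates (\<pi>0 @ (\<pi> @ \<pi>') @ \<pi>1) (map (\<lambda>F. F x) Es) a (F x) t"
    using assms[unfolded realizes_def, rule_format, of \<pi>0 x "\<pi>' @ \<pi>1"] by simp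
qed

lemma realizes_prepend:
  assumes "realizes (k + length \<pi>) \<pi>' a Es F T"
  shows "realizes k (\<pi> @ \<pi>') a Es F T"
  unfolding realizes_def
proof (intro allI impI)
  fix \<pi>0 \<pi>1 :: program and x assume "length \<pi>0 = k"
  then show "\<exists>t\<le>T x. evaluates (\<pi>0 @ (\<pi> @ \<pi>') @ \<pi>1) (map (\<lambda>F. F x) Es) a (F x) t"
    using assms[unfolded realizes_def, rule_format, of "\<pi>0 @ \<pi>" x \<pi>1] by simp
qed

lemma ptime_size: "ptime Es F \<Longrightarrow> poly_bounded (env_size Es) (\<lambda>x. size (F x))"
  by (simp add: ptime_def)

lemma ptime_unop:
  assumes F: "ptime Es F"
    and size: "\<And>x. size (G x) \<le> size (F x)"
    and eval: "\<And>\<pi> x a t. evaluates \<pi> (map (\<lambda>F. F x) Es) a (F x) t \<Longrightarrow>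
                 evaluates \<pi> (map (\<lambda>F. F x) Es) (op a) (G x) (t + 1)"
  shows "ptime Es G"
proof -
  obtain T where T: "poly_bounded (env_size Es) T" and r: "\<And>k. \<exists>\<pi> a. realizes k \<pi> a Es F T"
    using F unfolding ptime_def by blast
  have "\<exists>\<pi> a. realizes k \<pi> a Es G (\<lambda>x. Suc (T x))" for k
  proof -
    obtain \<pi> a where "realizes k \<pi> a Es F T" using r by blast
    then have "realizes k \<pi> (op a) Es G (\<lambda>x. Suc (T x))"
      unfolding realizes_def using eval by (metis Suc_eq_plus1 Suc_le_mono)
    then show ?thesis by blast
  qed
  then show ?thesis
    unfolding ptime_def
    using poly_bounded_mono[OF ptime_size[OF F] size] poly_bounded_Suc[OF T] by blast
qed

lemma ptime_left: "ptime Es F \<Longrightarrow> ptime Es (\<lambda>x. left (F x))"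
proof (rule ptime_unop[where op = LeftE and F = F])
  show "size (left (F x)) \<le> size (F x)" for x by (cases "F x") auto
qed (auto intro: eval_Left[unfolded One_nat_def add_Suc_right add_0_right])

lemma ptime_right: "ptime Es F \<Longrightarrow> ptime Es (\<lambda>x. right (F x))"
proof (rule ptime_unop[where op = RightE and F = F])
  show "size (right (F x)) \<le> size (F x)" for x by (cases "F x") auto
qed (auto intro: eval_Right[unfolded One_nat_def add_Suc_right add_0_right])

lemma ptime_Leaf: "ptime Es (\<lambda>_. Leaf)"
proof -
  have "realizes k [] LeafE Es (\<lambda>_. Leaf) (\<lambda>_. 1)" for k
    unfolding realizes_def using eval_LeafE by blast
  then show ?thesis unfolding ptime_def using poly_bounded_const by auto
qed

lemma ptime_var: 
  assumes "F \<in> set Es"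
  shows "ptime Es F"
proof -
  obtain i where i: "i < length Es" "Es ! i = F" using assms by (auto simp: in_set_conv_nth)
  have "realizes k [] (Var i) Es F (\<lambda>_. 1)" for k
    unfolding realizes_def using i eval_Var[of i "map (\<lambda>F. F x) Es" for x] by force
  moreover have "size (F x) \<le> env_size Es x" for x
    unfolding env_size_def using assms by (intro member_le_sum_list) auto
  then have "poly_bounded (env_size Es) (\<lambda>x. size (F x))"
    by (rule poly_bounded_mono[OF poly_bounded_self])
  ultimately show ?thesis unfolding ptime_def using poly_bounded_const by blast
qed

lemma ptime_Node:
  assumes "ptime Es F" "ptime Es G"
  shows "ptime Es (\<lambda>x. Node (F x) (G x))"
proof -
  obtain T where T: "poly_bounded (env_size Es) T" and r: "\<And>k. \<exists>\<pi> a. realizes k \<pi> a Es F T"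
    using assms unfolding ptime_def by blast
  obtain T' where T': "poly_bounded (env_size Es) T'" and r': "\<And>k. \<exists>\<pi> a. realizes k \<pi> a Es G T'"
    using assms unfolding ptime_def by blast
  have "\<exists>\<pi> a. realizes k \<pi> a Es (\<lambda>x. Node (F x) (G x)) (\<lambda>x. Suc (T x + T' x))" for k
  proof -
    obtain \<pi> a where 1: "realizes k \<pi> a Es F T" using r by blast
    obtain \<pi>' a' where 2: "realizes (k + length \<pi>) \<pi>' a' Es G T'" using r' by blast
    have "realizes k (\<pi> @ \<pi>') (NodeE a a') Es (\<lambda>x. Node (F x) (G x)) (\<lambda>x. Suc (T x + T' x))"
      using realizes_append[OF 1, of \<pi>'] realizes_prepend[OF 2] unfolding realizes_def
      by (metis (no_types, lifting) Suc_eq_plus1 Suc_le_mono add_mono eval_NodeE)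
    then show ?thesis by blast
  qed
  moreover have "poly_bounded (env_size Es) (\<lambda>x. size (Node (F x) (G x)))"
    using poly_bounded_Suc[OF poly_bounded_add[OF assms[THEN ptime_size]]] by simp
  ultimately show ?thesis
    unfolding ptime_def using T T' by (blast intro: poly_bounded_intros)
qed

lemma ptime_if_node:
  assumes "ptime Es C" "ptime Es F" "ptime Es G"
  shows "ptime Es (\<lambda>x. if C x = Leaf then G x else F x)"
proof -
  obtain T where T: "poly_bounded (env_size Es) T" and r: "\<And>k. \<exists>\<pi> a. realizes k \<pi> a Es F T"
    using assms unfolding ptime_def by blast
  obtain T' where T': "poly_bounded (env_size Es) T'" and r': "\<And>k. \<exists>\<pi> a. realizes k \<pi> a Es G T'"
    using assms unfolding ptime_def by blast
  obtain T'' where T'': "poly_bounded (env_size Es) T''" and r'': "\<And>k. \<exists>\<pi> a. realizes k \<pi> a Es C T''"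
    using assms unfolding ptime_def by blast
  have "\<exists>\<pi> a. realizes k \<pi> a Es (\<lambda>x. if C x = Leaf then G x else F x)
          (\<lambda>x. Suc (T'' x + (T x + T' x)))" for k
  proof -
    obtain \<pi> a where 1: "realizes k \<pi> a Es F T" using r by blast
    obtain \<pi>' a' where 2: "realizes (k + length \<pi>) \<pi>' a' Es G T'" using r' by blast
    obtain \<pi>'' a'' where 3: "realizes (k + length (\<pi> @ \<pi>')) \<pi>'' a'' Es C T''" using r'' by blast
    let ?\<pi> = "(\<pi> @ \<pi>') @ \<pi>''"
    have 1: "realizes k ?\<pi> a Es F T" by (intro realizes_append 1)
    have 2: "realizes k ?\<pi> a' Es G T'" by (intro realizes_append realizes_prepend 2)
    have 3: "realizes k ?\<pi> a'' Es C T''" by (intro realizes_append realizes_prepend 3)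
    have "realizes k ?\<pi> (IfNode a'' a a') Es (\<lambda>x. if C x = Leaf then G x else F x)
          (\<lambda>x. Suc (T'' x + (T x + T' x)))"
      unfolding realizes_def
    proof (intro allI impI)
      fix \<pi>0 \<pi>1 :: program and x assume k: "length \<pi>0 = k"
      let ?\<Psi> = "\<pi>0 @ ?\<pi> @ \<pi>1" and ?\<rho> = "map (\<lambda>F. F x) Es"
      obtain t where t: "t \<le> T x" "evaluates ?\<Psi> ?\<rho> a (F x) t"
        using 1 k unfolding realizes_def by blast
      obtain t' where t': "t' \<le> T' x" "evaluates ?\<Psi> ?\<rho> a' (G x) t'"
        using 2 k unfolding realizes_def by blast
      obtain t'' where t'': "t'' \<le> T'' x" "evaluates ?\<Psi> ?\<rho> a'' (C x) t''"
        using 3 k unfolding realizes_def by blast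
      show "\<exists>t\<le>Suc (T'' x + (T x + T' x)).
          evaluates ?\<Psi> ?\<rho> (IfNode a'' a a') (if C x = Leaf then G x else F x) t"
      proof (cases "C x")
        case Leaf
        then show ?thesis using t' t'' eval_If_Leaf[of ?\<Psi> ?\<rho> a'' t'' a' "G x" t' a]
          by (intro exI[of _ "t'' + t' + 1"]) auto
      next
        case (Node u v)
        then show ?thesis using t t'' eval_If_Node[of ?\<Psi> ?\<rho> a'' u v t'' a "F x" t a']
          by (intro exI[of _ "t'' + t + 1"]) auto
      qed
    qed
    then show ?thesis by blast
  qed
  moreover have "poly_bounded (env_size Es) (\<lambda>x. size (if C x = Leaf then G x else F x))"
    by (rule poly_bounded_mono[OF poly_bounded_add[OF assms(2,3)[THEN ptime_size]]]) simp
  ultimately show ?thesis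
    unfolding ptime_def using T T' T'' by (blast intro: poly_bounded_intros)
qed

text \<open>Makes inputs of a function available under local variables: if \<open>z\<close> extends \<open>x\<close> by these variables,
  \<open>g\<close> recovers \<open>x\<close> from \<open>z\<close>.\<close>

abbreviation pull :: "('z \<Rightarrow> 'x) \<Rightarrow> ('x \<Rightarrow> tree) list \<Rightarrow> ('z \<Rightarrow> tree) list" where
  "pull g Es \<equiv> map (\<lambda>F z. F (g z)) Es"

lemma env_size_pull: "env_size (pull g Es) z = env_size Es (g z)"
  by (simp add: env_size_def comp_def)

lemma env_pull: "map (\<lambda>F. F z) (pull g Es) = map (\<lambda>F. F (g z)) Es"
  by simp

lemma ptime_pull:
  assumes "ptime Es F"
  shows "ptime (pull g Es) (\<lambda>z. F (g z))"
proof -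
  obtain T where T: "poly_bounded (env_size Es) T" and r: "\<And>k. \<exists>\<pi> a. realizes k \<pi> a Es F T"
    using assms unfolding ptime_def by blast
  have "\<exists>\<pi> a. realizes k \<pi> a (pull g Es) (\<lambda>z. F (g z)) (\<lambda>z. T (g z))" for k
    using r[of k] unfolding realizes_def env_pull by blast
  moreover have "env_size (pull g Es) = (\<lambda>z. env_size Es (g z))"
    by (rule ext) (simp only: env_size_pull)
  ultimately show ?thesis
    unfolding ptime_def using poly_bounded_reindex[OF T, of g] poly_bounded_reindex[OF ptime_size[OF assms], of g]
    by auto
qed

lemma evaluates_list_Vars:
  "(\<And>i. i \<in> set is \<Longrightarrow> i < length \<rho>) \<Longrightarrow>
   evaluates_list \<pi> \<rho> (map Var is) (map ((!) \<rho>) is) (length is)"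
proof (induction "is")
  case (Cons i "is")
  then show ?case using evals_Cons[OF eval_Var[of i \<rho> \<pi>]] by simp
qed (simp add: evals_Nil)

lemma evaluates_list_tail_Vars:
  "evaluates_list \<pi> (v # \<rho>) (map Var [1..<Suc (length \<rho>)]) \<rho> (length \<rho>)"
proof -
  have "map ((!) (v # \<rho>)) [1..<Suc (length \<rho>)] = \<rho>"
    by (rule nth_equalityI) (auto simp del: upt_Suc)
  then show ?thesis
    using evaluates_list_Vars[of "[1..<Suc (length \<rho>)]" "v # \<rho>" \<pi>] by (simp del: upt_Suc)
qed

lemma evaluates_list_all_Vars:
  "evaluates_list \<pi> \<rho> (map Var [0..<length \<rho>]) \<rho> (length \<rho>)"
  using evaluates_list_Vars[of "[0..<length \<rho>]" \<rho> \<pi>] by (simp add: map_nth)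

text \<open>The expression becomes the body of a function that is called with the inputs it needs.\<close>

lemma ptime_env_mono:
  assumes "ptime Es F" and sub: "set Es \<subseteq> set Es'"
  shows "ptime Es' F"
proof -
  obtain T where T: "poly_bounded (env_size Es) T" and r: "\<And>k. \<exists>\<pi> a. realizes k \<pi> a Es F T"
    using assms unfolding ptime_def by blast
  let ?n = "length Es"
  have "\<forall>G\<in>set Es. \<exists>i<length Es'. Es' ! i = G" using sub by (metis in_set_conv_nth subsetD)
  then obtain pos where pos: "\<And>G. G \<in> set Es \<Longrightarrow> pos G < length Es' \<and> Es' ! pos G = G" by metis
  have "\<exists>\<pi> a. realizes k \<pi> a Es' F (\<lambda>x. Suc (?n + T x))" for k
  proof -
    obtain \<pi> a where 1: "realizes k \<pi> a Es F T" using r by blast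
    let ?e = "Call (k + length \<pi>) (map Var (map pos Es))"
    have "realizes k (\<pi> @ [a]) ?e Es' F (\<lambda>x. Suc (?n + T x))"
      unfolding realizes_def
    proof (intro allI impI)
      fix \<pi>0 \<pi>1 :: program and x assume k: "length \<pi>0 = k"
      let ?\<Psi> = "\<pi>0 @ (\<pi> @ [a]) @ \<pi>1" and ?\<rho> = "map (\<lambda>F. F x) Es" and ?\<rho>' = "map (\<lambda>F. F x) Es'"
      obtain t where t: "t \<le> T x" "evaluates ?\<Psi> ?\<rho> a (F x) t"
        using realizes_append[OF 1] k unfolding realizes_def by blast
      have "?\<Psi> ! (k + length \<pi>) = a" using k by (simp add: nth_append)
      moreover have vals: "map ((!) ?\<rho>') (map pos Es) = ?\<rho>" using pos by auto
      have "evaluates_list ?\<Psi> ?\<rho>' (map Var (map pos Es)) (map ((!) ?\<rho>') (map pos Es)) (length (map pos Es))"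
        using pos by (intro evaluates_list_Vars) auto
      then have "evaluates_list ?\<Psi> ?\<rho>' (map Var (map pos Es)) ?\<rho> ?n"
        unfolding vals by (simp only: length_map)
      ultimately have "evaluates ?\<Psi> ?\<rho>' ?e (F x) (?n + t + 1)"
        using t k by (intro eval_Call[where vs = ?\<rho>]) auto
      then show "\<exists>t\<le>Suc (?n + T x). evaluates ?\<Psi> ?\<rho>' ?e (F x) t"
        using t by (intro exI[of _ "?n + t + 1"]) auto
    qed
    then show ?thesis by blast
  qed
  moreover have "env_size Es x \<le> ?n * env_size Es' x" for x
  proof -
    have "size (G x) \<le> env_size Es' x" if "G \<in> set Es" for G
      unfolding env_size_def using that sub by (intro member_le_sum_list) auto
    then have "env_size Es x \<le> (\<Sum>G\<leftarrow>Es. env_size Es' x)" unfolding env_size_def by (intro sum_list_mono)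
    then show ?thesis by (simp add: sum_list_triv)
  qed
  then have "poly_bounded (env_size Es') (env_size Es)"
    by (rule poly_bounded_mono[OF poly_bounded_mult[OF poly_bounded_const poly_bounded_self]])
  ultimately show ?thesis
    unfolding ptime_def using poly_bounded_trans[OF T] poly_bounded_trans[OF ptime_size[OF assms(1)]]
    by (blast intro: poly_bounded_intros)
qed

lemma poly_bounded_power: "poly_bounded s T \<Longrightarrow> poly_bounded s (\<lambda>x. T x ^ c)"
  by (induction c) (auto intro: poly_bounded_intros)

lemma enc_list_Nil: "enc_list e [] = Leaf"
  by (simp add: enc_list_def)

lemma enc_list_Cons: "enc_list e (x # xs) = Node (e x) (enc_list e xs)"
  by (simp add: enc_list_def)

lemmas enc_list_simps = enc_list_Nil enc_list_Cons

lemma size_enc_list: "size (enc_list e xs) = length xs + (\<Sum>x\<leftarrow>xs. size (e x))"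
  by (induction xs) (auto simp: enc_list_simps)

lemma size_enc_list_drop: "size (enc_list e (drop n xs)) \<le> size (enc_list e xs)"
proof (induction n arbitrary: xs)
  case (Suc n)
  then show ?case by (cases xs) (auto simp: enc_list_simps intro: le_SucI trans_le_add2)
qed simp

text \<open>Structural recursion whose intermediate results have polynomial size, as in Cobham's
  characterisation of the polynomial-time functions. The recursion passes through the suffixes of the
  list; only there is the bound \<open>B\<close> needed.\<close>

lemma ptime_rec_list:
  fixes e :: "'v \<Rightarrow> tree" and a :: "'r \<Rightarrow> tree" and Es :: "('x \<Rightarrow> tree) list"
  assumes xs: "ptime Es (\<lambda>x. enc_list e (xs x))"
    and init: "ptime Es (\<lambda>x. a (init x))"
    and step: "ptime ((\<lambda>z. e (fst z)) # (\<lambda>z. enc_list e (fst (snd z))) # (\<lambda>z. a (fst (snd (snd z))))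
                 # pull (\<lambda>z. snd (snd (snd z))) Es)
                (\<lambda>z. a (f (snd (snd (snd z))) (fst z) (fst (snd z)) (fst (snd (snd z)))))"
    and B: "poly_bounded (env_size Es) B"
    and size: "\<And>x n. size (a (rec_list (init x) (f x) (drop n (xs x)))) \<le> B x"
  shows "ptime Es (\<lambda>x. a (rec_list (init x) (f x) (xs x)))"
proof -
  let ?Es = "(\<lambda>z. e (fst z)) # (\<lambda>z. enc_list e (fst (snd z))) # (\<lambda>z. a (fst (snd (snd z))))
                 # pull (\<lambda>z. snd (snd (snd z))) Es"
  let ?F = "\<lambda>z. a (f (snd (snd (snd z))) (fst z) (fst (snd z)) (fst (snd (snd z))))"
  let ?R = "\<lambda>x ys. rec_list (init x) (f x) ys"
  let ?m = "length Es"
  let ?vars = "map Var [1..<Suc ?m]"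
  obtain T1 where T1: "poly_bounded (env_size Es) T1"
    and r1: "\<And>k. \<exists>\<pi> b. realizes k \<pi> b Es (\<lambda>x. enc_list e (xs x)) T1"
    using xs unfolding ptime_def by blast
  obtain T2 where T2: "poly_bounded (env_size Es) T2"
    and r2: "\<And>k. \<exists>\<pi> b. realizes k \<pi> b Es (\<lambda>x. a (init x)) T2"
    using init unfolding ptime_def by blast
  obtain T3 where T3: "poly_bounded (env_size ?Es) T3"
    and r3: "\<And>k. \<exists>\<pi> b. realizes k \<pi> b ?Es ?F T3"
    using step unfolding ptime_def by blast
  obtain c where c: "\<And>z. T3 z \<le> (env_size ?Es z + 2) ^ c"
    using T3 unfolding poly_bounded_def by blast
  let ?X = "\<lambda>x. size (enc_list e (xs x))"
  define C where "C x = (?X x + B x + env_size Es x + 2) ^ c + (T2 x + (2 * ?m + 10))" for x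
  define T where "T x = T1 x + (?m + (Suc (?X x) * C x + 1))" for x
  have X: "poly_bounded (env_size Es) ?X" by (rule ptime_size[OF xs])
  have C: "poly_bounded (env_size Es) C"
    unfolding C_def by (intro poly_bounded_intros poly_bounded_power X B T2 poly_bounded_self)
  have T: "poly_bounded (env_size Es) T"
    unfolding T_def by (intro poly_bounded_intros X T1 C)
  have "\<exists>\<pi> b. realizes k \<pi> b Es (\<lambda>x. a (?R x (xs x))) T" for k
  proof -
    obtain \<pi>3 b3 where 3: "realizes k \<pi>3 b3 ?Es ?F T3" using r3 by blast
    define fS where "fS = k + length \<pi>3"
    obtain \<pi>2 b2 where 2: "realizes (k + length (\<pi>3 @ [b3])) \<pi>2 b2 Es (\<lambda>x. a (init x)) T2"
      using r2 by blast
    define fH where "fH = k + length (\<pi>3 @ [b3] @ \<pi>2)"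
    define fR where "fR = Suc fH"
    define body where "body = IfNode (Var 0)
      (Call fS (LeftE (Var 0) # RightE (Var 0) # Call fR (RightE (Var 0) # ?vars) # ?vars))
      (Call fH ?vars)"
    let ?\<pi> = "(\<pi>3 @ [b3]) @ (\<pi>2 @ [b2, body])"
    obtain \<pi>1 b1 where 1: "realizes (k + length ?\<pi>) \<pi>1 b1 Es (\<lambda>x. enc_list e (xs x)) T1"
      using r1 by blast
    let ?\<pi>' = "?\<pi> @ \<pi>1"
    have 1: "realizes k ?\<pi>' b1 Es (\<lambda>x. enc_list e (xs x)) T1" by (rule realizes_prepend[OF 1])
    have 2: "realizes k ?\<pi>' b2 Es (\<lambda>x. a (init x)) T2"
      by (rule realizes_append[OF realizes_prepend[OF realizes_append[OF 2]]])
    have 3: "realizes k ?\<pi>' b3 ?Es ?F T3" by (intro realizes_append 3)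
    have "realizes k ?\<pi>' (Call fR (b1 # map Var [0..<?m])) Es (\<lambda>x. a (?R x (xs x))) T"
      unfolding realizes_def
    proof (intro allI impI)
      fix \<pi>0 \<pi>4 :: program and x assume k: "length \<pi>0 = k"
      define \<Psi> where "\<Psi> = \<pi>0 @ ?\<pi>' @ \<pi>4"
      define \<rho> where "\<rho> = map (\<lambda>F. F x) Es"
      have m: "length \<rho> = ?m" by (simp add: \<rho>_def)
      have idx: "fS < length \<Psi>" "fH < length \<Psi>" "fR < length \<Psi>"
        "\<Psi> ! fS = b3" "\<Psi> ! fH = b2" "\<Psi> ! fR = body"
        using k by (auto simp: \<Psi>_def fS_def fH_def fR_def nth_append)
      have vars: "evaluates_list \<Psi> (v # \<rho>) ?vars \<rho> ?m" for v
        using evaluates_list_tail_Vars[of \<Psi> v \<rho>] m by simp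
      have loop: "\<exists>t\<le>Suc (length ys) * C x. evaluates \<Psi> (enc_list e ys # \<rho>) body (a (?R x ys)) t"
        if "\<exists>n. ys = drop n (xs x)" for ys
        using that
      proof (induction ys)
        case Nil
        obtain t where t: "t \<le> T2 x" "evaluates \<Psi> \<rho> b2 (a (init x)) t"
          using 2 k unfolding realizes_def \<Psi>_def \<rho>_def by blast
        have "evaluates \<Psi> (Leaf # \<rho>) (Call fH ?vars) (a (init x)) (?m + t + 1)"
          using eval_Call[OF vars idx(2)] t idx by simp
        then have "evaluates \<Psi> (Leaf # \<rho>) body (a (init x)) (1 + (?m + t + 1) + 1)"
          unfolding body_def using eval_Var[of 0 "Leaf # \<rho>" \<Psi>] by (intro eval_If_Leaf) auto
        moreover have "1 + (?m + t + 1) + 1 \<le> Suc 0 * C x"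
          using t(1) by (simp add: C_def)
        ultimately show ?case by (auto simp: enc_list_simps)
      next
        case (Cons v vs)
        then obtain n where n: "v # vs = drop n (xs x)" by blast
        then have vs: "vs = drop (Suc n) (xs x)" by (metis drop_Suc list.sel(3) tl_drop)
        let ?N = "enc_list e (v # vs)"
        let ?z = "(v, vs, ?R x vs, x)"
        obtain t where t: "t \<le> Suc (length vs) * C x"
          "evaluates \<Psi> (enc_list e vs # \<rho>) body (a (?R x vs)) t"
          using Cons.IH vs by blast
        obtain s where s: "s \<le> T3 ?z" "evaluates \<Psi> (map (\<lambda>F. F ?z) ?Es) b3 (?F ?z) s"
          using 3 k unfolding realizes_def \<Psi>_def by blast
        have V: "evaluates \<Psi> (?N # \<rho>) (Var 0) ?N 1"
          using eval_Var[of 0 "?N # \<rho>" \<Psi>] by simp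
        have L: "evaluates \<Psi> (?N # \<rho>) (LeftE (Var 0)) (e v) 2"
          using eval_Left[OF V] by (simp add: enc_list_simps numeral_2_eq_2)
        have R: "evaluates \<Psi> (?N # \<rho>) (RightE (Var 0)) (enc_list e vs) 2"
          using eval_Right[OF V] by (simp add: enc_list_simps numeral_2_eq_2)
        have "evaluates \<Psi> (?N # \<rho>) (Call fR (RightE (Var 0) # ?vars)) (a (?R x vs)) ((2 + ?m) + t + 1)"
          using eval_Call[OF evals_Cons[OF R vars] idx(3)] t idx by simp
        then have "evaluates_list \<Psi> (?N # \<rho>)
            (LeftE (Var 0) # RightE (Var 0) # Call fR (RightE (Var 0) # ?vars) # ?vars)
            (e v # enc_list e vs # a (?R x vs) # \<rho>) (2 + (2 + (((2 + ?m) + t + 1) + ?m)))"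
          by (intro evals_Cons L R vars)
        moreover have "map (\<lambda>F. F ?z) ?Es = e v # enc_list e vs # a (?R x vs) # \<rho>"
          by (simp add: \<rho>_def)
        ultimately have "evaluates \<Psi> (?N # \<rho>)
            (Call fS (LeftE (Var 0) # RightE (Var 0) # Call fR (RightE (Var 0) # ?vars) # ?vars))
            (a (?R x (v # vs))) ((2 + (2 + (((2 + ?m) + t + 1) + ?m))) + s + 1)"
          using s(2) idx by (intro eval_Call) auto
        then have "evaluates \<Psi> (?N # \<rho>) body (a (?R x (v # vs)))
            (1 + ((2 + (2 + (((2 + ?m) + t + 1) + ?m))) + s + 1) + 1)"
          unfolding body_def using V
          by (intro eval_If_Node[where x = "e v" and y = "enc_list e vs"]) (auto simp: enc_list_simps)
        moreover have "s + (2 * ?m + 10) \<le> C x"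
        proof -
          have "size ?N \<le> ?X x" unfolding n by (rule size_enc_list_drop)
          moreover have "size (a (?R x vs)) \<le> B x" unfolding vs by (rule size)
          ultimately have "env_size ?Es ?z \<le> ?X x + B x + env_size Es x"
            by (simp add: env_size_def comp_def enc_list_simps)
          then have "(env_size ?Es ?z + 2) ^ c \<le> (?X x + B x + env_size Es x + 2) ^ c"
            by (intro power_mono) auto
          then have "s \<le> (?X x + B x + env_size Es x + 2) ^ c"
            using s(1) c[of ?z] by (meson le_trans)
          then show ?thesis by (simp add: C_def)
        qed
        then have "1 + ((2 + (2 + (((2 + ?m) + t + 1) + ?m))) + s + 1) + 1 \<le> Suc (length (v # vs)) * C x"
          using t(1) by simp
        ultimately show ?case by blast
      qed
      obtain t where t: "t \<le> Suc (length (xs x)) * C x"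
        "evaluates \<Psi> (enc_list e (xs x) # \<rho>) body (a (?R x (xs x))) t"
        using loop[of "xs x"] drop0 by metis
      obtain s where s: "s \<le> T1 x" "evaluates \<Psi> \<rho> b1 (enc_list e (xs x)) s"
        using 1 k unfolding realizes_def \<Psi>_def \<rho>_def by blast
      have "evaluates_list \<Psi> \<rho> (b1 # map Var [0..<?m]) (enc_list e (xs x) # \<rho>) (s + ?m)"
        using evals_Cons[OF s(2)] evaluates_list_all_Vars[of \<Psi> \<rho>] m by simp
      then have "evaluates \<Psi> \<rho> (Call fR (b1 # map Var [0..<?m])) (a (?R x (xs x))) (s + ?m + t + 1)"
        using t(2) idx by (intro eval_Call) auto
      moreover have "s + ?m + t + 1 \<le> T x"
      proof -
        have "length (xs x) \<le> ?X x" by (simp add: size_enc_list)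
        then have "Suc (length (xs x)) * C x \<le> Suc (?X x) * C x" by (intro mult_right_mono) auto
        then show ?thesis using s(1) t(1) unfolding T_def by linarith
      qed
      ultimately show "\<exists>t\<le>T x. evaluates (\<pi>0 @ ?\<pi>' @ \<pi>4) (map (\<lambda>F. F x) Es)
          (Call fR (b1 # map Var [0..<?m])) (a (?R x (xs x))) t"
        unfolding \<Psi>_def \<rho>_def by blast
    qed
    then show ?thesis by blast
  qed
  moreover have "poly_bounded (env_size Es) (\<lambda>x. size (a (?R x (xs x))))"
    using size[where n = 0] by (intro poly_bounded_mono[OF B]) simp
  ultimately show ?thesis unfolding ptime_def using T by blast
qed

text \<open>The expression for \<open>F\<close> becomes function 0; it calls functions placed at offset 1.\<close>

lemma ptime_program:
  assumes "ptime [e] F"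
  obtains \<pi> c where "\<And>x. \<exists>t. runs \<pi> (e x) (F x) t \<and> t \<le> (size (e x) + 2) ^ c"
proof -
  obtain T where T: "poly_bounded (env_size [e]) T" and r: "\<And>k. \<exists>\<pi> a. realizes k \<pi> a [e] F T"
    using assms unfolding ptime_def by blast
  obtain \<pi> a where 1: "realizes 1 \<pi> a [e] F T" using r by blast
  have "poly_bounded (\<lambda>x. size (e x)) (\<lambda>x. T x + 2)"
    using T by (intro poly_bounded_intros) (simp_all add: env_size_def[abs_def])
  then obtain c where c: "\<And>x. T x + 2 \<le> (size (e x) + 2) ^ c"
    unfolding poly_bounded_def by blast
  have "\<exists>t. runs (a # \<pi>) (e x) (F x) t \<and> t \<le> (size (e x) + 2) ^ c" for x
  proof -
    obtain t where t: "t \<le> T x" "evaluates (a # \<pi>) [e x] a (F x) t"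
      using 1[unfolded realizes_def, rule_format, of "[a]" x "[]"] by auto
    have "evaluates_list (a # \<pi>) [e x] [Var 0] [e x] (1 + 0)"
      using eval_Var[of 0 "[e x]"] by (intro evals_Cons evals_Nil) auto
    then have "runs (a # \<pi>) (e x) (F x) (1 + 0 + t + 1)"
      unfolding runs_def using t(2) by (intro eval_Call) auto
    moreover have "1 + 0 + t + 1 \<le> (size (e x) + 2) ^ c" using t(1) c[of x] by linarith
    ultimately show ?thesis by blast
  qed
  then show ?thesis by (rule that)
qed

section \<open>Closure properties for encoded data\<close>

lemma ptime_lift1: "ptime Es F \<Longrightarrow> ptime (A # pull g Es) (\<lambda>z. F (g z))"
  by (rule ptime_env_mono[OF ptime_pull]) auto

lemma ptime_lift2: "ptime Es F \<Longrightarrow> ptime (A # B # pull g Es) (\<lambda>z. F (g z))"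
  by (rule ptime_env_mono[OF ptime_pull]) auto

lemma ptime_lift3: "ptime Es F \<Longrightarrow> ptime (A # B # C # pull g Es) (\<lambda>z. F (g z))"
  by (rule ptime_env_mono[OF ptime_pull]) auto

lemma ptime_Nil: "ptime Es (\<lambda>x. enc_list e [])"
  unfolding enc_list_Nil by (rule ptime_Leaf)

lemma ptime_Cons:
  "ptime Es (\<lambda>x. e (h x)) \<Longrightarrow> ptime Es (\<lambda>x. enc_list e (t x)) \<Longrightarrow> ptime Es (\<lambda>x. enc_list e (h x # t x))"
  unfolding enc_list_Cons by (rule ptime_Node)

lemma ptime_tl: "ptime Es (\<lambda>x. enc_list e (xs x)) \<Longrightarrow> ptime Es (\<lambda>x. enc_list e (tl (xs x)))"
proof -
  have "enc_list e (tl xs) = right (enc_list e xs)" for xs by (cases xs) (auto simp: enc_list_simps)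
  then show "ptime Es (\<lambda>x. enc_list e (xs x)) \<Longrightarrow> ptime Es (\<lambda>x. enc_list e (tl (xs x)))"
    by (simp add: ptime_right)
qed

lemma ptime_case_hd:
  assumes "ptime Es (\<lambda>x. enc_list e (xs x))" "e d = Leaf"
  shows "ptime Es (\<lambda>x. e (case xs x of [] \<Rightarrow> d | v # _ \<Rightarrow> v))"
proof -
  have "e (case xs of [] \<Rightarrow> d | v # _ \<Rightarrow> v) = left (enc_list e xs)" for xs
    using assms(2) by (cases xs) (auto simp: enc_list_simps)
  then show ?thesis using assms(1) by (simp add: ptime_left)
qed

lemma ptime_Pair:
  "ptime Es (\<lambda>x. e1 (a x)) \<Longrightarrow> ptime Es (\<lambda>x. e2 (b x)) \<Longrightarrow> ptime Es (\<lambda>x. enc_prod e1 e2 (a x, b x))"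
  unfolding enc_prod_def fst_conv snd_conv by (rule ptime_Node)

lemma ptime_fst: "ptime Es (\<lambda>x. enc_prod e1 e2 (p x)) \<Longrightarrow> ptime Es (\<lambda>x. e1 (fst (p x)))"
  using ptime_left[of Es "\<lambda>x. enc_prod e1 e2 (p x)"] by (simp add: enc_prod_def)

lemma ptime_snd: "ptime Es (\<lambda>x. enc_prod e1 e2 (p x)) \<Longrightarrow> ptime Es (\<lambda>x. e2 (snd (p x)))"
  using ptime_right[of Es "\<lambda>x. enc_prod e1 e2 (p x)"] by (simp add: enc_prod_def)

lemma enc_bool_eq_Leaf: "enc_bool P = Leaf \<longleftrightarrow> \<not> P"
  by (simp add: enc_bool_def)

lemma ptime_if:
  assumes "ptime Es (\<lambda>x. enc_bool (P x))" "ptime Es (\<lambda>x. e (a x))" "ptime Es (\<lambda>x. e (b x))"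
  shows "ptime Es (\<lambda>x. e (if P x then a x else b x))"
proof -
  have "e (if P x then a x else b x) = (if enc_bool (P x) = Leaf then e (b x) else e (a x))" for x
    by (simp add: enc_bool_eq_Leaf)
  then show ?thesis using ptime_if_node[OF assms] by simp
qed

lemma ptime_bool_const: "ptime Es (\<lambda>x. enc_bool b)"
proof -
  have "ptime Es (\<lambda>x. if b then Node Leaf Leaf else Leaf)"
    by (cases b) (auto intro: ptime_Node ptime_Leaf)
  then show ?thesis by (simp add: enc_bool_def)
qed

lemma ptime_and:
  assumes "ptime Es (\<lambda>x. enc_bool (P x))" "ptime Es (\<lambda>x. enc_bool (Q x))"
  shows "ptime Es (\<lambda>x. enc_bool (P x \<and> Q x))"
proof -
  have "(P x \<and> Q x) = (if P x then Q x else False)" for x by simp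
  then show ?thesis using ptime_if[of Es P enc_bool Q "\<lambda>_. False"] assms ptime_bool_const by auto
qed

lemma ptime_or:
  assumes "ptime Es (\<lambda>x. enc_bool (P x))" "ptime Es (\<lambda>x. enc_bool (Q x))"
  shows "ptime Es (\<lambda>x. enc_bool (P x \<or> Q x))"
proof -
  have "(P x \<or> Q x) = (if P x then True else Q x)" for x by simp
  then show ?thesis using ptime_if[of Es P enc_bool "\<lambda>_. True" Q] assms ptime_bool_const by auto
qed

lemma ptime_not:
  assumes "ptime Es (\<lambda>x. enc_bool (P x))"
  shows "ptime Es (\<lambda>x. enc_bool (\<not> P x))"
proof -
  have "(\<not> P x) = (if P x then False else True)" for x by simp
  then show ?thesis using ptime_if[of Es P enc_bool "\<lambda>_. False" "\<lambda>_. True"] assms ptime_bool_const by auto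
qed

lemma ptime_bool_eq:
  assumes "ptime Es (\<lambda>x. enc_bool (P x))" "ptime Es (\<lambda>x. enc_bool (Q x))"
  shows "ptime Es (\<lambda>x. enc_bool (P x = Q x))"
proof -
  have "(P x = Q x) = (if P x then Q x else \<not> Q x)" for x by simp
  then show ?thesis using ptime_if[of Es P enc_bool Q "\<lambda>x. \<not> Q x"] assms ptime_not by auto
qed

lemma ptime_is_Nil:
  assumes "ptime Es (\<lambda>x. enc_list e (xs x))"
  shows "ptime Es (\<lambda>x. enc_bool (xs x = []))"
proof -
  have "enc_bool (xs x = []) = (if enc_list e (xs x) = Leaf then Node Leaf Leaf else Leaf)" for x
    by (cases "xs x") (auto simp: enc_list_simps enc_bool_def)
  then show ?thesis using ptime_if_node[OF assms ptime_Leaf ptime_Node[OF ptime_Leaf ptime_Leaf]] by simp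
qed

lemma ptime_foldr:
  fixes Es :: "('x \<Rightarrow> tree) list"
  assumes xs: "ptime Es (\<lambda>x. enc_list e (xs x))"
    and init: "ptime Es (\<lambda>x. a (init x))"
    and step: "ptime ((\<lambda>z. e (fst z)) # (\<lambda>z. a (fst (snd z))) # pull (\<lambda>z. snd (snd z)) Es)
                (\<lambda>z. a (f (snd (snd z)) (fst z) (fst (snd z))))"
    and B: "poly_bounded (env_size Es) B"
    and size: "\<And>x n. size (a (foldr (f x) (drop n (xs x)) (init x))) \<le> B x"
  shows "ptime Es (\<lambda>x. a (foldr (f x) (xs x) (init x)))"
proof -
  have rec: "foldr g ys i = rec_list i (\<lambda>v _ r. g v r) ys" for g i and ys
    by (induction ys) auto
  let ?g = "\<lambda>z. (fst z, snd (snd z))"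
  have "ptime ((\<lambda>z. e (fst z)) # (\<lambda>z. enc_list e (fst (snd z))) # (\<lambda>z. a (fst (snd (snd z))))
                 # pull (\<lambda>z. snd (snd (snd z))) Es)
            (\<lambda>z. a (f (snd (snd (snd z))) (fst z) (fst (snd (snd z)))))"
  proof (rule ptime_env_mono)
    show "ptime ((\<lambda>z. e (fst z)) # (\<lambda>z. a (fst (snd (snd z)))) # pull (\<lambda>z. snd (snd (snd z))) Es)
            (\<lambda>z. a (f (snd (snd (snd z))) (fst z) (fst (snd (snd z)))))"
      using ptime_pull[OF step, of ?g] by (simp add: comp_def)
  qed auto
  then show ?thesis
    unfolding rec using xs init B size[unfolded rec]
    by (intro ptime_rec_list[where e = e]) auto
qed

lemma enc_nat_0: "enc_nat 0 = Leaf"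
  by (simp add: enc_nat_def enc_list_Nil)

lemma enc_nat_replicate: "enc_nat n = enc_list (\<lambda>_. Leaf) (replicate n ())"
proof -
  have "enc_list (\<lambda>_. Leaf) xs = enc_list (\<lambda>_. Leaf) (replicate (length xs) ())" for xs :: "nat list"
    by (induction xs) (auto simp: enc_list_simps)
  from this[of "[0..<n]"] show ?thesis by (simp add: enc_nat_def)
qed

lemma enc_nat_Suc: "enc_nat (Suc n) = Node Leaf (enc_nat n)"
  by (simp add: enc_nat_replicate enc_list_simps)

lemma size_enc_nat: "size (enc_nat n) = n"
  by (simp add: enc_nat_replicate size_enc_list)

lemma ptime_0: "ptime Es (\<lambda>x. enc_nat 0)"
  unfolding enc_nat_0 by (rule ptime_Leaf)

lemma ptime_Suc: "ptime Es (\<lambda>x. enc_nat (k x)) \<Longrightarrow> ptime Es (\<lambda>x. enc_nat (Suc (k x)))"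
  unfolding enc_nat_Suc by (intro ptime_Node ptime_Leaf)

text \<open>A number is encoded as a list, and the length of the remaining list is the argument of the step.\<close>

lemma ptime_rec_nat:
  fixes Es :: "('x \<Rightarrow> tree) list"
  assumes k: "ptime Es (\<lambda>x. enc_nat (k x))"
    and init: "ptime Es (\<lambda>x. a (init x))"
    and step: "ptime ((\<lambda>z. enc_nat (fst z)) # (\<lambda>z. a (fst (snd z))) # pull (\<lambda>z. snd (snd z)) Es)
                (\<lambda>z. a (f (snd (snd z)) (fst z) (fst (snd z))))"
    and B: "poly_bounded (env_size Es) B"
    and size: "\<And>x j. j \<le> k x \<Longrightarrow> size (a (rec_nat (init x) (f x) j)) \<le> B x"
  shows "ptime Es (\<lambda>x. a (rec_nat (init x) (f x) (k x)))"
proof -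
  have rec: "rec_nat i g n = rec_list i (\<lambda>(_ :: unit) vs r. g (length vs) r) (replicate n ())" for g i n
    by (induction n) auto
  let ?g = "\<lambda>z. (length (fst (snd z) :: unit list), snd (snd z))"
  have len: "enc_nat (length vs) = enc_list (\<lambda>_. Leaf) vs" for vs :: "unit list"
    by (simp add: enc_nat_replicate) (simp add: replicate_length_same)
  have "ptime ((\<lambda>z. Leaf) # (\<lambda>z. enc_list (\<lambda>_ :: unit. Leaf) (fst (snd z))) # (\<lambda>z. a (fst (snd (snd z))))
                 # pull (\<lambda>z. snd (snd (snd z))) Es)
            (\<lambda>z. a (f (snd (snd (snd z))) (length (fst (snd z)) :: nat) (fst (snd (snd z)))))"
  proof (rule ptime_env_mono)
    show "ptime ((\<lambda>z. enc_list (\<lambda>_ :: unit. Leaf) (fst (snd z))) # (\<lambda>z. a (fst (snd (snd z))))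
                 # pull (\<lambda>z. snd (snd (snd z))) Es)
            (\<lambda>z. a (f (snd (snd (snd z))) (length (fst (snd z)) :: nat) (fst (snd (snd z)))))"
      using ptime_pull[OF step, of ?g] by (simp add: comp_def len)
  qed auto
  then show ?thesis
    unfolding rec
  proof (intro ptime_rec_list[where e = "\<lambda>_. Leaf" and B = B])
    fix x n
    show "size (a (rec_list (init x) (\<lambda>_ vs. f x (length vs)) (drop n (replicate (k x) ())))) \<le> B x"
      using size[of "k x - n" x] by (simp add: rec)
  qed (use k init B in \<open>auto simp: enc_nat_replicate\<close>)
qed

lemma enc_bool_False: "enc_bool False = Leaf"
  by (simp add: enc_bool_def)

lemma size_enc_list_append: "size (enc_list e (xs @ ys)) = size (enc_list e xs) + size (enc_list e ys)"
  by (simp add: size_enc_list)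

lemma ptime_length:
  assumes xs: "ptime Es (\<lambda>x. enc_list e (xs x))"
  shows "ptime Es (\<lambda>x. enc_nat (length (xs x)))"
proof -
  have len: "length ys = foldr (\<lambda>_ n. Suc n) ys 0" for ys :: "'c list" by (induction ys) auto
  show ?thesis
    unfolding len
  proof (rule ptime_foldr[OF xs _ _ ptime_size[OF xs]])
    show "size (enc_nat (foldr (\<lambda>_ n. Suc n) (drop n (xs x)) 0)) \<le> size (enc_list e (xs x))" for n x
      unfolding len[symmetric] by (simp add: size_enc_nat size_enc_list)
  qed (rule ptime_0, (intro ptime_Suc ptime_var, simp))
qed

lemma ptime_append:
  assumes xs: "ptime Es (\<lambda>x. enc_list e (xs x))" and ys: "ptime Es (\<lambda>x. enc_list e (ys x))"
  shows "ptime Es (\<lambda>x. enc_list e (xs x @ ys x))"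
proof -
  have app: "us @ vs = foldr (#) us vs" for us vs :: "'c list" by (induction us) auto
  show ?thesis
    unfolding app
  proof (rule ptime_foldr[where a = "enc_list e", OF xs ys _ poly_bounded_add[OF xs[THEN ptime_size] ys[THEN ptime_size]]])
    show "size (enc_list e (foldr (#) (drop n (xs x)) (ys x))) \<le>
        size (enc_list e (xs x)) + size (enc_list e (ys x))" for n x
      unfolding app[symmetric] using size_enc_list_drop[of e n "xs x"] by (simp add: size_enc_list_append)
  qed (intro ptime_Cons ptime_var; simp)
qed

lemma ptime_concat:
  assumes xss: "ptime Es (\<lambda>x. enc_list (enc_list e) (xss x))"
  shows "ptime Es (\<lambda>x. enc_list e (concat (xss x)))"
proof -
  have con: "concat uss = foldr (@) uss []" for uss :: "'c list list" by (induction uss) auto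
  have size: "size (enc_list e (concat uss)) \<le> size (enc_list (enc_list e) uss)" for uss
    by (induction uss) (auto simp: enc_list_simps size_enc_list_append)
  show ?thesis
    unfolding con
  proof (rule ptime_foldr[OF xss _ _ ptime_size[OF xss]])
    show "size (enc_list e (foldr (@) (drop n (xss x)) [])) \<le> size (enc_list (enc_list e) (xss x))" for n x
      unfolding con[symmetric] using size size_enc_list_drop by (rule order.trans)
  qed (rule ptime_Nil, (intro ptime_append ptime_var; simp))
qed

lemma ptime_rev:
  assumes xs: "ptime Es (\<lambda>x. enc_list e (xs x))"
  shows "ptime Es (\<lambda>x. enc_list e (rev (xs x)))"
proof -
  have rev: "rev us = foldr (\<lambda>v r. r @ [v]) us []" for us :: "'c list" by (induction us) auto
  have size: "size (enc_list e (rev us)) = size (enc_list e us)" for us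
    by (simp add: size_enc_list rev_map[symmetric])
  show ?thesis
    unfolding rev
  proof (rule ptime_foldr[OF xs _ _ ptime_size[OF xs]])
    show "size (enc_list e (foldr (\<lambda>v r. r @ [v]) (drop n (xs x)) [])) \<le> size (enc_list e (xs x))" for n x
      unfolding rev[symmetric] size by (rule size_enc_list_drop)
  qed (rule ptime_Nil, (intro ptime_append ptime_Cons ptime_Nil ptime_var; simp))
qed

lemma ptime_list_all:
  assumes xs: "ptime Es (\<lambda>x. enc_list e (xs x))"
    and P: "ptime ((\<lambda>z. e (fst z)) # pull snd Es) (\<lambda>z. enc_bool (P (snd z) (fst z)))"
  shows "ptime Es (\<lambda>x. enc_bool (list_all (P x) (xs x)))"
proof -
  have all: "list_all Q ys \<longleftrightarrow> foldr (\<lambda>v r. Q v \<and> r) ys True" for Q and ys :: "'c list"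
    by (induction ys) auto
  have P': "ptime ((\<lambda>z. e (fst z)) # (\<lambda>z. enc_bool (fst (snd z))) # pull (\<lambda>z. snd (snd z)) Es)
      (\<lambda>z. enc_bool (P (snd (snd z)) (fst z)))"
  proof (rule ptime_env_mono)
    show "ptime ((\<lambda>z. e (fst z)) # pull (\<lambda>z. snd (snd z)) Es) (\<lambda>z. enc_bool (P (snd (snd z)) (fst z)))"
      using ptime_pull[OF P, of "\<lambda>z. (fst z, snd (snd z))"] by (simp add: comp_def)
  qed auto
  show ?thesis
    unfolding all
  proof (rule ptime_foldr[OF xs _ _ poly_bounded_const[of _ 1]])
    show "size (enc_bool b) \<le> 1" for b by (simp add: enc_bool_def)
  qed (rule ptime_bool_const, rule ptime_and[OF P'], rule ptime_var, simp)
qed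

lemma ptime_list_ex:
  assumes xs: "ptime Es (\<lambda>x. enc_list e (xs x))"
    and P: "ptime ((\<lambda>z. e (fst z)) # pull snd Es) (\<lambda>z. enc_bool (P (snd z) (fst z)))"
  shows "ptime Es (\<lambda>x. enc_bool (list_ex (P x) (xs x)))"
proof -
  have ex: "list_ex Q ys \<longleftrightarrow> \<not> list_all (\<lambda>v. \<not> Q v) ys" for Q and ys :: "'c list"
    by (auto simp: list_ex_iff list_all_iff)
  show ?thesis unfolding ex by (rule ptime_not[OF ptime_list_all[OF xs ptime_not[OF P]]])
qed

lemma ptime_diff:
  assumes "ptime Es (\<lambda>x. enc_nat (a x))" "ptime Es (\<lambda>x. enc_nat (b x))"
  shows "ptime Es (\<lambda>x. enc_nat (a x - b x))"
proof -
  have diff: "i - j = rec_nat i (\<lambda>_ r. case r of 0 \<Rightarrow> 0 | Suc m \<Rightarrow> m) j" for i j :: nat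
    by (induction j) (auto split: nat.split)
  have pred: "enc_nat (case i of 0 \<Rightarrow> 0 | Suc m \<Rightarrow> m) = right (enc_nat i)" for i
    by (cases i) (auto simp: enc_nat_0 enc_nat_Suc)
  show ?thesis
    unfolding diff
  proof (rule ptime_rec_nat[where a = enc_nat, OF assms(2,1) _ ptime_size[OF assms(1)]])
    show "size (enc_nat (rec_nat (a x) (\<lambda>_ r. case r of 0 \<Rightarrow> 0 | Suc m \<Rightarrow> m) j)) \<le> size (enc_nat (a x))" for x j
      unfolding diff[symmetric] by (simp add: size_enc_nat)
  qed (unfold pred, intro ptime_right ptime_var, simp)
qed

lemma ptime_le:
  assumes "ptime Es (\<lambda>x. enc_nat (a x))" "ptime Es (\<lambda>x. enc_nat (b x))"
  shows "ptime Es (\<lambda>x. enc_bool (a x \<le> b x))"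
proof -
  have "enc_bool (i \<le> j) = (if enc_nat (i - j) = Leaf then Node Leaf Leaf else Leaf)" for i j :: nat
    by (cases "i - j") (auto simp: enc_nat_0 enc_nat_Suc enc_bool_def)
  then show ?thesis
    using ptime_if_node[OF ptime_diff[OF assms] ptime_Leaf ptime_Node[OF ptime_Leaf ptime_Leaf]] by simp
qed

lemma ptime_less:
  assumes "ptime Es (\<lambda>x. enc_nat (a x))" "ptime Es (\<lambda>x. enc_nat (b x))"
  shows "ptime Es (\<lambda>x. enc_bool (a x < b x))"
  unfolding less_eq_Suc_le by (intro ptime_le ptime_Suc assms)

lemma ptime_nat_eq:
  assumes "ptime Es (\<lambda>x. enc_nat (a x))" "ptime Es (\<lambda>x. enc_nat (b x))"
  shows "ptime Es (\<lambda>x. enc_bool (a x = b x))"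
  unfolding order_eq_iff by (intro ptime_and ptime_le assms)

lemma ptime_member:
  assumes "ptime Es (\<lambda>x. enc_nat (a x))" "ptime Es (\<lambda>x. enc_list enc_nat (xs x))"
  shows "ptime Es (\<lambda>x. enc_bool (a x \<in> set (xs x)))"
proof -
  have mem: "y \<in> set ys \<longleftrightarrow> list_ex (\<lambda>v. y = v) ys" for y :: nat and ys by (auto simp: list_ex_iff)
  show ?thesis
    unfolding mem
    by (rule ptime_list_ex[OF assms(2)]) (intro ptime_nat_eq ptime_lift1[OF assms(1)] ptime_var, simp)
qed

lemma ptime_add:
  assumes "ptime Es (\<lambda>x. enc_nat (a x))" "ptime Es (\<lambda>x. enc_nat (b x))"
  shows "ptime Es (\<lambda>x. enc_nat (a x + b x))"
proof -
  have add: "i + j = rec_nat j (\<lambda>_ r. Suc r) i" for i j :: nat by (induction i) auto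
  show ?thesis
    unfolding add
  proof (rule ptime_rec_nat[where a = enc_nat, OF assms _ poly_bounded_add[OF assms[THEN ptime_size]]])
    show "j \<le> a x \<Longrightarrow> size (enc_nat (rec_nat (b x) (\<lambda>_ r. Suc r) j)) \<le> size (enc_nat (a x)) + size (enc_nat (b x))" for x j
      unfolding add[symmetric] by (simp add: size_enc_nat)
  qed (intro ptime_Suc ptime_var, simp)
qed

lemma ptime_mult:
  assumes "ptime Es (\<lambda>x. enc_nat (a x))" "ptime Es (\<lambda>x. enc_nat (b x))"
  shows "ptime Es (\<lambda>x. enc_nat (a x * b x))"
proof -
  have mult: "i * j = rec_nat 0 (\<lambda>_ r. j + r) i" for i j :: nat by (induction i) auto
  show ?thesis
    unfolding mult
  proof (rule ptime_rec_nat[OF assms(1) _ _ poly_bounded_mult[OF assms[THEN ptime_size]]])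
    show "j \<le> a x \<Longrightarrow> size (enc_nat (rec_nat 0 (\<lambda>_ r. b x + r) j)) \<le> size (enc_nat (a x)) * size (enc_nat (b x))" for x j
      unfolding mult[symmetric] by (simp add: size_enc_nat)
  qed (rule ptime_0, (intro ptime_add ptime_lift2[OF assms(2)] ptime_var, simp))
qed

lemma ptime_funpow:
  assumes k: "ptime Es (\<lambda>x. enc_nat (k x))" and init: "ptime Es (\<lambda>x. a (init x))"
    and step: "ptime ((\<lambda>z. a (fst z)) # pull snd Es) (\<lambda>z. a (f (snd z) (fst z)))"
    and B: "poly_bounded (env_size Es) B"
    and size: "\<And>x j. j \<le> k x \<Longrightarrow> size (a ((f x ^^ j) (init x))) \<le> B x"
  shows "ptime Es (\<lambda>x. a ((f x ^^ k x) (init x)))"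
proof -
  have pow: "(g ^^ n) i = rec_nat i (\<lambda>_ r. g r) n" for g :: "'c \<Rightarrow> 'c" and i n by (induction n) auto
  have step': "ptime ((\<lambda>z. enc_nat (fst z)) # (\<lambda>z. a (fst (snd z))) # pull (\<lambda>z. snd (snd z)) Es)
      (\<lambda>z. a (f (snd (snd z)) (fst (snd z))))"
  proof (rule ptime_env_mono)
    show "ptime ((\<lambda>z. a (fst (snd z))) # pull (\<lambda>z. snd (snd z)) Es) (\<lambda>z. a (f (snd (snd z)) (fst (snd z))))"
      using ptime_pull[OF step, of snd] by (simp add: comp_def)
  qed auto
  show ?thesis
    unfolding pow by (rule ptime_rec_nat[where a = a, OF k init step' B size[unfolded pow]])
qed

lemma ptime_drop:
  assumes "ptime Es (\<lambda>x. enc_nat (k x))" and xs: "ptime Es (\<lambda>x. enc_list e (xs x))"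
  shows "ptime Es (\<lambda>x. enc_list e (drop (k x) (xs x)))"
proof -
  have drop: "drop n ys = (tl ^^ n) ys" for n and ys :: "'c list"
    by (induction n) (simp_all add: drop_Suc drop_tl)
  show ?thesis
    unfolding drop
  proof (rule ptime_funpow[where a = "enc_list e", OF assms _ ptime_size[OF xs]])
    show "size (enc_list e ((tl ^^ j) (xs x))) \<le> size (enc_list e (xs x))" for x j
      unfolding drop[symmetric] by (rule size_enc_list_drop)
  qed (intro ptime_tl ptime_var, simp)
qed

definition nth_or :: "'c \<Rightarrow> 'c list \<Rightarrow> nat \<Rightarrow> 'c" where
  "nth_or d xs i = (case drop i xs of [] \<Rightarrow> d | v # _ \<Rightarrow> v)"

lemma ptime_nth_or:
  assumes "ptime Es (\<lambda>x. enc_list e (xs x))" "ptime Es (\<lambda>x. enc_nat (i x))" "e d = Leaf"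
  shows "ptime Es (\<lambda>x. e (nth_or d (xs x) (i x)))"
  unfolding nth_or_def by (intro ptime_case_hd ptime_drop assms)

section \<open>Input tables\<close>

abbreviation "enc_part \<equiv> enc_list enc_nat"
abbreviation "enc_parts \<equiv> enc_list enc_part"
abbreviation "enc_table \<equiv> enc_list (enc_list enc_bool)"

text \<open>The content of an input: number of elements, order, unary and binary relations. The search is
  defined on arbitrary tables, so that its complexity does not depend on their being well-formed.\<close>

type_synonym tables = "nat \<times> bool list list \<times> bool list list \<times> bool list list list"

definition enc_tables :: "tables \<Rightarrow> tree" where
  "enc_tables T = Node (enc_nat (fst T)) (Node (enc_table (fst (snd T)))
     (Node (enc_table (fst (snd (snd T)))) (Node (enc_list enc_table (snd (snd (snd T)))) Leaf)))"

definition table_at :: "bool list list \<Rightarrow> nat \<Rightarrow> nat \<Rightarrow> bool" where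
  "table_at B x y = nth_or False (nth_or [] B x) y"

text \<open>Entries of the matrix encoding are equal iff they arise from the same truth values, because
  \<open>entry_code\<close> is injective in these.\<close>

definition same_entry :: "tables \<Rightarrow> nat \<Rightarrow> nat \<Rightarrow> nat \<Rightarrow> nat \<Rightarrow> bool" where
  "same_entry T x y x' y' \<longleftrightarrow>
     list_all (\<lambda>B. table_at B x y = table_at B x' y' \<and> table_at B y x = table_at B y' x') (snd (snd (snd T))) \<and>
     list_all (\<lambda>V. (x = y \<and> nth_or False V x) = (x' = y' \<and> nth_or False V x')) (fst (snd (snd T)))"

lemma ptime_tables:
  assumes "ptime Es (\<lambda>x. enc_tables (T x))"
  shows "ptime Es (\<lambda>x. enc_nat (fst (T x)))" "ptime Es (\<lambda>x. enc_table (fst (snd (T x))))"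
    "ptime Es (\<lambda>x. enc_table (fst (snd (snd (T x)))))" "ptime Es (\<lambda>x. enc_list enc_table (snd (snd (snd (T x)))))"
  using assms
    assms[THEN ptime_left] assms[THEN ptime_right, THEN ptime_left]
    assms[THEN ptime_right, THEN ptime_right, THEN ptime_left]
    assms[THEN ptime_right, THEN ptime_right, THEN ptime_right, THEN ptime_left]
  by (simp_all add: enc_tables_def)

lemma ptime_table_at:
  assumes "ptime Es (\<lambda>x. enc_table (B x))" "ptime Es (\<lambda>x. enc_nat (a x))" "ptime Es (\<lambda>x. enc_nat (b x))"
  shows "ptime Es (\<lambda>x. enc_bool (table_at (B x) (a x) (b x)))"
  unfolding table_at_def by (intro ptime_nth_or assms) (auto simp: enc_list_Nil enc_bool_False)

lemma ptime_same_entry: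
  assumes "ptime Es (\<lambda>x. enc_tables (T x))" "ptime Es (\<lambda>x. enc_nat (a x))" "ptime Es (\<lambda>x. enc_nat (b x))"
    "ptime Es (\<lambda>x. enc_nat (a' x))" "ptime Es (\<lambda>x. enc_nat (b' x))"
  shows "ptime Es (\<lambda>x. enc_bool (same_entry (T x) (a x) (b x) (a' x) (b' x)))"
  unfolding same_entry_def
proof (intro ptime_and)
  show "ptime Es (\<lambda>x. enc_bool (list_all (\<lambda>B. table_at B (a x) (b x) = table_at B (a' x) (b' x) \<and>
      table_at B (b x) (a x) = table_at B (b' x) (a' x)) (snd (snd (snd (T x))))))"
    by (rule ptime_list_all[OF ptime_tables(4)[OF assms(1)]])
      (intro ptime_and ptime_bool_eq ptime_table_at assms(2-5)[THEN ptime_lift1] ptime_var; simp)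
  show "ptime Es (\<lambda>x. enc_bool (list_all (\<lambda>V. (a x = b x \<and> nth_or False V (a x)) =
      (a' x = b' x \<and> nth_or False V (a' x))) (fst (snd (snd (T x))))))"
    by (rule ptime_list_all[OF ptime_tables(3)[OF assms(1)]])
      (intro ptime_and ptime_bool_eq ptime_nat_eq ptime_nth_or assms(2-5)[THEN ptime_lift1] ptime_var;
       simp add: enc_bool_False)
qed

section \<open>Complexity of the greedy search\<close>

lemma ptime_rep:
  assumes "ptime Es (\<lambda>x. enc_part (P x))"
  shows "ptime Es (\<lambda>x. enc_nat (rep (P x)))"
  unfolding rep_def by (rule ptime_case_hd[OF assms enc_nat_0])

context
  fixes Es :: "('x \<Rightarrow> tree) list" and T :: "'x \<Rightarrow> tables"
  assumes T: "ptime Es (\<lambda>x. enc_tables (T x))"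
begin

lemma ptime_agree:
  assumes "ptime Es (\<lambda>x. enc_part (C x))" "ptime Es (\<lambda>x. enc_nat (a x))" "ptime Es (\<lambda>x. enc_nat (b x))"
  shows "ptime Es (\<lambda>x. enc_bool (agree (same_entry (T x)) (C x) (a x) (b x)))"
  unfolding agree_def
  by (rule ptime_list_all[OF assms(1)])
    (intro ptime_same_entry T[THEN ptime_lift1] assms(2,3)[THEN ptime_lift1] ptime_var; simp)

end

lemma size_reps: "size (enc_part (reps s C R)) \<le> size (enc_part R)"
  by (induction R) (auto simp: reps_def enc_list_simps)

lemma ptime_num_types:
  assumes T: "ptime Es (\<lambda>x. enc_tables (T x))"
    and R: "ptime Es (\<lambda>x. enc_part (R x))" and W: "ptime Es (\<lambda>x. enc_parts (W x))"
  shows "ptime Es (\<lambda>x. enc_nat (num_types (same_entry (T x)) (R x) (W x)))"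
  unfolding num_types_def reps_def
proof (rule ptime_length, rule ptime_foldr[OF R _ _ ptime_size[OF R]])
  show "size (enc_part (foldr (\<lambda>v rs. if list_ex (agree (same_entry (T x)) (concat (W x)) v) rs then rs else v # rs)
      (drop n (R x)) [])) \<le> size (enc_part (R x))" for x n
    unfolding reps_def[symmetric] using size_reps size_enc_list_drop by (rule order.trans)
  show "ptime ((\<lambda>z. enc_nat (fst z)) # (\<lambda>z. enc_part (fst (snd z))) # pull (\<lambda>z. snd (snd z)) Es)
    (\<lambda>z. enc_part (if list_ex (agree (same_entry (T (snd (snd z)))) (concat (W (snd (snd z)))) (fst z)) (fst (snd z))
       then fst (snd z) else fst z # fst (snd z)))"
  proof (intro ptime_if[where e = enc_part])
    show "ptime ((\<lambda>z. enc_nat (fst z)) # (\<lambda>z. enc_part (fst (snd z))) # pull (\<lambda>z. snd (snd z)) Es)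
      (\<lambda>z. enc_bool (list_ex (agree (same_entry (T (snd (snd z)))) (concat (W (snd (snd z)))) (fst z)) (fst (snd z))))"
      by (rule ptime_list_ex[where e = enc_nat])
        (rule ptime_var, simp, (intro ptime_agree ptime_concat
          T[THEN ptime_lift2, THEN ptime_lift1] W[THEN ptime_lift2, THEN ptime_lift1] ptime_var; simp))
  qed (intro ptime_Cons ptime_var; simp)+
qed (rule ptime_Nil)

lemma size_enc_prod: "size (enc_prod e1 e2 z) = Suc (size (e1 (fst z)) + size (e2 (snd z)))"
  by (simp add: enc_prod_def)

lemma size_scan:
  "size (enc_prod enc_parts enc_parts (scan s l R Cs)) \<le> Suc (size (enc_parts Cs))"
  by (induction Cs) (auto simp: scan_def size_enc_prod enc_list_simps)

lemma ptime_prune: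
  assumes T: "ptime Es (\<lambda>x. enc_tables (T x))" and l: "ptime Es (\<lambda>x. enc_nat (l x))"
    and R: "ptime Es (\<lambda>x. enc_part (R x))" and Cs: "ptime Es (\<lambda>x. enc_parts (Cs x))"
  shows "ptime Es (\<lambda>x. enc_parts (prune (same_entry (T x)) (l x) (R x) (Cs x)))"
  unfolding prune_def
proof (rule ptime_snd[where ?e1.0 = enc_parts])
  show "ptime Es (\<lambda>x. enc_prod enc_parts enc_parts (scan (same_entry (T x)) (l x) (R x) (Cs x)))"
    unfolding scan_def
  proof (rule ptime_foldr[OF Cs _ _ poly_bounded_Suc[OF ptime_size[OF Cs]]])
    show "ptime Es (\<lambda>x. enc_prod enc_parts enc_parts ([], []))"
      by (intro ptime_Pair ptime_Nil)
    fix x n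
    show "size (enc_prod enc_parts enc_parts (foldr (\<lambda>C z.
        if num_types (same_entry (T x)) (R x) (fst z) \<le> l x \<and>
           num_types (same_entry (T x)) (R x) (fst z) < num_types (same_entry (T x)) (R x) (C # fst z)
        then (C # fst z, snd z) else (fst z, C # snd z)) (drop n (Cs x)) ([], [])))
      \<le> Suc (size (enc_parts (Cs x)))"
      unfolding scan_def[symmetric]
      using size_scan size_enc_list_drop by (meson Suc_le_mono order.trans)
  next
    let ?E = "(\<lambda>z. enc_part (fst z)) # (\<lambda>z. enc_prod enc_parts enc_parts (fst (snd z))) # pull (\<lambda>z. snd (snd z)) Es"
    have C: "ptime ?E (\<lambda>z. enc_part (fst z))"
      and st: "ptime ?E (\<lambda>z. enc_prod enc_parts enc_parts (fst (snd z)))" by (rule ptime_var, simp)+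
    note W = ptime_fst[OF st] and S = ptime_snd[OF st]
    show "ptime ?E (\<lambda>z. enc_prod enc_parts enc_parts
       (if num_types (same_entry (T (snd (snd z)))) (R (snd (snd z))) (fst (fst (snd z))) \<le> l (snd (snd z)) \<and>
           num_types (same_entry (T (snd (snd z)))) (R (snd (snd z))) (fst (fst (snd z)))
           < num_types (same_entry (T (snd (snd z)))) (R (snd (snd z))) (fst z # fst (fst (snd z)))
        then (fst z # fst (fst (snd z)), snd (fst (snd z)))
        else (fst (fst (snd z)), fst z # snd (fst (snd z)))))"
      by (intro ptime_if[where e = "enc_prod enc_parts enc_parts"] ptime_and ptime_le ptime_less ptime_Pair
          ptime_Cons[where e = enc_part] ptime_num_types C W S T[THEN ptime_lift2] R[THEN ptime_lift2] l[THEN ptime_lift2])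
  qed
qed

lemma size_prune: "size (enc_parts (prune s l R Cs)) \<le> size (enc_parts Cs)"
  using size_scan[of s l R Cs] by (simp add: prune_def size_enc_prod)

lemma size_prune_pow: "size (enc_parts ((prune s l R ^^ j) Cs)) \<le> size (enc_parts Cs)"
  by (induction j) (auto intro: order.trans[OF size_prune])

lemma ptime_mergeable:
  assumes T: "ptime Es (\<lambda>x. enc_tables (T x))" and l: "ptime Es (\<lambda>x. enc_nat (l x))"
    and R: "ptime Es (\<lambda>x. enc_part (R x))" and Cs: "ptime Es (\<lambda>x. enc_parts (Cs x))"
  shows "ptime Es (\<lambda>x. enc_bool (mergeable (same_entry (T x)) (l x) (R x) (Cs x)))"
  unfolding mergeable_def
proof (intro ptime_le ptime_num_types T R l)
  show "ptime Es (\<lambda>x. enc_parts ((prune (same_entry (T x)) (l x) (R x) ^^ (l x * l x)) (Cs x)))"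
    by (rule ptime_funpow[where a = enc_parts, OF ptime_mult[OF l l] Cs _ ptime_size[OF Cs] size_prune_pow])
      (intro ptime_prune T[THEN ptime_lift1] R[THEN ptime_lift1] l[THEN ptime_lift1] ptime_var; simp)
qed

lemma ptime_mixed:
  assumes T: "ptime Es (\<lambda>x. enc_tables (T x))" and l: "ptime Es (\<lambda>x. enc_nat (l x))"
    and R: "ptime Es (\<lambda>x. enc_part (R x))" and C: "ptime Es (\<lambda>x. enc_part (C x))"
  shows "ptime Es (\<lambda>x. enc_bool (mixed (same_entry (T x)) (l x) (R x) (C x)))"
  unfolding mixed_def
  by (intro ptime_and ptime_less ptime_num_types T l R C ptime_Cons[where e = enc_part] ptime_Nil)

lemma ptime_related:
  assumes T: "ptime Es (\<lambda>x. enc_tables (T x))" and l: "ptime Es (\<lambda>x. enc_nat (l x))"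
    and D: "ptime Es (\<lambda>x. enc_parts (D x))"
    and a: "ptime Es (\<lambda>x. enc_nat (a x))" and b: "ptime Es (\<lambda>x. enc_nat (b x))"
  shows "ptime Es (\<lambda>x. enc_bool (related (same_entry (T x)) (l x) (D x) (a x) (b x)))"
proof -
  have all: "ptime ((\<lambda>z. enc_part (fst z)) # pull snd Es) (\<lambda>z. enc_bool (list_all (\<lambda>C.
      mixed (same_entry (T (snd z))) (l (snd z)) (fst z) C \<or> agree (same_entry (T (snd z))) C (a (snd z)) (b (snd z)))
      (D (snd z))))"
    by (rule ptime_list_all[OF D[THEN ptime_lift1]])
      (intro ptime_or ptime_mixed ptime_agree T[THEN ptime_lift1, THEN ptime_lift1] l[THEN ptime_lift1, THEN ptime_lift1]
        a[THEN ptime_lift1, THEN ptime_lift1] b[THEN ptime_lift1, THEN ptime_lift1] ptime_var; simp)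
  show ?thesis
    unfolding related_def One_nat_def
    by (intro all ptime_or ptime_le ptime_length[OF D] ptime_Suc ptime_0 ptime_list_ex[OF D] ptime_and ptime_member
        a[THEN ptime_lift1] b[THEN ptime_lift1] ptime_var; simp)
qed

lemma insert_part_rec:
  "insert_part r P A = rec_list [P] (\<lambda>P' A' acc. if r (rep P) (rep P') then (P @ P') # A' else P' # acc) A"
  by (induction A) auto

lemma size_insert_part: "size (enc_parts (insert_part r P A)) \<le> size (enc_parts (P # A))"
  by (induction A) (auto simp: enc_list_simps size_enc_list_append)

lemma ptime_insert_part:
  assumes T: "ptime Es (\<lambda>x. enc_tables (T x))" and l: "ptime Es (\<lambda>x. enc_nat (l x))"
    and D: "ptime Es (\<lambda>x. enc_parts (D x))"
    and P: "ptime Es (\<lambda>x. enc_part (P x))" and A: "ptime Es (\<lambda>x. enc_parts (A x))"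
  shows "ptime Es (\<lambda>x. enc_parts (insert_part (related (same_entry (T x)) (l x) (D x)) (P x) (A x)))"
  unfolding insert_part_rec
proof (rule ptime_rec_list[OF A])
  show PN: "ptime Es (\<lambda>x. enc_parts [P x])" by (intro ptime_Cons[where e = enc_part] P ptime_Nil)
  show "poly_bounded (env_size Es) (\<lambda>x. size (enc_parts (P x # A x)))"
    by (intro ptime_size ptime_Cons[where e = enc_part] P A)
  fix x n
  show "size (enc_parts (rec_list [P x] (\<lambda>P' A' acc. if related (same_entry (T x)) (l x) (D x) (rep (P x)) (rep P')
      then (P x @ P') # A' else P' # acc) (drop n (A x)))) \<le> size (enc_parts (P x # A x))"
    unfolding insert_part_rec[symmetric]
    by (rule order.trans[OF size_insert_part]) (simp add: enc_list_Cons size_enc_list_drop)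
next
  let ?E = "(\<lambda>z. enc_part (fst z)) # (\<lambda>z. enc_parts (fst (snd z))) # (\<lambda>z. enc_parts (fst (snd (snd z))))
     # pull (\<lambda>z. snd (snd (snd z))) Es"
  have v: "ptime ?E (\<lambda>z. enc_part (fst z))" "ptime ?E (\<lambda>z. enc_parts (fst (snd z)))"
    "ptime ?E (\<lambda>z. enc_parts (fst (snd (snd z))))" by (rule ptime_var, simp)+
  show "ptime ?E (\<lambda>z. enc_parts (if related (same_entry (T (snd (snd (snd z))))) (l (snd (snd (snd z))))
       (D (snd (snd (snd z)))) (rep (P (snd (snd (snd z))))) (rep (fst z))
      then (P (snd (snd (snd z))) @ fst z) # fst (snd z) else fst z # fst (snd (snd z))))"
    by (intro ptime_if[where e = enc_parts] ptime_related ptime_rep ptime_Cons[where e = enc_part] ptime_append v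
        T[THEN ptime_lift3] l[THEN ptime_lift3] D[THEN ptime_lift3] P[THEN ptime_lift3])
qed

lemma merge_related_rec:
  "merge_related r A = rec_list [] (\<lambda>P A' acc.
     if list_ex (\<lambda>P'. r (rep P) (rep P')) A' then insert_part r P A' else P # acc) A"
  by (induction A) auto

lemma size_merge_related: "size (enc_parts (merge_related r A)) \<le> size (enc_parts A)"
proof (induction A)
  case (Cons P A)
  then show ?case using size_insert_part[of r P A] by (auto simp: enc_list_simps)
qed simp

lemma ptime_merge_related:
  assumes T: "ptime Es (\<lambda>x. enc_tables (T x))" and l: "ptime Es (\<lambda>x. enc_nat (l x))"
    and D: "ptime Es (\<lambda>x. enc_parts (D x))" and A: "ptime Es (\<lambda>x. enc_parts (A x))"
  shows "ptime Es (\<lambda>x. enc_parts (merge_related (related (same_entry (T x)) (l x) (D x)) (A x)))"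
  unfolding merge_related_rec
proof (rule ptime_rec_list[OF A _ _ ptime_size[OF A]])
  fix x n
  show "size (enc_parts (rec_list [] (\<lambda>P A' acc.
     if list_ex (\<lambda>P'. related (same_entry (T x)) (l x) (D x) (rep P) (rep P')) A'
     then insert_part (related (same_entry (T x)) (l x) (D x)) P A' else P # acc) (drop n (A x))))
     \<le> size (enc_parts (A x))"
    unfolding merge_related_rec[symmetric] using size_merge_related size_enc_list_drop by (rule order.trans)
next
  let ?E = "(\<lambda>z. enc_part (fst z)) # (\<lambda>z. enc_parts (fst (snd z))) # (\<lambda>z. enc_parts (fst (snd (snd z))))
     # pull (\<lambda>z. snd (snd (snd z))) Es"
  have v: "ptime ?E (\<lambda>z. enc_part (fst z))" "ptime ?E (\<lambda>z. enc_parts (fst (snd z)))"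
    "ptime ?E (\<lambda>z. enc_parts (fst (snd (snd z))))" by (rule ptime_var, simp)+
  have ex: "ptime ?E (\<lambda>z. enc_bool (list_ex (\<lambda>P'. related (same_entry (T (snd (snd (snd z))))) (l (snd (snd (snd z))))
       (D (snd (snd (snd z)))) (rep (fst z)) (rep P')) (fst (snd z))))"
    by (rule ptime_list_ex[OF v(2)])
      (intro ptime_related ptime_rep v(1)[THEN ptime_lift1] T[THEN ptime_lift3, THEN ptime_lift1]
        l[THEN ptime_lift3, THEN ptime_lift1] D[THEN ptime_lift3, THEN ptime_lift1] ptime_var; simp)
  show "ptime ?E (\<lambda>z. enc_parts (if list_ex (\<lambda>P'. related (same_entry (T (snd (snd (snd z))))) (l (snd (snd (snd z))))
       (D (snd (snd (snd z)))) (rep (fst z)) (rep P')) (fst (snd z))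
      then insert_part (related (same_entry (T (snd (snd (snd z))))) (l (snd (snd (snd z)))) (D (snd (snd (snd z)))))
        (fst z) (fst (snd z)) else fst z # fst (snd (snd z))))"
    by (intro ptime_if[where e = enc_parts] ex ptime_insert_part ptime_Cons[where e = enc_part] v
        T[THEN ptime_lift3] l[THEN ptime_lift3] D[THEN ptime_lift3])
qed (rule ptime_Nil)

text \<open>In contrast to \<open>hd\<close>, the value on the empty list is known, and it is the one that \<open>left\<close> computes.\<close>

definition head :: "nat list list \<Rightarrow> nat list" where
  "head Rs = (case Rs of [] \<Rightarrow> [] | R # _ \<Rightarrow> R)"

lemma merge_adjacent_rec:
  "merge_adjacent t D = rec_list [] (\<lambda>R Rs acc. if Rs = [] then [R]
     else if t (R @ head Rs) then (R @ head Rs) # tl Rs else R # acc) D"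
proof (induction D)
  case (Cons R D)
  then show ?case by (cases D) (auto simp: head_def)
qed simp

lemma size_merge_adjacent: "size (enc_parts (merge_adjacent t D)) \<le> size (enc_parts D)"
proof (induction D)
  case (Cons R D)
  then show ?case by (cases D) (auto simp: enc_list_simps size_enc_list_append)
qed simp

lemma ptime_merge_adjacent:
  assumes T: "ptime Es (\<lambda>x. enc_tables (T x))" and l: "ptime Es (\<lambda>x. enc_nat (l x))"
    and D: "ptime Es (\<lambda>x. enc_parts (D x))" and D': "ptime Es (\<lambda>x. enc_parts (D' x))"
  shows "ptime Es (\<lambda>x. enc_parts (merge_adjacent (\<lambda>R. mergeable (same_entry (T x)) (l x) R (D' x)) (D x)))"
  unfolding merge_adjacent_rec
proof (rule ptime_rec_list[OF D _ _ ptime_size[OF D]])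
  fix x n
  show "size (enc_parts (rec_list [] (\<lambda>R Rs acc. if Rs = [] then [R]
     else if mergeable (same_entry (T x)) (l x) (R @ head Rs) (D' x) then (R @ head Rs) # tl Rs else R # acc)
       (drop n (D x)))) \<le> size (enc_parts (D x))"
    using size_merge_adjacent[of "\<lambda>R. mergeable (same_entry (T x)) (l x) R (D' x)" "drop n (D x)"]
      size_enc_list_drop[of enc_part n "D x"] unfolding merge_adjacent_rec by (rule order.trans)
next
  let ?E = "(\<lambda>z. enc_part (fst z)) # (\<lambda>z. enc_parts (fst (snd z))) # (\<lambda>z. enc_parts (fst (snd (snd z))))
     # pull (\<lambda>z. snd (snd (snd z))) Es"
  have v: "ptime ?E (\<lambda>z. enc_part (fst z))" "ptime ?E (\<lambda>z. enc_parts (fst (snd z)))"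
    "ptime ?E (\<lambda>z. enc_parts (fst (snd (snd z))))" by (rule ptime_var, simp)+
  have new: "ptime ?E (\<lambda>z. enc_part (fst z @ head (fst (snd z))))"
    unfolding head_def by (intro ptime_append v ptime_case_hd enc_list_Nil)
  show "ptime ?E (\<lambda>z. enc_parts (if fst (snd z) = [] then [fst z]
      else if mergeable (same_entry (T (snd (snd (snd z))))) (l (snd (snd (snd z)))) (fst z @ head (fst (snd z)))
         (D' (snd (snd (snd z))))
      then (fst z @ head (fst (snd z))) # tl (fst (snd z)) else fst z # fst (snd (snd z))))"
    by (intro ptime_if[where e = enc_parts] ptime_is_Nil[OF v(2)] ptime_mergeable ptime_Cons[where e = enc_part] ptime_Nil v
        new ptime_tl T[THEN ptime_lift3] l[THEN ptime_lift3] D'[THEN ptime_lift3])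
qed (rule ptime_Nil)

abbreviation "enc_pair \<equiv> enc_prod enc_parts enc_parts"
abbreviation "enc_state \<equiv> enc_prod enc_parts (enc_prod enc_parts (enc_list enc_pair))"

lemma ptime_step:
  assumes T: "ptime Es (\<lambda>x. enc_tables (T x))" and l: "ptime Es (\<lambda>x. enc_nat (l x))"
    and st: "ptime Es (\<lambda>x. enc_state (st x))"
  shows "ptime Es (\<lambda>x. enc_state (step (same_entry (T x)) (l x) (st x)))"
proof -
  note D = ptime_fst[OF st] and A = ptime_fst[OF ptime_snd[OF st]] and h = ptime_snd[OF ptime_snd[OF st]]
  note A' = ptime_merge_related[OF T l D A]
  show ?thesis
    unfolding step_def Let_def
    by (intro ptime_if[where e = enc_state] ptime_less ptime_length[OF A'] ptime_length[OF A]
        ptime_Pair[where ?e1.0 = enc_parts] ptime_Cons[where e = enc_pair]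
        ptime_merge_adjacent[OF T l D D] D A A' h)
qed

lemma size_step_iterate:
  assumes "size (enc_parts (fst st)) \<le> n" "size (enc_parts (fst (snd st))) \<le> n"
    "size (enc_list enc_pair (snd (snd st))) \<le> m"
  shows "size (enc_parts (fst ((step s l ^^ j) st))) \<le> n \<and>
    size (enc_parts (fst (snd ((step s l ^^ j) st)))) \<le> n \<and>
    size (enc_list enc_pair (snd (snd ((step s l ^^ j) st)))) \<le> m + j * (4 * n + 4)"
proof (induction j)
  case (Suc j)
  obtain D A h where st: "(step s l ^^ j) st = (D, A, h)" by (cases "(step s l ^^ j) st")
  have IH: "size (enc_parts D) \<le> n" "size (enc_parts A) \<le> n" "size (enc_list enc_pair h) \<le> m + j * (4 * n + 4)"
    using Suc st by auto
  moreover have "size (enc_parts (merge_related (related s l D) A)) \<le> n"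
    using size_merge_related IH(2) by (rule order.trans)
  moreover have "size (enc_parts (merge_adjacent (\<lambda>R. mergeable s l R D) D)) \<le> n"
    using size_merge_adjacent IH(1) by (rule order.trans)
  moreover have "step s l (D, A, h) =
      (if length (merge_related (related s l D) A) < length A
       then (D, merge_related (related s l D) A,
         (merge_related (related s l D) A, merge_related (related s l D) A)
         # (merge_related (related s l D) A, A) # h)
       else (merge_adjacent (\<lambda>R. mergeable s l R D) D, A, h))"
    by (simp add: step_def Let_def)
  ultimately show ?case
    unfolding funpow.simps comp_apply st by (auto simp: enc_list_Cons size_enc_prod)
qed (use assms in auto)

lemma size_singletons: "size (enc_parts (singletons X)) \<le> 2 * size (enc_part X)"
  by (induction X) (auto simp: singletons_def enc_list_simps)

lemma ptime_singletons:
  assumes X: "ptime Es (\<lambda>x. enc_part (X x))"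
  shows "ptime Es (\<lambda>x. enc_parts (singletons (X x)))"
proof -
  have rec: "singletons Y = foldr (\<lambda>y r. [y] # r) Y []" for Y
    by (induction Y) (auto simp: singletons_def)
  show ?thesis
    unfolding rec
  proof (rule ptime_foldr[OF X _ _ poly_bounded_mult[OF poly_bounded_const[of _ 2] ptime_size[OF X]]])
    show "size (enc_parts (foldr (\<lambda>y r. [y] # r) (drop n (X x)) [])) \<le> 2 * size (enc_part (X x))" for x n
      unfolding rec[symmetric]
      using size_singletons[of "drop n (X x)"] size_enc_list_drop[of enc_nat n "X x"] by linarith
  qed (rule ptime_Nil, (intro ptime_Cons[where e = enc_part] ptime_Cons[where e = enc_nat] ptime_Nil ptime_var; simp))
qed

lemma size_state: "size (enc_state st) =
    2 + size (enc_parts (fst st)) + size (enc_parts (fst (snd st))) + size (enc_list enc_pair (snd (snd st)))"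
  by (simp add: size_enc_prod)

text \<open>Merging does not increase the sizes of the encoded division and partition, and each step adds
  at most two pairs to the history.\<close>

definition attempt_bound :: "nat list \<Rightarrow> nat" where
  "attempt_bound X = (let n = 2 * size (enc_part X) in
     2 + n + n + (2 * n + 2 + (length X + length X) * (4 * n + 4)))"

lemma size_attempt_state:
  assumes "j \<le> length X + length X"
  shows "size (enc_state ((step s l ^^ j) (singletons X, singletons X, [(singletons X, singletons X)])))
    \<le> attempt_bound X"
proof -
  let ?st = "(singletons X, singletons X, [(singletons X, singletons X)])"
  let ?n = "2 * size (enc_part X)"
  note S = size_singletons[of X]
  have "size (enc_list enc_pair [(singletons X, singletons X)]) \<le> 2 * ?n + 2"
    using S by (simp add: enc_list_simps size_enc_prod)
  then have "size (enc_parts (fst ((step s l ^^ j) ?st))) \<le> ?n \<and>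
    size (enc_parts (fst (snd ((step s l ^^ j) ?st)))) \<le> ?n \<and>
    size (enc_list enc_pair (snd (snd ((step s l ^^ j) ?st)))) \<le> 2 * ?n + 2 + j * (4 * ?n + 4)"
    using S by (intro size_step_iterate) auto
  moreover have "j * (4 * ?n + 4) \<le> (length X + length X) * (4 * ?n + 4)"
    using assms by (intro mult_right_mono) auto
  ultimately show ?thesis unfolding size_state attempt_bound_def Let_def by linarith
qed

lemma size_attempt: "size (enc_list enc_pair (attempt s l X)) \<le> attempt_bound X"
proof -
  have "size (enc_list enc_pair (rev h)) = size (enc_list enc_pair h)" for h
    by (simp add: size_enc_list rev_map[symmetric])
  then show ?thesis
    using size_attempt_state[of "length X + length X" X s l]
    by (auto simp: attempt_def Let_def enc_list_Nil size_state)
qed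

lemma poly_bounded_attempt:
  assumes X: "ptime Es (\<lambda>x. enc_part (X x))"
  shows "poly_bounded (env_size Es) (\<lambda>x. attempt_bound (X x))"
  unfolding attempt_bound_def Let_def
  using ptime_size[OF X] ptime_size[OF ptime_length[OF X]]
  by (intro poly_bounded_add poly_bounded_mult poly_bounded_const) (auto simp: size_enc_nat)

lemma ptime_attempt:
  assumes T: "ptime Es (\<lambda>x. enc_tables (T x))" and l: "ptime Es (\<lambda>x. enc_nat (l x))"
    and X: "ptime Es (\<lambda>x. enc_part (X x))"
  shows "ptime Es (\<lambda>x. enc_list enc_pair (attempt (same_entry (T x)) (l x) (X x)))"
proof -
  note S = ptime_singletons[OF X]
  have st: "ptime Es (\<lambda>x. enc_state ((step (same_entry (T x)) (l x) ^^ (length (X x) + length (X x)))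
      (singletons (X x), singletons (X x), [(singletons (X x), singletons (X x))])))"
  proof (rule ptime_funpow[where a = enc_state, OF ptime_add[OF ptime_length[OF X] ptime_length[OF X]]
        _ _ poly_bounded_attempt[OF X] size_attempt_state])
    show "ptime Es (\<lambda>x. enc_state (singletons (X x), singletons (X x), [(singletons (X x), singletons (X x))]))"
      by (intro ptime_Pair S ptime_Cons[where e = enc_pair] ptime_Nil)
  qed (intro ptime_step T[THEN ptime_lift1] l[THEN ptime_lift1] ptime_var; simp)+
  show ?thesis
    unfolding attempt_def Let_def One_nat_def
    by (intro ptime_if[where e = "enc_list enc_pair"] ptime_le ptime_length[OF ptime_fst[OF ptime_snd[OF st]]]
        ptime_Suc ptime_0 ptime_rev ptime_snd[OF ptime_snd[OF st]] ptime_Nil)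
qed

definition insert_sorted :: "bool list list \<Rightarrow> nat \<Rightarrow> nat list \<Rightarrow> nat list" where
  "insert_sorted B x ys = rec_list [x] (\<lambda>y ys r. if table_at B x y then x # y # ys else y # r) ys"

definition insertion_sort :: "bool list list \<Rightarrow> nat list \<Rightarrow> nat list" where
  "insertion_sort B xs = foldr (insert_sorted B) xs []"

definition numbers :: "nat \<Rightarrow> nat list" where
  "numbers n = rec_nat [] (\<lambda>j r. j # r) n"

text \<open>The parameters are tried in increasing order, so that the one that is used is no larger than any
  parameter for which success is guaranteed.\<close>

definition search :: "tables \<Rightarrow> nat list \<Rightarrow> nat \<Rightarrow> listed_sequence" where
  "search T X n = rec_nat (attempt (same_entry T) (Suc 0) X)
     (\<lambda>j r. if r = [] then attempt (same_entry T) (Suc (Suc j)) X else r) n"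

definition find_sequence :: "tables \<Rightarrow> listed_sequence" where
  "find_sequence T = search T (insertion_sort (fst (snd T)) (numbers (fst T))) (fst T)"

lemma size_insert_sorted: "size (enc_part (insert_sorted B x ys)) = size (enc_part (x # ys))"
  by (induction ys) (auto simp: insert_sorted_def enc_list_simps)

lemma ptime_insert_sorted:
  assumes B: "ptime Es (\<lambda>x. enc_table (B x))" and a: "ptime Es (\<lambda>x. enc_nat (a x))"
    and ys: "ptime Es (\<lambda>x. enc_part (ys x))"
  shows "ptime Es (\<lambda>x. enc_part (insert_sorted (B x) (a x) (ys x)))"
  unfolding insert_sorted_def
proof (rule ptime_rec_list[OF ys])
  show "ptime Es (\<lambda>x. enc_part [a x])" by (intro ptime_Cons[where e = enc_nat] a ptime_Nil)
  show "poly_bounded (env_size Es) (\<lambda>x. size (enc_part (a x # ys x)))"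
    by (intro ptime_size ptime_Cons[where e = enc_nat] a ys)
  fix x n
  show "size (enc_part (rec_list [a x] (\<lambda>y ys r. if table_at (B x) (a x) y then a x # y # ys else y # r) (drop n (ys x))))
      \<le> size (enc_part (a x # ys x))"
    unfolding insert_sorted_def[symmetric] size_insert_sorted by (simp add: enc_list_Cons size_enc_list_drop)
next
  let ?E = "(\<lambda>z. enc_nat (fst z)) # (\<lambda>z. enc_part (fst (snd z))) # (\<lambda>z. enc_part (fst (snd (snd z))))
     # pull (\<lambda>z. snd (snd (snd z))) Es"
  have v: "ptime ?E (\<lambda>z. enc_nat (fst z))" "ptime ?E (\<lambda>z. enc_part (fst (snd z)))"
    "ptime ?E (\<lambda>z. enc_part (fst (snd (snd z))))" by (rule ptime_var, simp)+
  show "ptime ?E (\<lambda>z. enc_part (if table_at (B (snd (snd (snd z)))) (a (snd (snd (snd z)))) (fst z)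
      then a (snd (snd (snd z))) # fst z # fst (snd z) else fst z # fst (snd (snd z))))"
    by (intro ptime_if[where e = enc_part] ptime_table_at ptime_Cons[where e = enc_nat] v
        B[THEN ptime_lift3] a[THEN ptime_lift3])
qed

lemma ptime_insertion_sort:
  assumes B: "ptime Es (\<lambda>x. enc_table (B x))" and xs: "ptime Es (\<lambda>x. enc_part (xs x))"
  shows "ptime Es (\<lambda>x. enc_part (insertion_sort (B x) (xs x)))"
  unfolding insertion_sort_def
proof (rule ptime_foldr[OF xs _ _ ptime_size[OF xs]])
  have "size (enc_part (foldr (insert_sorted C) ys [])) = size (enc_part ys)" for C ys
    by (induction ys) (auto simp: size_insert_sorted enc_list_Cons)
  then show "size (enc_part (foldr (insert_sorted (B x)) (drop n (xs x)) [])) \<le> size (enc_part (xs x))" for x n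
    by (simp add: size_enc_list_drop)
qed (rule ptime_Nil, (intro ptime_insert_sorted B[THEN ptime_lift2] ptime_var; simp))

lemma ptime_numbers:
  assumes n: "ptime Es (\<lambda>x. enc_nat (n x))"
  shows "ptime Es (\<lambda>x. enc_part (numbers (n x)))"
  unfolding numbers_def
proof (rule ptime_rec_nat[OF n _ _ poly_bounded_mult[OF ptime_size[OF n] ptime_size[OF n]]])
  fix x j assume "j \<le> n x"
  moreover have "size (enc_part (rec_nat [] (\<lambda>j r. j # r) j)) \<le> j * j"
    by (induction j) (auto simp: enc_list_simps size_enc_nat)
  ultimately show "size (enc_part (rec_nat [] (\<lambda>j r. j # r) j)) \<le> size (enc_nat (n x)) * size (enc_nat (n x))"
    unfolding size_enc_nat by (meson le_trans mult_le_mono)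
qed (rule ptime_Nil, (intro ptime_Cons[where e = enc_nat] ptime_var; simp))

lemma ptime_search:
  assumes T: "ptime Es (\<lambda>x. enc_tables (T x))" and X: "ptime Es (\<lambda>x. enc_part (X x))"
    and n: "ptime Es (\<lambda>x. enc_nat (n x))"
  shows "ptime Es (\<lambda>x. enc_list enc_pair (search (T x) (X x) (n x)))"
  unfolding search_def
proof (rule ptime_rec_nat[OF n _ _ poly_bounded_attempt[OF X]])
  show "ptime Es (\<lambda>x. enc_list enc_pair (attempt (same_entry (T x)) (Suc 0) (X x)))"
    by (intro ptime_attempt T X ptime_Suc ptime_0)
  show "size (enc_list enc_pair (rec_nat (attempt (same_entry (T x)) (Suc 0) (X x))
     (\<lambda>j r. if r = [] then attempt (same_entry (T x)) (Suc (Suc j)) (X x) else r) j)) \<le> attempt_bound (X x)" for x j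
    by (induction j) (auto simp: size_attempt)
next
  let ?E = "(\<lambda>z. enc_nat (fst z)) # (\<lambda>z. enc_list enc_pair (fst (snd z))) # pull (\<lambda>z. snd (snd z)) Es"
  have v: "ptime ?E (\<lambda>z. enc_nat (fst z))" "ptime ?E (\<lambda>z. enc_list enc_pair (fst (snd z)))" by (rule ptime_var, simp)+
  show "ptime ?E (\<lambda>z. enc_list enc_pair (if fst (snd z) = []
      then attempt (same_entry (T (snd (snd z)))) (Suc (Suc (fst z))) (X (snd (snd z))) else fst (snd z)))"
    by (intro ptime_if[where e = "enc_list enc_pair"] ptime_is_Nil[OF v(2)] ptime_attempt ptime_Suc v
        T[THEN ptime_lift2] X[THEN ptime_lift2])
qed

lemma ptime_find_sequence: "ptime [enc_tables] (\<lambda>T. enc_sequence (find_sequence T))"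
proof -
  have T: "ptime [enc_tables] (\<lambda>T. enc_tables T)" by (rule ptime_var) simp
  show ?thesis
    unfolding find_sequence_def enc_sequence_def
    by (intro ptime_search T ptime_insertion_sort ptime_numbers ptime_tables(1,2)[OF T])
qed

section \<open>Approximating the twin-width of an ordered structure\<close>

definition relation_table :: "nat \<Rightarrow> nat rel \<Rightarrow> bool list list" where
  "relation_table n E = map (\<lambda>x. map (\<lambda>y. (x, y) \<in> E) [0..<n]) [0..<n]"

definition tables_of :: "nat ostruct \<Rightarrow> tables" where
  "tables_of G = (let n = card (universe G) in
     (n, relation_table n (less_rel G), map (\<lambda>V. map (\<lambda>x. x \<in> V) [0..<n]) (unary G),
      map (relation_table n) (binary G)))"

lemma enc_list_map: "enc_list e (map f xs) = enc_list (\<lambda>x. e (f x)) xs"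
  by (induction xs) (auto simp: enc_list_simps)

lemma enc_struct_eq_enc_tables: "enc_struct G = enc_tables (tables_of G)"
proof -
  have "enc_rel n = (\<lambda>E. enc_table (relation_table n E))" for n
    by (rule ext) (simp add: enc_rel_def relation_table_def enc_list_map)
  moreover have "enc_set n = (\<lambda>V. enc_list enc_bool (map (\<lambda>x. x \<in> V) [0..<n]))" for n
    by (rule ext) (simp add: enc_set_def enc_list_map)
  ultimately show ?thesis
    by (simp add: enc_struct_def tables_of_def enc_tables_def Let_def enc_list_simps enc_list_map)
qed

lemma size_enc_bools: "size (enc_list enc_bool bs) \<le> 2 * length bs"
  by (induction bs) (auto simp: enc_list_simps enc_bool_def)

lemma size_enc_list_le:
  "(\<And>x. x \<in> set xs \<Longrightarrow> size (e x) \<le> m) \<Longrightarrow> size (enc_list e xs) \<le> length xs * (m + 1)"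
proof (induction xs)
  case (Cons a xs)
  then have "size (e a) \<le> m" "size (enc_list e xs) \<le> length xs * (m + 1)" by auto
  then show ?case by (simp add: enc_list_Cons)
qed (simp add: enc_list_Nil)

lemma size_relation_table: "size (enc_table (relation_table n E)) \<le> n * (2 * n + 1)"
proof -
  have "size (enc_list enc_bool bs) \<le> 2 * n" if "bs \<in> set (relation_table n E)" for bs
    using that size_enc_bools[of bs] by (auto simp: relation_table_def)
  then show ?thesis
    using size_enc_list_le[of "relation_table n E" "enc_list enc_bool" "2 * n"]
    by (simp add: relation_table_def)
qed

lemma size_enc_struct:
  assumes "length (unary G) = u" "length (binary G) = b" "1 \<le> card (universe G)"
  shows "size (enc_struct G) + 2 \<le> (10 + 3 * u + 4 * b) * card (universe G) ^ 2"
proof -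
  let ?n = "card (universe G)"
  have n: "?n \<le> ?n ^ 2" "1 \<le> ?n ^ 2" using assms(3) by (auto simp: power2_eq_square)
  have rel: "size (enc_table (relation_table ?n E)) \<le> 3 * ?n ^ 2" for E
  proof -
    have "?n * (2 * ?n + 1) = 2 * ?n ^ 2 + ?n" by (simp add: power2_eq_square)
    then show ?thesis using size_relation_table[of ?n E] n by linarith
  qed
  let ?un = "map (\<lambda>V. map (\<lambda>x. x \<in> V) [0..<?n]) (unary G)"
  have "size (enc_list enc_bool bs) \<le> 2 * ?n" if "bs \<in> set ?un" for bs
    using that size_enc_bools[of bs] by auto
  then have un: "size (enc_table ?un) \<le> u * (2 * ?n + 1)"
    using size_enc_list_le[of ?un "enc_list enc_bool" "2 * ?n"] assms(1) by simp
  have un': "u * (2 * ?n + 1) \<le> u * (3 * ?n ^ 2)" using n by (intro mult_left_mono) auto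
  let ?bin = "map (relation_table ?n) (binary G)"
  have "size (enc_table B) \<le> 3 * ?n ^ 2" if "B \<in> set ?bin" for B using that rel by auto
  then have bin: "size (enc_list enc_table ?bin) \<le> b * (3 * ?n ^ 2 + 1)"
    using size_enc_list_le[of ?bin enc_table "3 * ?n ^ 2"] assms(2) by simp
  have bin': "b * (3 * ?n ^ 2 + 1) \<le> b * (4 * ?n ^ 2)" using n by (intro mult_left_mono) auto
  have "size (enc_struct G) = 4 + ?n + size (enc_table (relation_table ?n (less_rel G)))
      + size (enc_table ?un) + size (enc_list enc_table ?bin)"
    unfolding enc_struct_eq_enc_tables by (simp add: enc_tables_def tables_of_def Let_def size_enc_nat)
  then have "size (enc_struct G) \<le> 4 + ?n + 3 * ?n ^ 2 + u * (3 * ?n ^ 2) + b * (4 * ?n ^ 2)"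
    using rel[of "less_rel G"] un un' bin bin' by linarith
  then show ?thesis using n by (simp add: algebra_simps)
qed

lemma nth_or_map_upt: "nth_or d (map f [0..<n]) i = (if i < n then f i else d)"
proof (cases "i < n")
  case True
  have "drop i [0..<n] = [i..<n]" by (simp only: drop_upt add_0)
  then have "drop i [0..<n] = i # [Suc i..<n]" using upt_conv_Cons[OF True] by (rule trans)
  then show ?thesis using True by (simp add: nth_or_def drop_map)
qed (simp add: nth_or_def)

lemma table_at_relation_table:
  "E \<subseteq> {..<n} \<times> {..<n} \<Longrightarrow> table_at (relation_table n E) x y \<longleftrightarrow> (x, y) \<in> E"
  by (auto simp: table_at_def relation_table_def nth_or_map_upt) (auto simp: nth_or_def)

lemma entry_code_eq_iff:
  "entry_code E x y = entry_code E' x' y' \<longleftrightarrow>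
     ((x, y) \<in> E) = ((x', y') \<in> E') \<and> ((y, x) \<in> E) = ((y', x') \<in> E')"
  by (auto simp: entry_code_def)

lemma same_entry_tables_of:
  assumes G: "ordered_binary_structure u b G" "universe G = {..<n}"
  shows "same_entry (tables_of G) x y x' y' \<longleftrightarrow>
    entry (matrix_encoding G) x y = entry (matrix_encoding G) x' y'"
proof -
  have E: "E \<in> set (binary G) \<Longrightarrow> table_at (relation_table n E) x y \<longleftrightarrow> (x, y) \<in> E" for E x y
    using G by (intro table_at_relation_table) (auto simp: ordered_binary_structure_def)
  have V: "V \<in> set (unary G) \<Longrightarrow> nth_or False (map (\<lambda>x. x \<in> V) [0..<n]) x \<longleftrightarrow> x \<in> V" for V x
    using G by (auto simp: nth_or_map_upt ordered_binary_structure_def)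
  have "same_entry (tables_of G) x y x' y' \<longleftrightarrow>
      (\<forall>E\<in>set (binary G). ((x, y) \<in> E) = ((x', y') \<in> E) \<and> ((y, x) \<in> E) = ((y', x') \<in> E)) \<and>
      (\<forall>V\<in>set (unary G). (x = y \<and> x \<in> V) = (x' = y' \<and> x' \<in> V))"
    using E V G(2) by (simp add: same_entry_def tables_of_def Let_def list_all_iff)
  moreover have "entry (matrix_encoding G) x y = entry (matrix_encoding G) x' y' \<longleftrightarrow>
      (\<forall>E\<in>set (binary G). entry_code E x y = entry_code E x' y') \<and>
      (\<forall>V\<in>set (unary G). entry_code (Id_on V) x y = entry_code (Id_on V) x' y')"
    by (auto simp: matrix_encoding_def)
  moreover have "entry_code (Id_on V) x y = entry_code (Id_on V) x' y' \<longleftrightarrow>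
      (x = y \<and> x \<in> V) = (x' = y' \<and> x' \<in> V)" for V
    unfolding entry_code_eq_iff Id_on_iff by auto
  ultimately show ?thesis unfolding entry_code_eq_iff by blast
qed

lemma bounded_alphabet_matrix_encoding:
  assumes G: "ordered_binary_structure u b G" and "1 \<le> l"
  shows "bounded_alphabet (entry (matrix_encoding G)) (universe G) (less_rel G)
    {xs. set xs \<subseteq> {-1, 0, 1, 2} \<and> length xs = u + b} (4 ^ (u + b + 1)) l"
proof unfold_locales
  fix x y x' y' :: nat
  show "(entry (matrix_encoding G) x y = entry (matrix_encoding G) x' y') =
      (entry (matrix_encoding G) y x = entry (matrix_encoding G) y' x')"
    by (simp add: matrix_encoding_def entry_code_eq_iff) blast
  show "entry (matrix_encoding G) x y \<in> {xs. set xs \<subseteq> {-1, 0, 1, 2} \<and> length xs = u + b}"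
    using G by (auto simp: matrix_encoding_def ordered_binary_structure_def entry_code_def)
next
  show "finite {xs. set xs \<subseteq> {-1, 0, 1, 2 :: int} \<and> length xs = u + b}"
    by (intro finite_lists_length_eq) simp
  have four: "card {-1, 0, 1, 2 :: int} = 4" by simp
  have "card {xs. set xs \<subseteq> {-1, 0, 1, 2 :: int} \<and> length xs = u + b} = card {-1, 0, 1, 2 :: int} ^ (u + b)"
    by (rule card_lists_length_eq) simp
  also have "\<dots> \<le> 4 ^ (u + b + 1)" unfolding four by (rule power_increasing) simp_all
  finally show "card {xs. set xs \<subseteq> {-1, 0, 1, 2 :: int} \<and> length xs = u + b} \<le> 4 ^ (u + b + 1)" .
  show "(2 :: nat) \<le> 4 ^ (u + b + 1)" using one_le_power[of "4 :: nat" "u + b"] by simp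
qed (use assms in \<open>auto simp: ordered_binary_structure_def\<close>)

lemma insert_sorted_Nil: "insert_sorted B x [] = [x]"
  by (simp add: insert_sorted_def)

lemma insert_sorted_Cons:
  "insert_sorted B x (y # ys) = (if table_at B x y then x # y # ys else y # insert_sorted B x ys)"
  by (simp add: insert_sorted_def)

lemma set_insert_sorted: "set (insert_sorted B x ys) = insert x (set ys)"
  by (induction ys) (auto simp: insert_sorted_Nil insert_sorted_Cons)

lemma sorted_insert_sorted:
  assumes B: "\<And>x y. table_at B x y \<longleftrightarrow> (x, y) \<in> L" and L: "strict_linear_order_on U L"
    and ys: "sorted_wrt (\<lambda>x y. (x, y) \<in> L) ys" "set ys \<subseteq> U" "x \<in> U" "x \<notin> set ys"
  shows "sorted_wrt (\<lambda>x y. (x, y) \<in> L) (insert_sorted B x ys)"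
  using ys
proof (induction ys)
  case (Cons y ys)
  have tr: "trans L" and tot: "total_on U L" using L by (auto simp: strict_linear_order_on_def)
  show ?case
  proof (cases "(x, y) \<in> L")
    case True
    then show ?thesis using Cons.prems B tr by (auto simp: insert_sorted_Cons dest: transD)
  next
    case False
    then have "(y, x) \<in> L" using tot Cons.prems by (auto simp: total_on_def)
    then show ?thesis using Cons False B by (auto simp: insert_sorted_Cons set_insert_sorted)
  qed
qed (simp add: insert_sorted_def)

lemma insertion_sort_correct:
  assumes B: "\<And>x y. table_at B x y \<longleftrightarrow> (x, y) \<in> L" and L: "strict_linear_order_on U L"
    and xs: "distinct xs" "set xs \<subseteq> U"
  shows "set (insertion_sort B xs) = set xs \<and> sorted_wrt (\<lambda>x y. (x, y) \<in> L) (insertion_sort B xs)"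
  using xs
proof (induction xs)
  case (Cons x xs)
  have eq: "insertion_sort B (x # xs) = insert_sorted B x (insertion_sort B xs)"
    by (simp add: insertion_sort_def)
  have "sorted_wrt (\<lambda>x y. (x, y) \<in> L) (insert_sorted B x (insertion_sort B xs))"
    by (rule sorted_insert_sorted[OF B L]) (use Cons in auto)
  then show ?case using Cons by (simp add: eq set_insert_sorted)
qed (simp add: insertion_sort_def)

lemma numbers_correct: "set (numbers n) = {..<n} \<and> distinct (numbers n)"
proof (induction n)
  case (Suc n)
  have "numbers (Suc n) = n # numbers n" by (simp add: numbers_def)
  then show ?case using Suc by (simp add: lessThan_Suc)
qed (simp add: numbers_def)

lemma search_first_success:
  assumes "j \<le> n" "attempt (same_entry T) (Suc j) X \<noteq> []"
  shows "\<exists>i\<le>j. search T X n = attempt (same_entry T) (Suc i) X \<and> attempt (same_entry T) (Suc i) X \<noteq> []"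
  using assms
proof (induction n arbitrary: j)
  case 0
  then show ?case by (auto simp: search_def)
next
  case (Suc n)
  have rec: "search T X (Suc n) = (if search T X n = [] then attempt (same_entry T) (Suc (Suc n)) X else search T X n)"
    by (simp add: search_def)
  show ?case
  proof (cases "j \<le> n")
    case True
    then show ?thesis using Suc.IH[of j] Suc.prems rec by auto
  next
    case False
    then have j: "j = Suc n" using Suc.prems by simp
    show ?thesis
    proof (cases "search T X n = []")
      case True
      then show ?thesis using rec j Suc.prems by auto
    next
      case False
      have "\<exists>i\<le>n. search T X n = attempt (same_entry T) (Suc i) X"
        by (induction n) (auto simp: search_def intro: le_SucI)
      then show ?thesis using rec j False by (metis le_SucI)
    qed
  qed
qed

lemma width_bound:
  fixes l m q :: nat
  assumes l: "1 \<le> l" "l \<le> m"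
  defines "N \<equiv> l * ((4 ^ (q + 1)) ^ l) ^ (l * l * l)"
  shows "2 * N + l * l * l * (2 * N) \<le> (2 :: nat) ^ ((2 * q + 5) * m ^ 4)"
proof -
  have p: "l \<le> l ^ 4" "l * l * l \<le> l ^ 4" "1 \<le> l ^ 4"
    using l(1) power_increasing[of 1 4 l] power_increasing[of 3 4 l] by (auto simp: power3_eq_cube)
  have N: "N = l * 2 ^ ((2 * q + 2) * l ^ 4)"
  proof -
    have "(4 :: nat) = 2 ^ 2" by simp
    then have "(4 :: nat) ^ (q + 1) = 2 ^ (2 * q + 2)"
      by (metis distrib_left mult.right_neutral power_mult)
    then have "((4 ^ (q + 1)) ^ l) ^ (l * l * l) = (2 :: nat) ^ ((2 * q + 2) * (l * (l * l * l)))"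
      by (simp only: power_mult)
    moreover have "l * (l * l * l) = l ^ 4" by (simp add: eval_nat_numeral)
    ultimately show ?thesis unfolding N_def by simp
  qed
  have "2 * N + l * l * l * (2 * N) = 2 * (l * (2 ^ ((2 * q + 2) * l ^ 4) * (1 + l * l * l)))"
    unfolding N by (simp add: algebra_simps)
  also have "\<dots> \<le> 2 ^ 1 * (2 ^ l * (2 ^ ((2 * q + 2) * l ^ 4) * 2 ^ (l * l * l)))"
  proof -
    have "l \<le> 2 ^ l" "1 + l * l * l \<le> 2 ^ (l * l * l)"
      using less_exp[of l] less_exp[of "l * l * l"] by linarith+
    then show ?thesis by (intro mult_le_mono) simp_all
  qed
  also have "\<dots> = 2 ^ (1 + (l + ((2 * q + 2) * l ^ 4 + l * l * l)))"
    by (simp only: power_add)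
  also have "\<dots> \<le> 2 ^ ((2 * q + 5) * l ^ 4)"
    using p by (intro power_increasing) (auto simp: algebra_simps)
  also have "\<dots> \<le> 2 ^ ((2 * q + 5) * m ^ 4)"
    using l by (intro power_increasing mult_left_mono power_mono) auto
  finally show ?thesis .
qed

text \<open>Parameter \<open>n + 1\<close> always succeeds. In particular there is a contraction sequence, so the twin-width
  \<open>k\<close> is attained by some sequence; this in turn makes parameter \<open>2 * k + 2\<close> succeed.\<close>

lemma find_sequence_witness:
  assumes G: "ordered_binary_structure u b G" "universe G = {..<n}"
  defines "k \<equiv> struct_twin_width G"
  shows "twin_width_witness G (2 ^ ((2 * (u + b) + 5) * (2 * k + 2) ^ 4))
    (partitions_of (find_sequence (tables_of G)))"
proof -
  let ?M = "entry (matrix_encoding G)" and ?U = "universe G" and ?L = "less_rel G"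
  let ?\<Sigma> = "{xs. set xs \<subseteq> {-1, 0, 1, 2} \<and> length xs = u + b}" and ?\<alpha> = "4 ^ (u + b + 1)"
  let ?T = "tables_of G" and ?s = "\<lambda>x y x' y'. ?M x y = ?M x' y'"
  define X where "X = insertion_sort (fst (snd ?T)) (numbers (fst ?T))"
  have n: "card ?U = n" "fst ?T = n" using G(2) by (auto simp: tables_of_def Let_def)
  have s: "same_entry ?T = ?s" by (intro ext) (rule same_entry_tables_of[OF G])
  have "table_at (fst (snd ?T)) x y \<longleftrightarrow> (x, y) \<in> ?L" for x y
    using table_at_relation_table[of ?L n x y] G by (auto simp: tables_of_def Let_def ordered_binary_structure_def)
  then have X: "set X = ?U" "sorted_wrt (\<lambda>x y. (x, y) \<in> ?L) X"
    using insertion_sort_correct[of "fst (snd ?T)" ?L ?U "numbers n"] numbers_correct[of n] G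
    by (auto simp: X_def n ordered_binary_structure_def)
  have enc: "ordered_matrix.matrix_of ?M ?U ?L = matrix_encoding G" 
  proof -
    interpret bounded_alphabet ?M ?U ?L ?\<Sigma> ?\<alpha> 1
      by (rule bounded_alphabet_matrix_encoding[OF G(1)]) simp
    show ?thesis unfolding matrix_of_def by (simp add: matrix_encoding_def)
  qed
  let ?N = "\<lambda>l. l * (?\<alpha> ^ l) ^ (l * l * l)"
  have found: "pe_sequence (matrix_encoding G) (2 * ?N l) (l * l * l * (2 * ?N l))
      (map as_partitions (attempt ?s l X))" if "1 \<le> l" "attempt ?s l X \<noteq> []" for l
  proof -
    interpret bounded_alphabet ?M ?U ?L ?\<Sigma> ?\<alpha> l
      by (rule bounded_alphabet_matrix_encoding[OF G(1) that(1)])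
    show ?thesis using attempt_result(1)[OF X(2,1) that(2)] unfolding enc max_classes_def .
  qed
  have large: "attempt ?s (Suc n) X \<noteq> []"
  proof -
    interpret bounded_alphabet ?M ?U ?L ?\<Sigma> ?\<alpha> "Suc n"
      by (rule bounded_alphabet_matrix_encoding[OF G(1)]) simp
    show ?thesis using attempt_result(2)[OF X(2,1)] no_rich_division_if_large n by simp
  qed
  have ex: "\<exists>d p e Ps. d = p + e \<and> pe_sequence (matrix_encoding G) p e Ps"
    by (intro exI conjI, rule refl, rule found[OF _ large]) simp
  have "\<exists>p e Ps. k = p + e \<and> pe_sequence (matrix_encoding G) p e Ps"
    unfolding k_def struct_twin_width_def twin_width_def by (rule LeastI_ex[OF ex])
  then obtain p e Ps where k: "k = p + e" and pe: "pe_sequence (matrix_encoding G) p e Ps" by blast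
  \<comment> \<open>The sequence that attains the twin-width rules out rich divisions at parameter \<open>2 * k + 2\<close>.\<close>
  have small: "attempt ?s (Suc (2 * k + 1)) X \<noteq> []"
  proof -
    interpret bounded_alphabet ?M ?U ?L ?\<Sigma> ?\<alpha> "Suc (2 * k + 1)"
      by (rule bounded_alphabet_matrix_encoding[OF G(1)]) simp
    show ?thesis using attempt_result(2)[OF X(2,1)] no_rich_division_if_pe_sequence[unfolded enc, OF pe] k by simp
  qed
  have "attempt (same_entry ?T) (Suc (min n (2 * k + 1))) X \<noteq> []"
    using large small unfolding s min_def by (auto split: if_splits)
  moreover have fs: "find_sequence ?T = search ?T X n" by (simp add: find_sequence_def X_def n)
  ultimately obtain i where i: "i \<le> min n (2 * k + 1)" "find_sequence ?T = attempt ?s (Suc i) X" "attempt ?s (Suc i) X \<noteq> []"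
    using search_first_success[of "min n (2 * k + 1)" n ?T X]
    unfolding fs s by auto
  have "partitions_of (find_sequence ?T) = map as_partitions (attempt ?s (Suc i) X)"
    unfolding i partitions_of_def by (simp add: case_prod_beta)
  moreover have "2 * ?N (Suc i) + Suc i * Suc i * Suc i * (2 * ?N (Suc i)) \<le>
      2 ^ ((2 * (u + b) + 5) * (2 * k + 2) ^ 4)"
    using i(1) by (intro width_bound) auto
  ultimately show ?thesis
    unfolding twin_width_witness_def using found[OF _ i(3)] by fastforce
qed

lemma computable_const: "computable (\<lambda>_. m)"
proof -
  have "ptime [enc_nat] (\<lambda>_. enc_nat m)" by (induction m) (auto intro: ptime_0 ptime_Suc)
  then show ?thesis unfolding computable_def by (rule ptime_program) blast
qed

theorem theorem2:
  fixes u b :: nat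
  shows "\<exists>(\<pi> :: program) (f :: nat \<Rightarrow> nat) (c :: nat) (g :: nat \<Rightarrow> nat).
    computable f \<and>
    (\<lambda>k. real (g k)) \<in> O(\<lambda>k. real k ^ 4) \<and>
    (\<forall>(G :: nat ostruct) (k :: nat).
       ordered_binary_structure u b G \<and> (\<exists>n. universe G = {..<n}) \<and> struct_twin_width G = k \<longrightarrow>
       (\<exists>(ws :: listed_sequence) (t :: nat).
          runs \<pi> (enc_struct G) (enc_sequence ws) t \<and>
          t \<le> f k * card (universe G) ^ c \<and>
          twin_width_witness G (2 ^ g k) (partitions_of ws)))"
proof -
  obtain \<pi> c where \<pi>: "\<And>T. \<exists>t. runs \<pi> (enc_tables T) (enc_sequence (find_sequence T)) t \<and>
      t \<le> (size (enc_tables T) + 2) ^ c"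
    using ptime_program[OF ptime_find_sequence] by blast
  define g where "g k = (2 * (u + b) + 5) * (2 * k + 2) ^ 4" for k
  \<comment> \<open>Every parameter up to \<open>n + 1\<close> is tried at most once, so the time is polynomial in \<open>n\<close> alone and the
    factor that may depend on the twin-width is a constant.\<close>
  define m where "m = (10 + 3 * u + 4 * b) ^ c"
  have "(\<lambda>k. real (g k)) \<in> O(\<lambda>k. real k ^ 4)"
  proof (rule bigoI[of _ "real ((2 * (u + b) + 5) * 256)"], rule eventually_at_top_linorderI[of 1])
    fix k :: nat assume "1 \<le> k"
    then have "(2 * k + 2) ^ 4 \<le> (4 * k) ^ 4" by (intro power_mono) auto
    then have "g k \<le> (2 * (u + b) + 5) * (256 * k ^ 4)"
      unfolding g_def by (intro mult_left_mono) (auto simp: power_mult_distrib)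
    then have "real (g k) \<le> real ((2 * (u + b) + 5) * 256) * real k ^ 4"
      by (simp only: mult.assoc[symmetric] of_nat_mult[symmetric] of_nat_power[symmetric] of_nat_le_iff)
    then show "norm (real (g k)) \<le> real ((2 * (u + b) + 5) * 256) * norm (real k ^ 4)"
      by (simp del: of_nat_mult of_nat_add)
  qed
  moreover have "\<exists>ws t. runs \<pi> (enc_struct G) (enc_sequence ws) t \<and> t \<le> m * card (universe G) ^ (2 * c) \<and>
      twin_width_witness G (2 ^ g k) (partitions_of ws)"
    if G: "ordered_binary_structure u b G" "universe G = {..<n}" and k: "struct_twin_width G = k" for G k n
  proof -
    obtain t where t: "runs \<pi> (enc_struct G) (enc_sequence (find_sequence (tables_of G))) t"
      "t \<le> (size (enc_struct G) + 2) ^ c"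
      unfolding enc_struct_eq_enc_tables using \<pi> by blast
    have "length (unary G) = u" "length (binary G) = b" "1 \<le> card (universe G)"
      using G(1) by (auto simp: ordered_binary_structure_def Suc_le_eq card_gt_0_iff)
    then have "(size (enc_struct G) + 2) ^ c \<le> ((10 + 3 * u + 4 * b) * card (universe G) ^ 2) ^ c"
      by (intro power_mono size_enc_struct) auto
    then have "t \<le> m * card (universe G) ^ (2 * c)"
      using t(2) by (simp add: m_def power_mult_distrib power_mult)
    then show ?thesis using t(1) find_sequence_witness[OF G] k unfolding g_def by blast
  qed
  ultimately show ?thesis using computable_const[of m] by blast
qed

end
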